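(* Let $\alpha,\lambda>0$ and $f\in L^2(\Omega)$. Let $(u,v)\in BV(\Omega)\times H$ be an optimal decomposition of $f$, i.e. a minimizer of $$F(u,v)=|u|_{BV(\Omega)}+\frac{\alpha}{2}\int_\Omega|f-u-v|^2\,dx+\lambda\|v\|_{\mathrm{Lip}^*}$$ over all $(u,v)\in BV(\Omega)\times H$ with $\int_\Omega f\,dx=\int_\Omega u\,dx$, and denote $w=f-u-v$. Then: 1. $\|f\|_{*,\lambda}\le\frac1\alpha$ if and only if $u=0$, $v=0$ and $w=f$. 2. Assume $\|f\|_{*,\lambda}>\frac1\alpha$. Then $(u,v)$ is characterized by the two conditions $$\|w\|_{*,\lambda}=\frac1\alpha,\qquad \langle w,u+v\rangle=\frac1\alpha\left(|u|_{BV(\Omega)}+\lambda\|v\|_{\mathrm{Lip}^*}\right);$$ that is, a pair $(u,v)\in BV(\Omega)\times H$ is an optimal decomposition of $f$ if and only if $w=f-u-v$ satisfies these two conditions.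
   Context: $\Omega=[0,L]^2\subset\mathbb{R}^2$ ($L>0$) is the image domain. $BV(\Omega)$ is the space of (real-valued) functions of bounded variation on $\Omega$, and $|u|_{BV(\Omega)}=\int_\Omega|\nabla u|$ is the total variation of $u$. $H=\{v\in L^1(\Omega):\int_\Omega v(x)\,dx=0\}$. For $v\in H$ the dual Lipschitz norm is $$\|v\|_{\mathrm{Lip}^*}=\sup_\phi\left\{\int_\Omega\phi\,v\,dx:\ \mathrm{Lip}(\phi)\le 1\right\},\qquad \mathrm{Lip}(\phi)=\sup\left\{\frac{|\phi(x)-\phi(y)|}{|x-y|}:x,y\in\Omega,\ x\ne y\right\};$$ equivalently $\|v\|_{\mathrm{Lip}^*}=\inf_m\{\||m|\|_{L^1}:\mathrm{div}(m)=v\}$, where $m=(m_1,m_2)$ is a vector field with zero flux through $\partial\Omega$ and $|m|=\sqrt{m_1^2+m_2^2}$. The energy $F(u,v)$ takes the value $+\infty$ when $f-u-v\notin L^2(\Omega)$. For $w\in L^2(\Omega)$ define, with values in $[0,+\infty]$, $$\|w\|_{*,\lambda}=\sup_{g\in BV(\Omega),\,h\in H}\frac{\langle w,g+h\rangle}{|g|_{BV(\Omega)}+\lambda\|h\|_{\mathrm{Lip}^*}},\qquad |g|_{BV(\Omega)}+\lambda\|h\|_{\mathrm{Lip}^*}\neq0,$$ where $\langle\cdot,\cdot\rangle$ is the $L^2(\Omega)$ inner product; the supremum is taken over those $h\in H$ that also lie in $L^2(\Omega)$, so that the inner product is defined. The two conditions in item 2 are understood to include $w\in L^2(\Omega)$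.
   Formalization: Item 2 also assumes that f minus its mean has ‖·‖_{*,λ} ≥ 1/α (automatic if f has mean 0); without it item 2 fails, e.g. for f = 1, where (1,0) is optimal with w = 0, and it fails for every f so excluded. *)

theory Defs
  imports "HOL-Analysis.Analysis"
begin

text \<open>
  Functions on the closed square are represented by functions on the whole plane, of which only the
  values on the square matter; elements of the Lebesgue spaces are representatives, so that
  equality of functions is equality almost everywhere.
\<close>

definition square :: "real \<Rightarrow> (real^2) set" where
  "square L = cbox 0 (\<chi> i. L)"

abbreviation leb :: "real \<Rightarrow> (real^2) measure" where
  "leb L \<equiv> lebesgue_on (square L)"

definition L1 :: "real \<Rightarrow> (real^2 \<Rightarrow> real) set" where
  "L1 L = {u. integrable (leb L) u}"

definition L2 :: "real \<Rightarrow> (real^2 \<Rightarrow> real) set" where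
  "L2 L = {u. u \<in> borel_measurable (leb L) \<and> integrable (leb L) (\<lambda>x. (u x)\<^sup>2)}"

definition L2_inner :: "real \<Rightarrow> (real^2 \<Rightarrow> real) \<Rightarrow> (real^2 \<Rightarrow> real) \<Rightarrow> real" where
  "L2_inner L u v = (\<integral>x. u x * v x \<partial>leb L)"

definition mean :: "real \<Rightarrow> (real^2 \<Rightarrow> real) \<Rightarrow> real" where
  "mean L u = (\<integral>x. u x \<partial>leb L) / L\<^sup>2"

definition C1_compact_support :: "(real^2) set \<Rightarrow> (real^2 \<Rightarrow> real^2) set" where
  "C1_compact_support U = {p.
     (\<exists>p' :: real^2 \<Rightarrow> (real^2) \<Rightarrow>\<^sub>L (real^2).
        (\<forall>x. (p has_derivative blinfun_apply (p' x)) (at x)) \<and> continuous_on UNIV p') \<and>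
     compact (closure {x. p x \<noteq> 0}) \<and> closure {x. p x \<noteq> 0} \<subseteq> U}"

definition divergence :: "(real^2 \<Rightarrow> real^2) \<Rightarrow> real^2 \<Rightarrow> real" where
  "divergence p x = (\<Sum>i\<in>UNIV. frechet_derivative p (at x) (axis i 1) $ i)"

text \<open>
  For a function of bounded variation, \<open>\<integral>\<bar>\<nabla>u\<bar>\<close> denotes the total mass of the vector measure
  \<open>\<nabla>u\<close>, which is defined by duality with the test fields on the interior of the square.
\<close>

definition total_variation :: "real \<Rightarrow> (real^2 \<Rightarrow> real) \<Rightarrow> ereal" where
  "total_variation L u =
     (SUP p \<in> {p \<in> C1_compact_support (interior (square L)). \<forall>x. norm (p x) \<le> 1}.
        ereal (\<integral>x. u x * divergence p x \<partial>leb L))"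

definition BV :: "real \<Rightarrow> (real^2 \<Rightarrow> real) set" where
  "BV L = {u \<in> L1 L. total_variation L u < \<infinity>}"

definition H :: "real \<Rightarrow> (real^2 \<Rightarrow> real) set" where
  "H L = {v \<in> L1 L. (\<integral>x. v x \<partial>leb L) = 0}"

definition Lip_dual_norm :: "real \<Rightarrow> (real^2 \<Rightarrow> real) \<Rightarrow> ereal" where
  "Lip_dual_norm L v =
     (SUP \<phi> \<in> {\<phi> :: real^2 \<Rightarrow> real. 1-lipschitz_on (square L) \<phi>}.
        ereal (\<integral>x. \<phi> x * v x \<partial>leb L))"

text \<open>
  The regularizer is finite on \<open>BV L \<times> H L\<close>, so the quotients below are quotients of a real
  number by a positive real number. In two dimensions \<open>BV L \<subseteq> L2 L\<close>, so the condition that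
  \<open>h\<close> is square integrable is all that is needed for the inner product to make sense.

  Pitfall: constants have total variation 0, so \<open>star_norm L lam w = \<infinity>\<close> whenever \<open>w\<close> has nonzero
  mean. Hence \<open>star_norm L lam f > 1 / \<alpha>\<close> alone does not exclude that \<open>(mean L f, 0)\<close> is optimal with a
  residual \<open>f - mean L f\<close> of \<open>star_norm\<close> below \<open>1 / \<alpha>\<close> (take \<open>f = 1\<close>, with residual 0).
\<close>

definition regularizer ::
  "real \<Rightarrow> real \<Rightarrow> (real^2 \<Rightarrow> real) \<Rightarrow> (real^2 \<Rightarrow> real) \<Rightarrow> ereal" where
  "regularizer L lam g h = total_variation L g + ereal lam * Lip_dual_norm L h"

definition star_norm :: "real \<Rightarrow> real \<Rightarrow> (real^2 \<Rightarrow> real) \<Rightarrow> ereal" where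
  "star_norm L lam w =
     (SUP (g, h) \<in> {(g, h). g \<in> BV L \<and> h \<in> H L \<and> h \<in> L2 L \<and> regularizer L lam g h \<noteq> 0}.
        ereal (L2_inner L w (\<lambda>x. g x + h x)) / regularizer L lam g h)"

definition energy ::
  "real \<Rightarrow> real \<Rightarrow> real \<Rightarrow> (real^2 \<Rightarrow> real) \<Rightarrow> (real^2 \<Rightarrow> real) \<Rightarrow> (real^2 \<Rightarrow> real) \<Rightarrow> ereal" where
  "energy L \<alpha> lam f u v =
     (if (\<lambda>x. f x - u x - v x) \<in> L2 L
      then total_variation L u + ereal (\<alpha> / 2 * (\<integral>x. (f x - u x - v x)\<^sup>2 \<partial>leb L))
             + ereal lam * Lip_dual_norm L v
      else \<infinity>)"

definition admissible ::
  "real \<Rightarrow> (real^2 \<Rightarrow> real) \<Rightarrow> (real^2 \<Rightarrow> real) \<Rightarrow> (real^2 \<Rightarrow> real) \<Rightarrow> bool" where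
  "admissible L f u v \<longleftrightarrow>
     u \<in> BV L \<and> v \<in> H L \<and> (\<integral>x. f x \<partial>leb L) = (\<integral>x. u x \<partial>leb L)"

definition optimal_decomposition ::
  "real \<Rightarrow> real \<Rightarrow> real \<Rightarrow> (real^2 \<Rightarrow> real) \<Rightarrow> (real^2 \<Rightarrow> real) \<Rightarrow> (real^2 \<Rightarrow> real) \<Rightarrow> bool" where
  "optimal_decomposition L \<alpha> lam f u v \<longleftrightarrow>
     admissible L f u v \<and>
     (\<forall>u' v'. admissible L f u' v' \<longrightarrow> energy L \<alpha> lam f u v \<le> energy L \<alpha> lam f u' v')"

end

theory Submission
  imports Defs
begin

text \<open>
  Write \<open>J(g, h) = |g|\<^sub>B\<^sub>V + lam * |h|\<^sub>L\<^sub>i\<^sub>p\<close> for the regularizer and \<open>w = f - u - v\<close> for the residual. The theorem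
  expresses the optimality conditions of a convex problem whose objective is the positively homogeneous
  function \<open>J\<close> plus a quadratic term. Perturbing a minimizer \<open>(u, v)\<close> in the direction of an arbitrary pair
  \<open>(g, h)\<close> gives \<open>\<alpha> \<langle>w, g + h\<rangle> \<le> J(g, h)\<close>, and perturbing it in the directions \<open>(u, v)\<close> and \<open>- (u, v)\<close> gives
  \<open>\<alpha> \<langle>w, u + v\<rangle> = J(u, v)\<close>; conversely these two conditions imply minimality by convexity. The mean of \<open>u\<close> is
  prescribed, but perturbations may be corrected by constants, which have no variation and are orthogonal
  to the residual (\<open>optimal_imp_dual_conditions\<close>, \<open>dual_conditions_imp_optimal\<close>).

  The first condition says that the star norm of \<open>w\<close> is at most \<open>1 / \<alpha>\<close> (\<open>star_norm_le_imp_dual_bounded\<close>,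
  \<open>dual_bounded_imp_star_norm_le\<close>). If \<open>f\<close> itself satisfies it, then testing \<open>f\<close> and \<open>w\<close> with their difference
  \<open>u + v\<close> shows \<open>u + v = 0\<close>, so \<open>J(u, v) = 0\<close> and both functions vanish. In the second part the pair \<open>(u, v)\<close>
  attains the norm as soon as \<open>J(u, v) > 0\<close>. If \<open>J(u, v) = 0\<close>, then \<open>u\<close> is the mean of \<open>f\<close> and \<open>v = 0\<close>, and the
  lower bound is the assumption about \<open>f\<close> minus its mean.

  Three analytic facts make this rigorous. A function of mean 0 with vanishing dual Lipschitz norm is 0
  (\<open>lipd_eq_0_imp_AE_0\<close>). A function of vanishing total variation is constant, and every BV function on the
  square is square integrable. The embedding is essential: finite energy only makes \<open>u + v\<close> square
  integrable, while the star norm is tested with a square integrable \<open>h\<close>, so \<open>v\<close> can serve as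
  such a test function only because \<open>u\<close> is square integrable.

  Both statements about BV follow from a Poincare-Sobolev inequality (\<open>poincare_sobolev\<close>), whose proof
  avoids mollification and Fubini's theorem. The function \<open>u\<close> is integrated against tensor products of
  quadratic B-splines on a grid. Differences of neighbouring coefficients are integrals of \<open>u\<close> against partial
  derivatives of tensor products with cubic B-splines, so the total variation bounds the variation of
  the coefficients along the grid lines (\<open>spline_coeff_variation\<close>). A combinatorial inequality on the grid
  then bounds their oscillation in the square mean (\<open>discrete_poincare_sobolev\<close>), and letting the mesh
  width tend to 0 in a dual formulation gives the inequality for \<open>u\<close>.
\<close>

section \<open>Integrals over the square\<close>

lemma square_lmeasurable: "square L \<in> lmeasurable"
  by (simp add: square_def lmeasurable_cbox)

lemma sets_square: "square L \<in> sets lebesgue"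
  using square_lmeasurable by (rule fmeasurableD)

lemma finite_measure_leb: "finite_measure (leb L)"
  by (rule finite_measure_lebesgue_on[OF square_lmeasurable])

lemma mem_square: "x \<in> square L \<longleftrightarrow> (\<forall>i. 0 \<le> x $ i \<and> x $ i \<le> L)"
  by (simp add: square_def mem_box_cart)

lemma mem_interior_square: "x \<in> interior (square L) \<longleftrightarrow> (\<forall>i. 0 < x $ i \<and> x $ i < L)"
  by (simp add: square_def interior_cbox mem_box_cart)

lemma compact_square: "compact (square L)"
  by (simp add: square_def compact_cbox)

lemma measure_square:
  assumes "L > 0"
  shows "measure (leb L) (square L) = L\<^sup>2"
proof -
  have "cbox 0 (\<chi> i. L) \<noteq> ({} :: (real^2) set)"
    using assms by (simp add: interval_ne_empty_cart less_imp_le)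
  then have "measure lebesgue (square L) = L\<^sup>2"
    by (simp add: square_def content_cbox_cart power2_eq_square UNIV_2)
  then show ?thesis
    by (simp add: measure_restrict_space sets_square)
qed

lemma measurable_leb_continuous:
  fixes \<phi> :: "real^2 \<Rightarrow> 'a::euclidean_space"
  assumes "continuous_on (square L) \<phi>"
  shows "\<phi> \<in> borel_measurable (leb L)"
  by (rule continuous_imp_measurable_on_sets_lebesgue[OF assms sets_square])

lemma AE_leb_interior: "AE x in leb L. x \<in> interior (square L)"
proof -
  have "negligible (square L - interior (square L))"
    unfolding square_def interior_cbox by (rule negligible_frontier_interval)
  then have "AE x in lebesgue. x \<notin> square L - interior (square L)"
    using AE_not_in negligible_iff_null_sets by blast
  then show ?thesis
    by (subst AE_restrict_space_iff) (auto simp: sets_square)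
qed

lemma integrable_bounded_mult:
  fixes \<phi> u :: "'a \<Rightarrow> real"
  assumes u: "integrable M u" and \<phi>: "\<phi> \<in> borel_measurable M"
    and bound: "\<And>x. x \<in> space M \<Longrightarrow> \<bar>\<phi> x\<bar> \<le> K"
  shows "integrable M (\<lambda>x. \<phi> x * u x)"
proof (rule Bochner_Integration.integrable_bound)
  show "integrable M (\<lambda>x. K * u x)" using u by simp
  show "(\<lambda>x. \<phi> x * u x) \<in> borel_measurable M"
    using u \<phi> by (auto intro: borel_measurable_times borel_measurable_integrable)
  show "AE x in M. norm (\<phi> x * u x) \<le> norm (K * u x)"
  proof (rule AE_I2)
    fix x assume "x \<in> space M"
    from bound[OF this] have "\<bar>\<phi> x\<bar> \<le> \<bar>K\<bar>" by linarith
    then show "norm (\<phi> x * u x) \<le> norm (K * u x)"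
      by (simp add: abs_mult mult_right_mono)
  qed
qed

lemma integrable_continuous_mult:
  fixes \<phi> u :: "real^2 \<Rightarrow> real"
  assumes u: "integrable (leb L) u" and \<phi>: "continuous_on (square L) \<phi>"
  shows "integrable (leb L) (\<lambda>x. \<phi> x * u x)"
proof -
  obtain K where K: "\<And>x. x \<in> square L \<Longrightarrow> norm (\<phi> x) \<le> K"
    using compact_imp_bounded[OF compact_continuous_image[OF \<phi> compact_square]]
    by (auto simp: bounded_iff)
  show ?thesis
    by (rule integrable_bounded_mult[OF u measurable_leb_continuous[OF \<phi>], of K])
       (use K in auto)
qed

text \<open>
  The form of dominated convergence that serves all the approximations below: the factor \<open>u\<close> is a fixed
  integrable function, and the test functions \<open>\<psi> n\<close> converge boundedly.
\<close>

lemma tendsto_integral_bounded_mult: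
  fixes u :: "'a \<Rightarrow> real"
  assumes u: "integrable M u"
    and meas: "\<And>n. \<psi> n \<in> borel_measurable M" "\<phi> \<in> borel_measurable M"
    and lim: "AE x in M. (\<lambda>n. \<psi> n x) \<longlonglongrightarrow> \<phi> x"
    and bound: "\<And>n x. x \<in> space M \<Longrightarrow> \<bar>\<psi> n x\<bar> \<le> K"
  shows "(\<lambda>n. \<integral>x. \<psi> n x * u x \<partial>M) \<longlonglongrightarrow> (\<integral>x. \<phi> x * u x \<partial>M)"
proof (rule integral_dominated_convergence[where w = "\<lambda>x. K * \<bar>u x\<bar>"])
  show "(\<lambda>x. \<phi> x * u x) \<in> borel_measurable M" "\<And>n. (\<lambda>x. \<psi> n x * u x) \<in> borel_measurable M"
    using u meas by (auto intro: borel_measurable_times borel_measurable_integrable)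
  show "integrable M (\<lambda>x. K * \<bar>u x\<bar>)" using u by simp
  show "AE x in M. (\<lambda>n. \<psi> n x * u x) \<longlonglongrightarrow> \<phi> x * u x"
    using lim by eventually_elim (intro tendsto_intros)
  show "AE x in M. norm (\<psi> n x * u x) \<le> K * \<bar>u x\<bar>" for n
    using bound by (auto intro!: AE_I2 mult_right_mono simp: abs_mult)
qed

lemma integrable_const_leb: "integrable (leb L) (\<lambda>x. c :: real)"
  using finite_measure.integrable_const[OF finite_measure_leb] .

lemma integral_const_leb:
  assumes "L > 0" shows "(\<integral>x. c \<partial>leb L) = c * L\<^sup>2"
  using measure_square[OF assms] by simp

lemma L2_integrable_mult:
  assumes "u \<in> L2 L" "v \<in> L2 L"
  shows "integrable (leb L) (\<lambda>x. u x * v x)"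
proof (rule Bochner_Integration.integrable_bound)
  show "integrable (leb L) (\<lambda>x. (u x)\<^sup>2 + (v x)\<^sup>2)" using assms by (auto simp: L2_def)
  show "(\<lambda>x. u x * v x) \<in> borel_measurable (leb L)" using assms by (auto simp: L2_def)
  show "AE x in leb L. norm (u x * v x) \<le> norm ((u x)\<^sup>2 + (v x)\<^sup>2)"
  proof (intro AE_I2)
    fix x
    have "2 * \<bar>u x * v x\<bar> \<le> (u x)\<^sup>2 + (v x)\<^sup>2"
      using sum_squares_bound[of "\<bar>u x\<bar>" "\<bar>v x\<bar>"] by (simp add: abs_mult)
    then show "norm (u x * v x) \<le> norm ((u x)\<^sup>2 + (v x)\<^sup>2)" by auto
  qed
qed

lemma L2_add: "u \<in> L2 L \<Longrightarrow> v \<in> L2 L \<Longrightarrow> (\<lambda>x. u x + v x) \<in> L2 L"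
  using L2_integrable_mult[of u L v]
  by (auto simp: L2_def power2_sum mult.assoc)

lemma L2_scale: "u \<in> L2 L \<Longrightarrow> (\<lambda>x. c * u x) \<in> L2 L"
  by (auto simp: L2_def power_mult_distrib)

lemma L2_diff: "u \<in> L2 L \<Longrightarrow> v \<in> L2 L \<Longrightarrow> (\<lambda>x. u x - v x) \<in> L2 L"
  using L2_add[of u L "\<lambda>x. (-1) * v x"] L2_scale[of v L "-1"] by simp

lemma L2_const: "(\<lambda>x. c) \<in> L2 L"
  using integrable_const_leb by (auto simp: L2_def)

lemma L2_imp_integrable: "u \<in> L2 L \<Longrightarrow> integrable (leb L) u"
  using L2_integrable_mult[OF _ L2_const[of 1]] by simp

section \<open>Total variation\<close>

abbreviation test_fields :: "real \<Rightarrow> (real^2 \<Rightarrow> real^2) set" where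
  "test_fields L \<equiv> {p \<in> C1_compact_support (interior (square L)). \<forall>x. norm (p x) \<le> 1}"

text \<open>
  The test fields are given by an existential statement about a continuous derivative; this lemma
  fixes that derivative and identifies the divergence with its trace. The derivative vanishes off the
  closed support because the field vanishes identically near such points.
\<close>

lemma C1_compact_support_derivative:
  assumes "p \<in> C1_compact_support U"
  obtains p' where "\<And>x. (p has_derivative blinfun_apply (p' x)) (at x)" "continuous_on UNIV p'"
    "\<And>x. divergence p x = (\<Sum>i\<in>UNIV. blinfun_apply (p' x) (axis i 1) $ i)"
    "\<And>x. x \<notin> closure {x. p x \<noteq> 0} \<Longrightarrow> p' x = 0"
proof -
  obtain p' where p': "\<And>x. (p has_derivative blinfun_apply (p' x)) (at x)" "continuous_on UNIV p'"
    using assms by (auto simp: C1_compact_support_def)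
  have "frechet_derivative p (at x) = blinfun_apply (p' x)" for x
    using frechet_derivative_at[OF p'(1)] by simp
  then have div: "divergence p x = (\<Sum>i\<in>UNIV. blinfun_apply (p' x) (axis i 1) $ i)" for x
    by (simp add: divergence_def)
  have zero: "p' x = 0" if x: "x \<notin> closure {x. p x \<noteq> 0}" for x
  proof -
    have "(p has_derivative (\<lambda>_. 0)) (at x)"
    proof (rule has_derivative_transform_within_open[where f = "\<lambda>_. 0"])
      show "open (- closure {x. p x \<noteq> 0})" by (rule open_Compl[OF closed_closure])
      show "x \<in> - closure {x. p x \<noteq> 0}" using x by simp
      show "0 = p y" if "y \<in> - closure {x. p x \<noteq> 0}" for y
        using that closure_subset[of "{x. p x \<noteq> 0}"] by auto
    qed simp
    then have "blinfun_apply (p' x) = (\<lambda>_. 0)" using has_derivative_unique p'(1) by blast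
    then show ?thesis by (simp add: blinfun_eqI)
  qed
  show thesis by (rule that[OF p' div zero])
qed

lemma continuous_on_divergence:
  assumes "p \<in> C1_compact_support U"
  shows "continuous_on S (divergence p)"
proof -
  obtain p' where "\<And>x. (p has_derivative blinfun_apply (p' x)) (at x)"
    and p': "continuous_on UNIV p'"
      "\<And>x. divergence p x = (\<Sum>i\<in>UNIV. blinfun_apply (p' x) (axis i 1) $ i)"
    and "\<And>x. x \<notin> closure {x. p x \<noteq> 0} \<Longrightarrow> p' x = 0"
    using C1_compact_support_derivative[OF assms] by blast
  have "continuous_on UNIV (\<lambda>x. \<Sum>i\<in>UNIV. blinfun_apply (p' x) (axis i 1) $ i)"
    by (intro continuous_intros p'(1))
  then have "continuous_on UNIV (divergence p)"
    by (simp flip: p'(2))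
  then show ?thesis by (rule continuous_on_subset) simp
qed

text \<open>
  The integral over the whole space is invariant under translation, so every difference quotient of
  \<open>q\<close> in direction \<open>e\<close> has integral 0. The quotients converge to the derivative, and the mean value
  theorem together with the compact support provides the dominating function.
\<close>

lemma integral_directional_derivative_eq_0:
  fixes q d :: "'a::euclidean_space \<Rightarrow> real"
  assumes deriv: "\<And>x. ((\<lambda>t. q (x + t *\<^sub>R e)) has_real_derivative d x) (at 0)"
    and q: "continuous_on UNIV q" and d: "continuous_on UNIV d"
    and K: "compact K" "\<And>x. x \<notin> K \<Longrightarrow> q x = 0" "\<And>x. x \<notin> K \<Longrightarrow> d x = 0"
  shows "(\<integral>x. d x \<partial>lborel) = 0"
proof -
  define D where "D n x = (q (x + (1 / real (Suc n)) *\<^sub>R e) - q x) * real (Suc n)" for n x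
  obtain R where R: "K \<subseteq> cball 0 R"
    using compact_imp_bounded[OF K(1)] by (auto simp: bounded_iff subset_iff)
  obtain M where M: "\<And>x. x \<in> K \<Longrightarrow> norm (d x) \<le> M"
    using compact_imp_bounded[OF compact_continuous_image[OF continuous_on_subset[OF d] K(1)]]
    by (auto simp: bounded_iff)
  have M': "\<bar>d x\<bar> \<le> \<bar>M\<bar>" for x
    using M[of x] K(3)[of x] by (cases "x \<in> K") auto
  have deriv': "((\<lambda>t. q (x + t *\<^sub>R e)) has_real_derivative d (x + t *\<^sub>R e)) (at t)" for x t
    using deriv[of "x + t *\<^sub>R e"] DERIV_shift[of "\<lambda>s. q (x + s *\<^sub>R e)" "d (x + t *\<^sub>R e)" 0 t]
    by (simp add: algebra_simps)
  have bound: "\<bar>D n x\<bar> \<le> \<bar>M\<bar>" for n x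
  proof -
    obtain s where "0 < s" "s < 1 / real (Suc n)"
      "q (x + (1 / real (Suc n)) *\<^sub>R e) - q (x + 0 *\<^sub>R e) = (1 / real (Suc n) - 0) * d (x + s *\<^sub>R e)"
      using MVT2[of 0 "1 / real (Suc n)" "\<lambda>t. q (x + t *\<^sub>R e)" "\<lambda>t. d (x + t *\<^sub>R e)"] deriv'
      by auto
    then have "D n x = d (x + s *\<^sub>R e)" unfolding D_def by (simp del: of_nat_Suc)
    then show ?thesis using M' by simp
  qed
  have supp: "D n x = 0" if "x \<notin> cball 0 (R + norm e)" for n x
  proof -
    have "norm ((1 / real (Suc n)) *\<^sub>R e) \<le> norm e"
      by (simp add: divide_le_eq mult_le_cancel_left1)
    moreover have "norm x > R + norm e" using that by simp
    moreover have "norm (x + (1 / real (Suc n)) *\<^sub>R e) \<ge> norm x - norm ((1 / real (Suc n)) *\<^sub>R e)"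
      by (rule norm_diff_ineq)
    ultimately have "norm (x + (1 / real (Suc n)) *\<^sub>R e) > R" "norm x > R"
      using norm_ge_zero[of e] by linarith+
    then have "x + (1 / real (Suc n)) *\<^sub>R e \<notin> K" "x \<notin> K" using R by (auto dest: subsetD)
    then show ?thesis by (simp add: D_def K(2))
  qed
  have intq: "integrable lborel q"
  proof -
    have "integrable lborel (\<lambda>x. indicator K x *\<^sub>R q x)"
      using K(1) q by (intro borel_integrable_compact) (auto intro: continuous_on_subset)
    moreover have "(\<lambda>x. indicator K x *\<^sub>R q x) = q" using K(2) by (auto simp: indicator_def fun_eq_iff)
    ultimately show ?thesis by simp
  qed
  have qm: "q \<in> borel_measurable borel" using q by (rule borel_measurable_continuous_onI)
  have shift: "integrable lborel (\<lambda>x. q (x + c))" "(\<integral>x. q (x + c) \<partial>lborel) = (\<integral>x. q x \<partial>lborel)" for c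
  proof -
    have "integrable (distr lborel borel ((+) c)) q" using intq by (simp add: lborel_distr_plus)
    then show "integrable lborel (\<lambda>x. q (x + c))"
      using qm by (subst (asm) integrable_distr_eq) (auto simp: add.commute)
    have "(\<integral>x. q x \<partial>distr lborel borel ((+) c)) = (\<integral>x. q (c + x) \<partial>lborel)"
      using qm by (subst integral_distr) auto
    then show "(\<integral>x. q (x + c) \<partial>lborel) = (\<integral>x. q x \<partial>lborel)"
      by (simp add: lborel_distr_plus add.commute)
  qed
  have D0: "(\<integral>x. D n x \<partial>lborel) = 0" for n
    unfolding D_def using shift intq by (simp add: Bochner_Integration.integral_diff)
  have lim: "(\<lambda>n. D n x) \<longlonglongrightarrow> d x" for x
  proof -
    have "((\<lambda>t. (q (x + t *\<^sub>R e) - q (x + 0 *\<^sub>R e)) / (t - 0)) \<longlongrightarrow> d x) (at 0)"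
      using deriv[of x] by (simp add: has_field_derivative_iff)
    moreover have "filterlim (\<lambda>n. 1 / real (Suc n)) (at 0) sequentially"
      using LIMSEQ_inverse_real_of_nat by (auto simp: filterlim_at inverse_eq_divide)
    ultimately have "(\<lambda>n. (q (x + (1 / real (Suc n)) *\<^sub>R e) - q (x + 0 *\<^sub>R e)) / (1 / real (Suc n) - 0)) \<longlonglongrightarrow> d x"
      by (rule filterlim_compose)
    then show ?thesis by (simp add: D_def)
  qed
  have "(\<lambda>n. \<integral>x. D n x \<partial>lborel) \<longlonglongrightarrow> (\<integral>x. d x \<partial>lborel)"
  proof (rule integral_dominated_convergence[where w = "\<lambda>x::'a. indicator (cball 0 (R + norm e)) x * \<bar>M\<bar>"])
    show "d \<in> borel_measurable lborel"
      using borel_measurable_continuous_onI[OF d] by simp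
    show "D n \<in> borel_measurable lborel" for n
      unfolding D_def using shift(1) intq
      by (intro borel_measurable_times borel_measurable_diff borel_measurable_integrable) auto
    show "integrable lborel (\<lambda>x::'a. indicator (cball 0 (R + norm e)) x * \<bar>M\<bar>)"
      using emeasure_bounded_finite[OF bounded_cball, of "0::'a" "R + norm e"]
      by (intro integrable_mult_left integrable_real_indicator) (simp_all add: infinity_ennreal_def)
    show "AE x in lborel. norm (D n x) \<le> indicator (cball 0 (R + norm e)) x * \<bar>M\<bar>" for n
      using bound supp by (intro AE_I2) (auto simp: indicator_def simp del: mem_cball)
  qed (use lim in auto)
  then show ?thesis by (simp add: D0 LIMSEQ_const_iff)
qed

text \<open>
  Test fields have compact support in the open square, so the divergence theorem has no boundary term.
  This is why constants have total variation 0.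
\<close>

lemma integral_divergence_eq_0:
  assumes p: "p \<in> C1_compact_support (interior (square L))"
  shows "(\<integral>x. divergence p x \<partial>leb L) = 0"
proof -
  define K where "K = closure {x. p x \<noteq> 0}"
  have K: "compact K" "K \<subseteq> square L"
    using p interior_subset by (auto simp: C1_compact_support_def K_def)
  obtain p' where p': "\<And>x. (p has_derivative blinfun_apply (p' x)) (at x)" "continuous_on UNIV p'"
    "\<And>x. divergence p x = (\<Sum>i\<in>UNIV. blinfun_apply (p' x) (axis i 1) $ i)"
    "\<And>x. x \<notin> K \<Longrightarrow> p' x = 0"
    using C1_compact_support_derivative[OF p] unfolding K_def by blast
  define d where "d i x = blinfun_apply (p' x) (axis i 1) $ i" for i x
  have d_cont: "continuous_on UNIV (d i)" for i
    unfolding d_def by (intro continuous_intros p'(2))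
  have d_supp: "d i x = 0" if "x \<notin> K" for i x
    using p'(4)[OF that] by (simp add: d_def)
  have d_deriv: "((\<lambda>t. p (x + t *\<^sub>R axis i 1) $ i) has_real_derivative d i x) (at 0)" for i x
  proof -
    (* The chain rule needs the base point in the form that the inner line has at time 0. *)
    have "(p has_derivative blinfun_apply (p' x)) (at (x + 0 *\<^sub>R axis i 1))"
      using p'(1) by simp
    then have "((\<lambda>t. p (x + t *\<^sub>R axis i 1)) has_derivative
        (\<lambda>t. blinfun_apply (p' x) (t *\<^sub>R axis i 1))) (at (0::real))"
      by (intro has_derivative_compose[where g = p and f = "\<lambda>t. x + t *\<^sub>R axis i 1"])
         (auto intro!: derivative_eq_intros)
    then have "((\<lambda>t. p (x + t *\<^sub>R axis i 1) $ i) has_derivative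
        (\<lambda>t. blinfun_apply (p' x) (t *\<^sub>R axis i 1) $ i)) (at (0::real))"
      by (rule bounded_linear.has_derivative[OF bounded_linear_vec_nth])
    then show ?thesis
      by (simp add: has_field_derivative_def d_def blinfun.scaleR_right mult.commute
        mult_commute_abs)
  qed
  have d0: "(\<integral>x. d i x \<partial>lborel) = 0" for i
  proof (rule integral_directional_derivative_eq_0[OF d_deriv _ d_cont K(1)])
    have "continuous_on UNIV p"
      using p'(1) has_derivative_continuous continuous_at_imp_continuous_on by blast
    then show "continuous_on UNIV (\<lambda>x. p x $ i)" by (intro continuous_intros)
    show "p x $ i = 0" if "x \<notin> K" for x
    proof -
      have "x \<notin> {x. p x \<noteq> 0}"
        using closure_subset that unfolding K_def by (rule contra_subsetD)
      then show ?thesis by simp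
    qed
  qed (rule d_supp)
  have d_int: "integrable lborel (d i)" for i
  proof -
    have "integrable lborel (\<lambda>x. indicator K x *\<^sub>R d i x)"
      using K(1) d_cont by (intro borel_integrable_compact) (auto intro: continuous_on_subset)
    moreover have "(\<lambda>x. indicator K x *\<^sub>R d i x) = d i"
      using d_supp by (auto simp: indicator_def fun_eq_iff)
    ultimately show ?thesis by simp
  qed
  have "(\<integral>x. divergence p x \<partial>leb L) = (\<integral>x. indicator (square L) x *\<^sub>R divergence p x \<partial>lebesgue)"
    by (subst integral_restrict_space) (auto simp: sets_square)
  also have "(\<lambda>x. indicator (square L) x *\<^sub>R divergence p x) = divergence p"
  proof
    fix x show "indicator (square L) x *\<^sub>R divergence p x = divergence p x"
    proof (cases "x \<in> square L")
      case False
      then have "x \<notin> K" using K(2) by blast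
      then show ?thesis using False by (simp add: p'(3) d_supp flip: d_def)
    qed simp
  qed
  also have "(\<integral>x. divergence p x \<partial>lebesgue) = (\<integral>x. divergence p x \<partial>lborel)"
    using borel_measurable_continuous_onI[OF continuous_on_divergence[OF p]]
    by (intro integral_completion) simp
  also have "\<dots> = (\<Sum>i\<in>UNIV. \<integral>x. d i x \<partial>lborel)"
    unfolding p'(3) d_def[symmetric] using d_int by (intro Bochner_Integration.integral_sum)
  also have "\<dots> = 0" using d0 by simp
  finally show ?thesis .
qed

text \<open>
  Real-valued, because the variation is finite on \<open>BV L\<close>; outside that space the value 0 that stands
  for infinity has no meaning.
\<close>

definition tv :: "real \<Rightarrow> (real^2 \<Rightarrow> real) \<Rightarrow> real" where
  "tv L u = real_of_ereal (total_variation L u)"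

lemma zero_test_field: "(\<lambda>x. 0) \<in> test_fields L"
proof -
  have zero: "blinfun_apply (0 :: (real^2) \<Rightarrow>\<^sub>L (real^2)) = (\<lambda>_. 0)" by (rule ext) simp
  have "((\<lambda>x. 0) has_derivative blinfun_apply (0 :: (real^2) \<Rightarrow>\<^sub>L (real^2))) (at x)" for x
    unfolding zero by (rule has_derivative_const)
  then have "\<exists>p' :: real^2 \<Rightarrow> (real^2) \<Rightarrow>\<^sub>L (real^2).
      (\<forall>x. ((\<lambda>x. 0) has_derivative blinfun_apply (p' x)) (at x)) \<and> continuous_on UNIV p'"
    by (intro exI[of _ "\<lambda>_. 0"] conjI allI continuous_on_const)
  then have "(\<lambda>x. 0) \<in> C1_compact_support (interior (square L))"
    unfolding C1_compact_support_def mem_Collect_eq by (intro conjI) simp_all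
  then show ?thesis by simp
qed

lemma divergence_zero: "divergence (\<lambda>x. 0) x = 0"
  by (simp add: divergence_def)

lemma total_variation_nonneg: "0 \<le> total_variation L u"
  unfolding total_variation_def
  by (rule SUP_upper2[OF zero_test_field]) (simp add: divergence_zero)

lemma BV_integrable: "u \<in> BV L \<Longrightarrow> integrable (leb L) u"
  by (simp add: BV_def L1_def)

lemma total_variation_eq_tv: "u \<in> BV L \<Longrightarrow> total_variation L u = ereal (tv L u)"
  using total_variation_nonneg[of L u] by (cases "total_variation L u") (auto simp: BV_def tv_def)

lemma tv_nonneg: "0 \<le> tv L u"
  by (simp add: tv_def real_of_ereal_pos total_variation_nonneg)

lemma integral_divergence_le_tv:
  assumes "u \<in> BV L" "p \<in> test_fields L"
  shows "(\<integral>x. u x * divergence p x \<partial>leb L) \<le> tv L u"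
proof -
  have "ereal (\<integral>x. u x * divergence p x \<partial>leb L) \<le> total_variation L u"
    unfolding total_variation_def using assms(2) by (rule SUP_upper)
  then show ?thesis by (simp add: total_variation_eq_tv[OF assms(1)])
qed

lemma BV_tv_leI:
  assumes "integrable (leb L) u"
    and "\<And>p. p \<in> test_fields L \<Longrightarrow> (\<integral>x. u x * divergence p x \<partial>leb L) \<le> c"
  shows "u \<in> BV L" "tv L u \<le> c"
proof -
  have le: "total_variation L u \<le> ereal c"
    unfolding total_variation_def using assms(2) by (intro SUP_least) simp
  then have "total_variation L u < \<infinity>" by (rule le_less_trans) simp
  then show BV: "u \<in> BV L" using assms(1) by (simp add: BV_def L1_def)
  show "tv L u \<le> c" using le by (simp add: total_variation_eq_tv[OF BV])
qed

lemma integrable_mult_divergence: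
  assumes "integrable (leb L) u" "p \<in> test_fields L"
  shows "integrable (leb L) (\<lambda>x. u x * divergence p x)"
proof -
  have "p \<in> C1_compact_support (interior (square L))" using assms(2) by simp
  from integrable_continuous_mult[OF assms(1) continuous_on_divergence[OF this]]
  show ?thesis by (simp add: mult.commute)
qed

text \<open>
  A supremum of linear functionals is sublinear. The additive constant \<open>c\<close> costs nothing because
  divergences of test fields have mean 0; it is carried along because perturbations of \<open>u\<close> must be
  shifted to keep the prescribed mean.
\<close>

lemma BV_combination:
  assumes u: "u \<in> BV L" and v: "v \<in> BV L" and "0 \<le> a" "0 \<le> b"
  shows "(\<lambda>x. a * u x + b * v x + c) \<in> BV L"
    "tv L (\<lambda>x. a * u x + b * v x + c) \<le> a * tv L u + b * tv L v"
proof -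
  have int: "integrable (leb L) (\<lambda>x. a * u x + b * v x + c)"
    using u v BV_integrable integrable_const_leb
    by (intro Bochner_Integration.integrable_add integrable_mult_right) auto
  have le: "(\<integral>x. (a * u x + b * v x + c) * divergence p x \<partial>leb L) \<le> a * tv L u + b * tv L v"
    if p: "p \<in> test_fields L" for p
  proof -
    have "(\<integral>x. (a * u x + b * v x + c) * divergence p x \<partial>leb L) =
        (\<integral>x. a * (u x * divergence p x) + b * (v x * divergence p x) + c * divergence p x \<partial>leb L)"
      by (simp add: algebra_simps)
    also have "\<dots> = a * (\<integral>x. u x * divergence p x \<partial>leb L) +
        b * (\<integral>x. v x * divergence p x \<partial>leb L) + c * (\<integral>x. divergence p x \<partial>leb L)"
      using integrable_mult_divergence[OF BV_integrable[OF u] p]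
        integrable_mult_divergence[OF BV_integrable[OF v] p]
        integrable_mult_divergence[OF integrable_const_leb[of L 1] p]
      by simp
    also have "\<dots> = a * (\<integral>x. u x * divergence p x \<partial>leb L) + b * (\<integral>x. v x * divergence p x \<partial>leb L)"
      using integral_divergence_eq_0 p by simp
    also have "\<dots> \<le> a * tv L u + b * tv L v"
      using assms(3,4) integral_divergence_le_tv u v p
      by (intro add_mono mult_left_mono) auto
    finally show ?thesis .
  qed
  show "(\<lambda>x. a * u x + b * v x + c) \<in> BV L" by (rule BV_tv_leI(1)[OF int le])
  show "tv L (\<lambda>x. a * u x + b * v x + c) \<le> a * tv L u + b * tv L v"
    by (rule BV_tv_leI(2)[OF int le])
qed

lemma BV_const: "(\<lambda>x. c) \<in> BV L" "tv L (\<lambda>x. c) = 0"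
proof -
  have "(\<integral>x. c * divergence p x \<partial>leb L) \<le> 0" if "p \<in> test_fields L" for p
    using integral_divergence_eq_0 that by simp
  note le = BV_tv_leI[OF integrable_const_leb this]
  show "(\<lambda>x. c) \<in> BV L" by (rule le(1))
  show "tv L (\<lambda>x. c) = 0" using le(2) tv_nonneg by (rule antisym)
qed

lemma BV_add_const:
  assumes "u \<in> BV L"
  shows "(\<lambda>x. u x + c) \<in> BV L" "tv L (\<lambda>x. u x + c) = tv L u"
proof -
  have le: "(\<lambda>x. u x + c) \<in> BV L \<and> tv L (\<lambda>x. u x + c) \<le> tv L u" if "u \<in> BV L" for u c
    using BV_combination[OF that that, of 1 0 c] by simp
  from le[OF assms] show "(\<lambda>x. u x + c) \<in> BV L" by blast
  with le[of "\<lambda>x. u x + c" "- c"] le[OF assms, of c] show "tv L (\<lambda>x. u x + c) = tv L u" by simp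
qed

section \<open>The dual Lipschitz norm\<close>

lemma norm_square_le:
  assumes "x \<in> square L" shows "norm x \<le> 2 * L"
proof -
  have "norm x \<le> (\<Sum>i\<in>UNIV. \<bar>x $ i\<bar>)" by (rule norm_le_l1_cart)
  also have "\<dots> \<le> (\<Sum>i\<in>(UNIV :: 2 set). L)"
    using assms by (intro sum_mono) (simp add: mem_square)
  finally show ?thesis by simp
qed

lemma H_integrable: "v \<in> H L \<Longrightarrow> integrable (leb L) v"
  by (simp add: H_def L1_def)

lemma H_integral: "v \<in> H L \<Longrightarrow> (\<integral>x. v x \<partial>leb L) = 0"
  by (simp add: H_def)

lemma integrable_lipschitz_mult:
  fixes \<phi> :: "real^2 \<Rightarrow> real"
  assumes "1-lipschitz_on (square L) \<phi>" "integrable (leb L) v"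
  shows "integrable (leb L) (\<lambda>x. \<phi> x * v x)"
  by (rule integrable_continuous_mult[OF assms(2) lipschitz_on_continuous_on[OF assms(1)]])

text \<open>
  Since \<open>v\<close> has mean 0, \<open>\<phi>\<close> may be replaced by \<open>\<phi> - \<phi> 0\<close>, whose modulus is at most
  \<open>2 * L\<close> on the square for a 1-Lipschitz function. Hence the dual norm is finite on \<open>H L\<close>.
\<close>

lemma integral_lipschitz_mult_le:
  fixes \<phi> :: "real^2 \<Rightarrow> real"
  assumes L: "L > 0" and v: "v \<in> H L" and \<phi>: "1-lipschitz_on (square L) \<phi>"
  shows "(\<integral>x. \<phi> x * v x \<partial>leb L) \<le> 2 * L * (\<integral>x. \<bar>v x\<bar> \<partial>leb L)"
proof -
  note int = H_integrable[OF v]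
  have "(\<integral>x. \<phi> x * v x \<partial>leb L) = (\<integral>x. \<phi> x * v x - \<phi> 0 * v x \<partial>leb L)"
    using integrable_lipschitz_mult[OF \<phi> int] int H_integral[OF v] by simp
  also have "\<dots> \<le> (\<integral>x. 2 * L * \<bar>v x\<bar> \<partial>leb L)"
  proof (rule integral_mono)
    show "integrable (leb L) (\<lambda>x. \<phi> x * v x - \<phi> 0 * v x)"
      using integrable_lipschitz_mult[OF \<phi> int] int by simp
    show "integrable (leb L) (\<lambda>x. 2 * L * \<bar>v x\<bar>)" using int by simp
    fix x assume "x \<in> space (leb L)"
    then have x: "x \<in> square L" by simp
    have "0 \<in> square L" using L by (simp add: mem_square)
    from lipschitz_onD[OF \<phi> x this] norm_square_le[OF x]
    have "\<bar>\<phi> x - \<phi> 0\<bar> \<le> 2 * L" by (simp add: dist_norm)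
    then have "\<bar>\<phi> x - \<phi> 0\<bar> * \<bar>v x\<bar> \<le> 2 * L * \<bar>v x\<bar>" by (rule mult_right_mono) simp
    moreover have "\<phi> x * v x - \<phi> 0 * v x \<le> \<bar>\<phi> x - \<phi> 0\<bar> * \<bar>v x\<bar>"
      by (simp add: abs_mult[symmetric] left_diff_distrib[symmetric])
    ultimately show "\<phi> x * v x - \<phi> 0 * v x \<le> 2 * L * \<bar>v x\<bar>" by linarith
  qed
  finally show ?thesis by simp
qed

definition lipd :: "real \<Rightarrow> (real^2 \<Rightarrow> real) \<Rightarrow> real" where
  "lipd L v = real_of_ereal (Lip_dual_norm L v)"

lemma Lip_dual_norm_nonneg: "0 \<le> Lip_dual_norm L v"
  unfolding Lip_dual_norm_def
proof (rule SUP_upper2)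
  show "(\<lambda>x. 0) \<in> {\<phi> :: real^2 \<Rightarrow> real. 1-lipschitz_on (square L) \<phi>}"
    by (simp add: lipschitz_on_def)
qed simp

lemma lipd_nonneg: "0 \<le> lipd L v"
  by (simp add: lipd_def real_of_ereal_pos Lip_dual_norm_nonneg)

lemma Lip_dual_norm_leI:
  assumes "\<And>\<phi>. 1-lipschitz_on (square L) \<phi> \<Longrightarrow> (\<integral>x. \<phi> x * v x \<partial>leb L) \<le> c"
  shows "Lip_dual_norm L v \<le> ereal c"
  unfolding Lip_dual_norm_def using assms by (intro SUP_least) simp

lemma Lip_dual_norm_eq_lipd:
  assumes "L > 0" "v \<in> H L"
  shows "Lip_dual_norm L v = ereal (lipd L v)"
proof -
  have "Lip_dual_norm L v \<le> ereal (2 * L * (\<integral>x. \<bar>v x\<bar> \<partial>leb L))"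
    by (rule Lip_dual_norm_leI) (rule integral_lipschitz_mult_le[OF assms])
  then show ?thesis
    using Lip_dual_norm_nonneg[of L v] by (cases "Lip_dual_norm L v") (auto simp: lipd_def)
qed

lemma integral_lipschitz_le_lipd:
  assumes "L > 0" "v \<in> H L" "1-lipschitz_on (square L) \<phi>"
  shows "(\<integral>x. \<phi> x * v x \<partial>leb L) \<le> lipd L v"
proof -
  have "ereal (\<integral>x. \<phi> x * v x \<partial>leb L) \<le> Lip_dual_norm L v"
    unfolding Lip_dual_norm_def by (rule SUP_upper) (use assms(3) in simp)
  then show ?thesis by (simp add: Lip_dual_norm_eq_lipd[OF assms(1,2)])
qed

lemma lipd_leI:
  assumes "L > 0" "v \<in> H L"
    and "\<And>\<phi>. 1-lipschitz_on (square L) \<phi> \<Longrightarrow> (\<integral>x. \<phi> x * v x \<partial>leb L) \<le> c"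
  shows "lipd L v \<le> c"
  using Lip_dual_norm_leI[of L v c] assms(3) by (simp add: Lip_dual_norm_eq_lipd[OF assms(1,2)])

lemma H_combination:
  assumes L: "L > 0" and u: "u \<in> H L" and v: "v \<in> H L" and "0 \<le> a" "0 \<le> b"
  shows "(\<lambda>x. a * u x + b * v x) \<in> H L"
    "lipd L (\<lambda>x. a * u x + b * v x) \<le> a * lipd L u + b * lipd L v"
proof -
  note int = H_integrable[OF u] H_integrable[OF v]
  show H: "(\<lambda>x. a * u x + b * v x) \<in> H L"
    using int H_integral[OF u] H_integral[OF v] by (simp add: H_def L1_def)
  show "lipd L (\<lambda>x. a * u x + b * v x) \<le> a * lipd L u + b * lipd L v"
  proof (rule lipd_leI[OF L H])
    fix \<phi> :: "real^2 \<Rightarrow> real" assume \<phi>: "1-lipschitz_on (square L) \<phi>"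
    have "(\<integral>x. \<phi> x * (a * u x + b * v x) \<partial>leb L) =
        (\<integral>x. a * (\<phi> x * u x) + b * (\<phi> x * v x) \<partial>leb L)"
      by (simp add: algebra_simps)
    also have "\<dots> = a * (\<integral>x. \<phi> x * u x \<partial>leb L) + b * (\<integral>x. \<phi> x * v x \<partial>leb L)"
      using integrable_lipschitz_mult[OF \<phi> int(1)] integrable_lipschitz_mult[OF \<phi> int(2)] by simp
    also have "\<dots> \<le> a * lipd L u + b * lipd L v"
      using integral_lipschitz_le_lipd[OF L u \<phi>] integral_lipschitz_le_lipd[OF L v \<phi>] assms(4,5)
      by (intro add_mono mult_left_mono)
    finally show "(\<integral>x. \<phi> x * (a * u x + b * v x) \<partial>leb L) \<le> a * lipd L u + b * lipd L v" .
  qed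
qed

lemma zero_in_H: "(\<lambda>x. 0) \<in> H L"
  by (simp add: H_def L1_def)

lemma lipd_zero: "L > 0 \<Longrightarrow> lipd L (\<lambda>x. 0) = 0"
  using lipd_leI[OF _ zero_in_H, of L 0] lipd_nonneg[of L "\<lambda>x. 0"] by simp

text \<open>
  Every closed \<open>T\<close> inside \<open>{v > 0}\<close> is null, because there a positive function has integral 0. By inner
  regularity of Lebesgue measure the whole set \<open>{v > 0}\<close> is then null.
\<close>

lemma AE_nonpos_if_integral_closed_eq_0:
  fixes v :: "real^2 \<Rightarrow> real"
  assumes v: "integrable (leb L) v"
    and zero: "\<And>F. closed F \<Longrightarrow> F \<subseteq> square L \<Longrightarrow> (\<integral>x. indicator F x * v x \<partial>leb L) = 0"
  shows "AE x in leb L. v x \<le> 0"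
proof -
  define A where "A = {x \<in> square L. 0 < v x}"
  have "{x \<in> space (leb L). 0 < v x} \<in> sets (leb L)"
    using borel_measurable_integrable[OF v] by measurable
  then have A: "A \<in> sets lebesgue"
    by (simp add: A_def sets_restrict_space_iff sets_square)
  have null: "emeasure lebesgue T = 0" if T: "closed T" "T \<subseteq> A" for T
  proof -
    have Tm: "T \<in> sets lebesgue" using T(1) by (simp add: borel_closed)
    have Ts: "T \<subseteq> square L" using T(2) by (auto simp: A_def)
    have "(\<lambda>x. indicator T x :: real) \<in> borel_measurable lebesgue" using Tm by simp
    then have ind: "(\<lambda>x. indicator T x :: real) \<in> borel_measurable (leb L)"
      by (rule measurable_restrict_space1)
    have int: "integrable (leb L) (\<lambda>x. indicator T x * v x)"
      by (rule integrable_bounded_mult[OF v ind, of 1]) (simp add: indicator_def)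
    have nonneg: "AE x in leb L. 0 \<le> indicator T x * v x"
      using T(2) by (intro AE_I2) (auto simp: indicator_def A_def)
    have "AE x in leb L. indicator T x * v x = 0"
      using integral_nonneg_eq_0_iff_AE[OF int nonneg] zero[OF T(1) Ts] by blast
    then have "AE x in leb L. x \<notin> T"
      by eventually_elim (use T(2) in \<open>auto simp: A_def indicator_def\<close>)
    then have "AE x in lebesgue. x \<in> square L \<longrightarrow> x \<notin> T"
      by (subst (asm) AE_restrict_space_iff) (auto simp: sets_square)
    then have "AE x in lebesgue. x \<notin> T"
      by eventually_elim (use Ts in blast)
    then show ?thesis using AE_iff_null_sets[OF Tm] by blast
  qed
  have "emeasure lebesgue A \<le> 0"
  proof (rule ennreal_le_epsilon)
    fix e :: real assume "0 < e"
    then obtain T where T: "closed T" "T \<subseteq> A" "A - T \<in> lmeasurable" "emeasure lebesgue (A - T) < ennreal e"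
      using sets_lebesgue_inner_closed[OF A] by blast
    have Tm: "T \<in> sets lebesgue" using T(1) by (simp add: borel_closed)
    have "A = T \<union> (A - T)" using T(2) by blast
    then have "emeasure lebesgue A \<le> emeasure lebesgue T + emeasure lebesgue (A - T)"
      using emeasure_subadditive[of T lebesgue "A - T"] fmeasurableD[OF T(3)] Tm by simp
    then show "emeasure lebesgue A \<le> 0 + ennreal e"
      using null[OF T(1,2)] T(4) by simp
  qed
  then have "A \<in> null_sets lebesgue" using A by (intro null_setsI) simp_all
  then have "AE x in lebesgue. x \<notin> A" by (rule AE_not_in)
  then have "AE x in lebesgue. x \<in> square L \<longrightarrow> v x \<le> 0"
    by eventually_elim (auto simp: A_def)
  then show ?thesis by (subst AE_restrict_space_iff) (auto simp: sets_square)
qed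

text \<open>
  The indicator of a closed set is the bounded limit of \<open>max 0 (1 - n * infdist x F)\<close>, a multiple of a
  1-Lipschitz function. If the dual norm of \<open>v\<close> vanishes, then so do the integrals of \<open>v\<close> against these
  functions, hence over all closed sets.
\<close>

lemma lipd_eq_0_imp_AE_0:
  assumes L: "L > 0" and v: "v \<in> H L" and "lipd L v = 0"
  shows "AE x in leb L. v x = 0"
proof -
  note int = H_integrable[OF v]
  have lip0: "(\<integral>x. \<phi> x * v x \<partial>leb L) = 0" if \<phi>: "1-lipschitz_on (square L) \<phi>" for \<phi>
  proof -
    have "1-lipschitz_on (square L) (\<lambda>x. - \<phi> x)"
      using \<phi> by (simp add: lipschitz_on_def dist_real_def)
    from integral_lipschitz_le_lipd[OF L v this] integral_lipschitz_le_lipd[OF L v \<phi>]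
    show ?thesis using assms(3) by simp
  qed
  have closed0: "(\<integral>x. indicator F x * v x \<partial>leb L) = 0" if F: "closed F" "F \<noteq> {}" for F
  proof -
    define \<psi> where "\<psi> n x = real (Suc n) * max 0 (1 / real (Suc n) - infdist x F)" for n x
    have \<psi>0: "(\<integral>x. \<psi> n x * v x \<partial>leb L) = 0" for n
    proof -
      have "1-lipschitz_on (square L) (\<lambda>x. max 0 (1 / real (Suc n) - infdist x F))"
      proof (rule lipschitz_onI)
        fix x y :: "real^2"
        show "dist (max 0 (1 / real (Suc n) - infdist x F)) (max 0 (1 / real (Suc n) - infdist y F))
          \<le> 1 * dist x y"
          using infdist_triangle_abs[of x F y] unfolding dist_real_def by linarith
      qed simp
      from lip0[OF this] show ?thesis unfolding \<psi>_def by (simp add: mult.assoc)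
    qed
    have "(\<lambda>n. \<integral>x. \<psi> n x * v x \<partial>leb L) \<longlonglongrightarrow> (\<integral>x. indicator F x * v x \<partial>leb L)"
    proof (rule tendsto_integral_bounded_mult[OF int, where K = 1])
      show "\<psi> n \<in> borel_measurable (leb L)" for n
        unfolding \<psi>_def by (intro measurable_leb_continuous continuous_intros)
      show "indicator F \<in> borel_measurable (leb L)"
        by (intro measurable_restrict_space1 borel_measurable_indicator) (use F(1) in \<open>simp add: borel_closed\<close>)
      show "\<bar>\<psi> n x\<bar> \<le> 1" for n x
      proof -
        have "max 0 (1 / real (Suc n) - infdist x F) \<le> 1 / real (Suc n)"
          using infdist_nonneg[of x F] by auto
        then have "\<psi> n x \<le> real (Suc n) * (1 / real (Suc n))"
          unfolding \<psi>_def by (rule mult_left_mono) simp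
        moreover have "0 \<le> \<psi> n x" unfolding \<psi>_def by simp
        ultimately show ?thesis by simp
      qed
      show "AE x in leb L. (\<lambda>n. \<psi> n x) \<longlonglongrightarrow> indicator F x"
      proof (rule AE_I2)
        fix x :: "real^2"
        show "(\<lambda>n. \<psi> n x) \<longlonglongrightarrow> indicator F x"
        proof (cases "x \<in> F")
          case True
          then show ?thesis by (simp add: \<psi>_def)
        next
          case False
          then have pos: "infdist x F > 0" using F infdist_pos_not_in_closed by blast
          have "eventually (\<lambda>n. 1 / real (Suc n) < infdist x F) sequentially"
            using LIMSEQ_inverse_real_of_nat pos
            by (simp add: order_tendstoD(2) inverse_eq_divide)
          then have "eventually (\<lambda>n. indicator F x = \<psi> n x) sequentially"
            by eventually_elim (use False in \<open>auto simp: \<psi>_def max_def\<close>)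
          then show ?thesis by (intro tendsto_eventually) (simp add: eq_commute)
        qed
      qed
    qed
    then show ?thesis by (simp add: \<psi>0 LIMSEQ_const_iff)
  qed
  then have closed0': "(\<integral>x. indicator F x * v x \<partial>leb L) = 0" if "closed F" for F
    using that by (cases "F = {}") auto
  have "AE x in leb L. v x \<le> 0"
    by (rule AE_nonpos_if_integral_closed_eq_0[OF int closed0'])
  moreover have "AE x in leb L. - v x \<le> 0"
    by (rule AE_nonpos_if_integral_closed_eq_0) (use int closed0' in auto)
  ultimately show ?thesis by eventually_elim auto
qed

section \<open>B-splines and a Poincare-Sobolev inequality on grids\<close>

text \<open>
  At 0 the function equals \<open>t * (max 0 t) ^ n\<close>, whose second factor is continuous and vanishes there;
  this is Caratheodory's criterion.
\<close>

lemma DERIV_pos_part_power: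
  assumes "n > 0"
  shows "((\<lambda>t::real. (max 0 t) ^ Suc n) has_real_derivative real (Suc n) * (max 0 t) ^ n) (at t)"
proof -
  consider "t < 0" | "t > 0" | "t = 0" by linarith
  then show ?thesis
  proof cases
    case 1
    have "((\<lambda>t::real. 0) has_real_derivative 0) (at t)" by simp
    then have "((\<lambda>t::real. (max 0 t) ^ Suc n) has_real_derivative 0) (at t)"
      by (rule has_field_derivative_transform_within_open[where S = "{..<0}"]) (use 1 in auto)
    then show ?thesis using 1 assms by (simp add: max_absorb1 zero_power)
  next
    case 2
    have "((\<lambda>t::real. t ^ Suc n) has_real_derivative real (Suc n) * t ^ n) (at t)"
      using DERIV_pow[of "Suc n" t UNIV] by simp
    then have "((\<lambda>t::real. (max 0 t) ^ Suc n) has_real_derivative real (Suc n) * t ^ n) (at t)"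
      by (rule has_field_derivative_transform_within_open[where S = "{0<..}"]) (use 2 in auto)
    then show ?thesis using 2 by simp
  next
    case 3
    have "\<exists>g. (\<forall>z::real. (max 0 z) ^ Suc n - (max 0 0) ^ Suc n = g z * (z - 0)) \<and> isCont g 0 \<and> g 0 = 0"
    proof (intro exI[of _ "\<lambda>z. (max 0 z) ^ n"] conjI allI)
      show "(max 0 z) ^ Suc n - (max 0 0) ^ Suc n = (max 0 z) ^ n * (z - 0)" for z :: real
        using assms by (simp add: max_def)
      show "isCont (\<lambda>z::real. (max 0 z) ^ n) 0" by (intro continuous_intros)
      show "(max 0 (0::real)) ^ n = 0" using assms by simp
    qed
    then have "((\<lambda>t::real. (max 0 t) ^ Suc n) has_real_derivative 0) (at 0)"
      unfolding CARAT_DERIV by simp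
    then show ?thesis using 3 assms by (simp add: zero_power)
  qed
qed

lemma DERIV_shift_back:
  "(f has_real_derivative D) (at (t - a)) \<Longrightarrow> ((\<lambda>t. f (t - a)) has_real_derivative D) (at t)"
  using DERIV_shift[of f D t "- a"] by simp

text \<open>
  The splines are written with truncated powers, so that smoothness is inherited from
  \<open>(max 0 t) ^ n\<close>. The function \<open>ramp2\<close> is an antiderivative of \<open>tent\<close> and rises from 0 to 1 on \<open>[0, 2]\<close>;
  \<open>ramp3\<close> is an antiderivative of \<open>ramp2\<close>. The first difference of \<open>ramp2\<close> is the quadratic B-spline
  with knots 0, 1, 2, 3, the second difference of \<open>ramp3\<close> the cubic one with knots 0, ..., 4. Two
  properties matter: the integer translates of each telescope to a partition of unity, and a difference of
  neighbouring quadratic splines is the derivative of a cubic one.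
\<close>

definition ramp2 :: "real \<Rightarrow> real" where
  "ramp2 t = ((max 0 t)\<^sup>2 - 2 * (max 0 (t - 1))\<^sup>2 + (max 0 (t - 2))\<^sup>2) / 2"

definition ramp3 :: "real \<Rightarrow> real" where
  "ramp3 t = ((max 0 t) ^ 3 - 2 * (max 0 (t - 1)) ^ 3 + (max 0 (t - 2)) ^ 3) / 6"

definition tent :: "real \<Rightarrow> real" where
  "tent t = max 0 t - 2 * max 0 (t - 1) + max 0 (t - 2)"

definition bspline2 :: "real \<Rightarrow> real" where
  "bspline2 t = ramp2 t - ramp2 (t - 1)"

definition bspline3 :: "real \<Rightarrow> real" where
  "bspline3 t = (ramp3 t - ramp3 (t - 1)) - (ramp3 (t - 1) - ramp3 (t - 2))"

lemma DERIV_ramp2: "(ramp2 has_real_derivative tent t) (at t)"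
proof -
  have d: "((\<lambda>t::real. (max 0 (t - a))\<^sup>2) has_real_derivative 2 * max 0 (t - a)) (at t)" for a
    using DERIV_shift_back[OF DERIV_pos_part_power[of 1 "t - a"]] by (simp add: numeral_2_eq_2)
  show ?thesis unfolding ramp2_def[abs_def] tent_def
    using DERIV_cdivide[OF DERIV_add[OF DERIV_diff[OF d[of 0] DERIV_cmult[OF d[of 1]]] d[of 2]], of 2 2]
    by (simp add: add_divide_distrib diff_divide_distrib)
qed

lemma DERIV_ramp3: "(ramp3 has_real_derivative ramp2 t) (at t)"
proof -
  have d: "((\<lambda>t::real. (max 0 (t - a)) ^ 3) has_real_derivative 3 * (max 0 (t - a))\<^sup>2) (at t)" for a
    using DERIV_shift_back[OF DERIV_pos_part_power[of 2 "t - a"]]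
    by (simp add: numeral_3_eq_3 numeral_2_eq_2)
  show ?thesis unfolding ramp3_def[abs_def] ramp2_def
    using DERIV_cdivide[OF DERIV_add[OF DERIV_diff[OF d[of 0] DERIV_cmult[OF d[of 1]]] d[of 2]], of 2 6]
    by (simp add: add_divide_distrib diff_divide_distrib)
qed

lemma tent_nonneg: "0 \<le> tent t"
  unfolding tent_def by (auto simp: max_def)

lemma ramp2_mono: "s \<le> t \<Longrightarrow> ramp2 s \<le> ramp2 t"
  by (rule DERIV_nonneg_imp_nondecreasing) (use DERIV_ramp2 tent_nonneg in blast)+

lemma ramp2_eq_0: "t \<le> 0 \<Longrightarrow> ramp2 t = 0"
  by (simp add: ramp2_def)

lemma ramp2_eq_1: "2 \<le> t \<Longrightarrow> ramp2 t = 1"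
  by (simp add: ramp2_def power2_eq_square algebra_simps)

lemma ramp2_bounds: "0 \<le> ramp2 t" "ramp2 t \<le> 1"
  using ramp2_mono[of "min t 0" t] ramp2_mono[of t "max t 2"] ramp2_eq_0[of "min t 0"]
    ramp2_eq_1[of "max t 2"] by auto

lemma bspline2_nonneg: "0 \<le> bspline2 t"
  using ramp2_mono[of "t - 1" t] by (simp add: bspline2_def)

lemma bspline2_support: "bspline2 t \<noteq> 0 \<Longrightarrow> 0 < t \<and> t < 3"
  using ramp2_eq_0[of t] ramp2_eq_0[of "t - 1"] ramp2_eq_1[of t] ramp2_eq_1[of "t - 1"]
  by (force simp: bspline2_def)

lemma sum_bspline2: "(\<Sum>i<n. bspline2 (t - real i)) = ramp2 t - ramp2 (t - real n)"
  by (induction n) (simp_all add: bspline2_def algebra_simps)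

lemma sum_bspline2_bounds: "0 \<le> (\<Sum>i<n. bspline2 (t - real i))" "(\<Sum>i<n. bspline2 (t - real i)) \<le> 1"
  using ramp2_bounds[of t] ramp2_bounds[of "t - real n"]
  by (auto simp: sum_bspline2 intro: ramp2_mono)

lemma DERIV_bspline2: "(bspline2 has_real_derivative tent t - tent (t - 1)) (at t)"
  unfolding bspline2_def[abs_def]
  by (intro DERIV_diff DERIV_ramp2 DERIV_shift_back)

lemma DERIV_ramp3_diff: "((\<lambda>t. ramp3 t - ramp3 (t - 1)) has_real_derivative bspline2 t) (at t)"
  unfolding bspline2_def
  by (intro DERIV_diff DERIV_ramp3 DERIV_shift_back)

lemma ramp3_diff_mono: "s \<le> t \<Longrightarrow> ramp3 s - ramp3 (s - 1) \<le> ramp3 t - ramp3 (t - 1)"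
  by (rule DERIV_nonneg_imp_nondecreasing[of s t "\<lambda>t. ramp3 t - ramp3 (t - 1)"])
     (use DERIV_ramp3_diff bspline2_nonneg in blast)+

lemma ramp3_diff_eq_0: "t \<le> 0 \<Longrightarrow> ramp3 t - ramp3 (t - 1) = 0"
  by (simp add: ramp3_def)

lemma ramp3_diff_eq_1: "3 \<le> t \<Longrightarrow> ramp3 t - ramp3 (t - 1) = 1"
  by (simp add: ramp3_def power3_eq_cube field_simps)

lemma ramp3_diff_bounds: "0 \<le> ramp3 t - ramp3 (t - 1)" "ramp3 t - ramp3 (t - 1) \<le> 1"
  using ramp3_diff_mono[of "min t 0" t] ramp3_diff_mono[of t "max t 3"] ramp3_diff_eq_0[of "min t 0"]
    ramp3_diff_eq_1[of "max t 3"] by auto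

lemma bspline3_nonneg: "0 \<le> bspline3 t"
  using ramp3_diff_mono[of "t - 1" t] by (simp add: bspline3_def)

lemma bspline3_support: "bspline3 t \<noteq> 0 \<Longrightarrow> 0 < t \<and> t < 4"
  using ramp3_diff_eq_0[of t] ramp3_diff_eq_0[of "t - 1"] ramp3_diff_eq_1[of t] ramp3_diff_eq_1[of "t - 1"]
  by (force simp: bspline3_def)

lemma sum_bspline3_le_1: "(\<Sum>i<n. bspline3 (t - real i)) \<le> 1"
proof -
  have "(\<Sum>i<n. bspline3 (t - real i)) =
      (ramp3 t - ramp3 (t - 1)) - (ramp3 (t - real n) - ramp3 (t - real n - 1))"
    by (induction n) (simp_all add: bspline3_def algebra_simps)
  then show ?thesis
    using ramp3_diff_bounds(2)[of t] ramp3_diff_bounds(1)[of "t - real n"] by simp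
qed

lemma DERIV_bspline3: "(bspline3 has_real_derivative bspline2 t - bspline2 (t - 1)) (at t)"
  using DERIV_diff[OF DERIV_ramp3_diff[of t] DERIV_shift_back[OF DERIV_ramp3_diff[of "t - 1"]]]
  by (simp add: bspline3_def[abs_def])

lemma continuous_on_bspline2: "continuous_on S bspline2"
  by (meson DERIV_bspline2 DERIV_isCont continuous_at_imp_continuous_on)

lemma abs_diff_le_variation:
  fixes f :: "nat \<Rightarrow> real"
  assumes "i \<le> m" "k \<le> m"
  shows "\<bar>f i - f k\<bar> \<le> (\<Sum>r<m. \<bar>f r - f (Suc r)\<bar>)"
proof -
  have *: "\<bar>f i - f k\<bar> \<le> (\<Sum>r<m. \<bar>f r - f (Suc r)\<bar>)" if "i \<le> k" "k \<le> m" for i k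
  proof -
    have "f i - f k = (\<Sum>r=i..<k. f r - f (Suc r))"
      using sum_Suc_diff'[of i k "\<lambda>r. - f r"] that by simp
    also have "\<bar>\<dots>\<bar> \<le> (\<Sum>r=i..<k. \<bar>f r - f (Suc r)\<bar>)" by (rule sum_abs)
    also have "\<dots> \<le> (\<Sum>r<m. \<bar>f r - f (Suc r)\<bar>)"
      by (rule sum_mono2) (use that in auto)
    finally show ?thesis .
  qed
  show ?thesis using *[of i k] *[of k i] assms by (cases "i \<le> k") (auto simp: abs_minus_commute)
qed

text \<open>
  The discrete form of the embedding of BV into the square integrable functions in the plane. Two grid
  points \<open>(i, j)\<close> and \<open>(k, l)\<close> are joined by two L-shaped paths, through \<open>(k, j)\<close> and through \<open>(i, l)\<close>. With
  \<open>x j\<close> and \<open>y i\<close> the variations along the grid lines, this bounds the difference of the values by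
  \<open>x j + y k\<close> and also by \<open>y i + x l\<close>. The first bound does not contain \<open>i\<close> and \<open>l\<close>, the second does not
  contain \<open>j\<close> and \<open>k\<close>, so the sum of the squared differences over all pairs is at most a product of two
  sums that involve only the total variations. Weights \<open>w\<close> of sum 0 see only differences of values, and the
  Cauchy-Schwarz inequality over all pairs of grid points gives the claim.
\<close>

lemma discrete_poincare_sobolev:
  fixes a w :: "nat \<Rightarrow> nat \<Rightarrow> real"
  assumes X: "(\<Sum>j\<le>m. \<Sum>i<m. \<bar>a i j - a (Suc i) j\<bar>) \<le> V"
    and Y: "(\<Sum>i\<le>m. \<Sum>j<m. \<bar>a i j - a i (Suc j)\<bar>) \<le> V"
    and w: "(\<Sum>i\<le>m. \<Sum>j\<le>m. w i j) = 0"
  shows "(\<Sum>i\<le>m. \<Sum>j\<le>m. a i j * w i j)\<^sup>2 \<le> 4 * V\<^sup>2 * (\<Sum>i\<le>m. \<Sum>j\<le>m. (w i j)\<^sup>2)"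
proof -
  define N where "N = real (Suc m)"
  define I where "I = {..m} \<times> {..m}"
  define A where "A p = a (fst p) (snd p)" for p
  define W where "W p = w (fst p) (snd p)" for p
  define x where "x j = (\<Sum>i<m. \<bar>a i j - a (Suc i) j\<bar>)" for j
  define y where "y i = (\<Sum>j<m. \<bar>a i j - a i (Suc j)\<bar>)" for i
  have pair: "(\<Sum>p\<in>I. g p) = (\<Sum>i\<le>m. \<Sum>j\<le>m. g (i, j))" for g :: "nat \<times> nat \<Rightarrow> real"
    by (simp add: I_def sum.cartesian_product)
  have pairI: "(\<Sum>r\<in>I\<times>I. g r) = (\<Sum>p\<in>I. \<Sum>q\<in>I. g (p, q))"
    for g :: "(nat \<times> nat) \<times> (nat \<times> nat) \<Rightarrow> real"
    by (simp add: sum.cartesian_product)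
  have xy0: "0 \<le> x j" "0 \<le> y j" for j by (auto simp: x_def y_def intro: sum_nonneg)
  have cardI: "real (card I) = N\<^sup>2" by (simp add: I_def N_def power2_eq_square algebra_simps)
  have diff: "\<bar>a i j - a k l\<bar> \<le> x j + y k" "\<bar>a i j - a k l\<bar> \<le> y i + x l"
    if "i \<le> m" "j \<le> m" "k \<le> m" "l \<le> m" for i j k l
    using abs_diff_le_variation[of i m k "\<lambda>i. a i j"] abs_diff_le_variation[of j m l "\<lambda>j. a k j"]
      abs_diff_le_variation[of j m l "\<lambda>j. a i j"] abs_diff_le_variation[of i m k "\<lambda>i. a i l"] that
    by (auto simp: x_def y_def)
  (* One factor of the square is bounded by each of the two paths. *)
  have sq: "(A p - A q)\<^sup>2 \<le> (x (snd p) + y (fst q)) * (y (fst p) + x (snd q))"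
    if "p \<in> I" "q \<in> I" for p q
  proof -
    have "\<bar>A p - A q\<bar> * \<bar>A p - A q\<bar> \<le> (x (snd p) + y (fst q)) * (y (fst p) + x (snd q))"
      using diff[of "fst p" "snd p" "fst q" "snd q"] that xy0
      by (intro mult_mono) (auto simp: A_def I_def)
    then show ?thesis by (simp add: power2_eq_square)
  qed
  have sumxy: "(\<Sum>j\<le>m. \<Sum>k\<le>m. x j + y k) \<le> 2 * N * V"
  proof -
    have "(\<Sum>j\<le>m. \<Sum>k\<le>m. x j + y k) = N * (\<Sum>j\<le>m. x j) + N * (\<Sum>k\<le>m. y k)"
      by (simp add: sum.distrib N_def sum_distrib_left)
    also have "\<dots> \<le> N * V + N * V"
      using X Y by (intro add_mono mult_left_mono) (auto simp: x_def y_def N_def)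
    finally show ?thesis by simp
  qed
  have "(\<Sum>p\<in>I. \<Sum>q\<in>I. (A p - A q)\<^sup>2) \<le> (\<Sum>p\<in>I. \<Sum>q\<in>I. (x (snd p) + y (fst q)) * (y (fst p) + x (snd q)))"
    by (intro sum_mono sq)
  also have "\<dots> = (\<Sum>i\<le>m. \<Sum>j\<le>m. \<Sum>k\<le>m. \<Sum>l\<le>m. (x j + y k) * (y i + x l))"
    by (simp add: pair)
  also have "\<dots> = (\<Sum>j\<le>m. \<Sum>k\<le>m. x j + y k) * (\<Sum>i\<le>m. \<Sum>l\<le>m. y i + x l)"
    by (simp flip: sum_distrib_left sum_distrib_right)
  also have "(\<Sum>i\<le>m. \<Sum>l\<le>m. y i + x l) = (\<Sum>j\<le>m. \<Sum>k\<le>m. x j + y k)"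
    by (subst sum.swap) (simp add: add.commute)
  also have "(\<Sum>j\<le>m. \<Sum>k\<le>m. x j + y k) * (\<Sum>j\<le>m. \<Sum>k\<le>m. x j + y k) \<le> (2 * N * V) * (2 * N * V)"
  proof -
    have "0 \<le> (\<Sum>j\<le>m. \<Sum>k\<le>m. x j + y k)" by (intro sum_nonneg add_nonneg_nonneg xy0)
    with sumxy show ?thesis by (intro mult_mono) auto
  qed
  finally have AA: "(\<Sum>p\<in>I. \<Sum>q\<in>I. (A p - A q)\<^sup>2) \<le> 4 * N\<^sup>2 * V\<^sup>2"
    by (simp add: power2_eq_square mult_ac)
  have W0: "(\<Sum>p\<in>I. W p) = 0"
    using w by (simp add: I_def W_def sum.cartesian_product case_prod_beta)
  (* The subtracted values \<open>A q\<close> drop out because the weights sum to 0. *)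
  have "N\<^sup>2 * (\<Sum>p\<in>I. A p * W p) = (\<Sum>p\<in>I. \<Sum>q\<in>I. (A p - A q) * W p)"
  proof -
    have "(\<Sum>p\<in>I. \<Sum>q\<in>I. (A p - A q) * W p) = (\<Sum>p\<in>I. (\<Sum>q\<in>I. A p * W p)) - (\<Sum>p\<in>I. \<Sum>q\<in>I. A q * W p)"
      by (simp add: left_diff_distrib sum_subtractf)
    also have "(\<Sum>p\<in>I. \<Sum>q\<in>I. A q * W p) = (\<Sum>q\<in>I. A q) * (\<Sum>p\<in>I. W p)"
      by (subst sum.swap) (simp add: sum_product)
    finally show ?thesis by (simp add: W0 cardI sum_distrib_left)
  qed
  then have "(N\<^sup>2 * (\<Sum>p\<in>I. A p * W p))\<^sup>2 = (\<Sum>(p,q)\<in>I\<times>I. (A p - A q) * W p)\<^sup>2"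
    by (simp add: sum.cartesian_product)
  also have "\<dots> = (\<Sum>r\<in>I\<times>I. (A (fst r) - A (snd r)) * W (fst r))\<^sup>2"
    by (simp add: case_prod_beta)
  also have "\<dots> \<le> (\<Sum>r\<in>I\<times>I. (A (fst r) - A (snd r))\<^sup>2) * (\<Sum>r\<in>I\<times>I. (W (fst r))\<^sup>2)"
    by (rule Cauchy_Schwarz_ineq_sum)
  also have "(\<Sum>r\<in>I\<times>I. (A (fst r) - A (snd r))\<^sup>2) = (\<Sum>p\<in>I. \<Sum>q\<in>I. (A p - A q)\<^sup>2)"
    by (simp only: pairI fst_conv snd_conv)
  also have "(\<Sum>r\<in>I\<times>I. (W (fst r))\<^sup>2) = (\<Sum>p\<in>I. \<Sum>q\<in>I. (W p)\<^sup>2)"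
    by (simp only: pairI fst_conv snd_conv)
  also have "\<dots> = N\<^sup>2 * (\<Sum>p\<in>I. (W p)\<^sup>2)"
    by (simp add: cardI sum_distrib_left)
  also have "(\<Sum>p\<in>I. \<Sum>q\<in>I. (A p - A q)\<^sup>2) * (N\<^sup>2 * (\<Sum>p\<in>I. (W p)\<^sup>2)) \<le>
      (4 * N\<^sup>2 * V\<^sup>2) * (N\<^sup>2 * (\<Sum>p\<in>I. (W p)\<^sup>2))"
    using AA by (rule mult_right_mono) (simp add: sum_nonneg)
  finally have "(N\<^sup>2)\<^sup>2 * (\<Sum>p\<in>I. A p * W p)\<^sup>2 \<le> (N\<^sup>2)\<^sup>2 * (4 * V\<^sup>2 * (\<Sum>p\<in>I. (W p)\<^sup>2))"
    by (simp add: power2_eq_square algebra_simps)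
  moreover have "0 < (N\<^sup>2)\<^sup>2" by (simp add: N_def)
  ultimately have "(\<Sum>p\<in>I. A p * W p)\<^sup>2 \<le> 4 * V\<^sup>2 * (\<Sum>p\<in>I. (W p)\<^sup>2)"
    by (simp only: mult_le_cancel_left_pos)
  then show ?thesis by (simp add: I_def A_def W_def sum.cartesian_product case_prod_beta)
qed

section \<open>Spline coefficients of functions of bounded variation\<close>

text \<open>
  A scalar function times a coordinate direction is a test field whose divergence is one partial
  derivative of the function; this is the only kind of test field that the embedding needs.
\<close>

lemma integral_partial_derivative_le_tv:
  fixes P :: "real^2 \<Rightarrow> real" and Q :: "2 \<Rightarrow> real^2 \<Rightarrow> real"
  assumes u: "u \<in> BV L"
    and deriv: "\<And>x. (P has_derivative (\<lambda>v. \<Sum>l\<in>UNIV. Q l x * v $ l)) (at x)"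
    and cont: "\<And>l. continuous_on UNIV (Q l)"
    and bound: "\<And>x. \<bar>P x\<bar> \<le> 1"
    and supp: "\<And>x. P x \<noteq> 0 \<Longrightarrow> x \<in> K" "compact K" "K \<subseteq> interior (square L)"
  shows "(\<integral>x. u x * Q k x \<partial>leb L) \<le> tv L u"
proof -
  define p :: "real^2 \<Rightarrow> real^2" where "p x = P x *\<^sub>R axis k 1" for x
  define E :: "2 \<Rightarrow> (real^2) \<Rightarrow>\<^sub>L (real^2)" where "E l = Blinfun (\<lambda>v. v $ l *\<^sub>R axis k 1)" for l
  have E: "blinfun_apply (E l) v = v $ l *\<^sub>R axis k 1" for l v
    unfolding E_def
    by (subst bounded_linear_Blinfun_apply)
       (auto intro: bounded_linear_compose[OF bounded_linear_scaleR_left bounded_linear_vec_nth])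
  define p' where "p' x = (\<Sum>l\<in>UNIV. Q l x *\<^sub>R E l)" for x
  have p'_apply: "blinfun_apply (p' x) v = (\<Sum>l\<in>UNIV. Q l x * v $ l) *\<^sub>R axis k 1" for x v
    by (simp add: p'_def blinfun.sum_left blinfun.scaleR_left E scaleR_sum_left)
  have p': "(p has_derivative blinfun_apply (p' x)) (at x)" for x
    unfolding p_def[abs_def] p'_apply[abs_def] by (rule has_derivative_scaleR_left[OF deriv])
  have "continuous_on UNIV p'"
    unfolding p'_def[abs_def] by (intro continuous_intros cont)
  moreover have "closure {x. p x \<noteq> 0} \<subseteq> K"
  proof (rule closure_minimal)
    show "{x. p x \<noteq> 0} \<subseteq> K" using supp(1) by (auto simp: p_def)
    show "closed K" using supp(2) by (rule compact_imp_closed)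
  qed
  moreover from this have "compact (closure {x. p x \<noteq> 0})"
    using compact_Int_closed[OF supp(2) closed_closure, of "{x. p x \<noteq> 0}"] by (simp add: inf_absorb2)
  ultimately have "p \<in> C1_compact_support (interior (square L))"
    unfolding C1_compact_support_def using p' supp(3) by blast
  moreover have "norm (p x) \<le> 1" for x
    using bound[of x] by (simp add: p_def)
  ultimately have p: "p \<in> test_fields L" by simp
  have "frechet_derivative p (at x) = blinfun_apply (p' x)" for x
    using frechet_derivative_at[OF p'] by simp
  then have "divergence p x = Q k x" for x
    by (simp add: divergence_def p'_apply axis_def if_distrib[of "(*) _"] if_distrib[of "(\<lambda>a. a $ _)"] cong: if_cong)
  then show ?thesis using integral_divergence_le_tv[OF u p] by simp
qed

text \<open>
  The splines on a mesh of width \<open>h\<close>. The shift by 1 keeps the support of \<open>bump h 0\<close> away from the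
  boundary of the square.
\<close>

definition bump :: "real \<Rightarrow> nat \<Rightarrow> real \<Rightarrow> real" where
  "bump h i s = bspline2 (s / h - 1 - real i)"

definition cubic_bump :: "real \<Rightarrow> nat \<Rightarrow> real \<Rightarrow> real" where
  "cubic_bump h i s = bspline3 (s / h - 1 - real i)"

lemma bump_nonneg: "0 \<le> bump h i s"
  by (simp add: bump_def bspline2_nonneg)

lemma cubic_bump_nonneg: "0 \<le> cubic_bump h i s"
  by (simp add: cubic_bump_def bspline3_nonneg)

lemma sum_bump_le_1: "(\<Sum>i<n. bump h i s) \<le> 1"
  unfolding bump_def by (rule sum_bspline2_bounds)

lemma sum_cubic_bump_le_1: "(\<Sum>i<n. cubic_bump h i s) \<le> 1"
  unfolding cubic_bump_def by (rule sum_bspline3_le_1)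

lemma bump_support:
  assumes "h > 0" "bump h i s \<noteq> 0"
  shows "(real i + 1) * h < s" "s < (real i + 4) * h"
  using bspline2_support[of "s / h - 1 - real i"] assms by (auto simp: bump_def field_simps)

lemma cubic_bump_support:
  assumes "h > 0" "cubic_bump h i s \<noteq> 0"
  shows "(real i + 1) * h < s" "s < (real i + 5) * h"
  using bspline3_support[of "s / h - 1 - real i"] assms by (auto simp: cubic_bump_def field_simps)

lemma DERIV_scaled:
  assumes "\<And>t. (f has_real_derivative f' t) (at t)"
  shows "((\<lambda>s. f (s / h - 1 - a)) has_real_derivative f' (s / h - 1 - a) / h) (at s)"
proof -
  have "((\<lambda>s. s / h - 1 - a) has_real_derivative 1 / h) (at s)"
    using DERIV_diff[OF DERIV_diff[OF DERIV_cdivide[OF DERIV_ident] DERIV_const] DERIV_const] by simp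
  from DERIV_chain2[where f = f, OF assms this] show ?thesis by simp
qed

lemma DERIV_bump:
  "(bump h i has_real_derivative
     (tent (s / h - 1 - real i) - tent (s / h - 1 - real i - 1)) / h) (at s)"
  unfolding bump_def[abs_def] by (rule DERIV_scaled[OF DERIV_bspline2])

lemma DERIV_cubic_bump:
  "(cubic_bump h i has_real_derivative (bump h i s - bump h (Suc i) s) / h) (at s)"
  using DERIV_scaled[OF DERIV_bspline3, of h "real i" s]
  by (simp add: cubic_bump_def[abs_def] bump_def algebra_simps)

lemma continuous_on_bump: "continuous_on S (bump h i)"
  unfolding bump_def[abs_def] divide_inverse
  by (rule continuous_on_compose2[OF continuous_on_bspline2[of UNIV]]) (auto intro!: continuous_intros)

text \<open>
  The type of coordinates has just two elements, so two distinct coordinates exhaust it. Stating the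
  lemma for an arbitrary pair \<open>k \<noteq> l\<close> allows both partial derivatives to be treated at once.
\<close>

lemma has_derivative_tensor:
  fixes k l :: 2
  assumes "k \<noteq> l" "(F has_real_derivative F') (at (x $ k))" "(G has_real_derivative G') (at (x $ l))"
  shows "((\<lambda>x. F (x $ k) * G (x $ l)) has_derivative
    (\<lambda>v. \<Sum>r\<in>UNIV. (if r = k then F' * G (x $ l) else F (x $ k) * G') * v $ r)) (at x)"
proof -
  have kl: "UNIV = {k, l}" using assms(1) exhaust_2[of k] exhaust_2[of l] by (auto simp: UNIV_2)
  have coord: "((\<lambda>x. x $ r) has_derivative (\<lambda>v. v $ r)) (at x)" for r :: 2
    by (rule bounded_linear_imp_has_derivative[OF bounded_linear_vec_nth])
  have "((\<lambda>x. F (x $ k)) has_derivative (\<lambda>v. F' * v $ k)) (at x)"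
    using has_derivative_compose[OF coord assms(2)[unfolded has_field_derivative_def]] .
  moreover have "((\<lambda>x. G (x $ l)) has_derivative (\<lambda>v. G' * v $ l)) (at x)"
    using has_derivative_compose[OF coord assms(3)[unfolded has_field_derivative_def]] .
  ultimately have "((\<lambda>x. F (x $ k) * G (x $ l)) has_derivative
      (\<lambda>v. F (x $ k) * (G' * v $ l) + F' * v $ k * G (x $ l))) (at x)"
    by (rule has_derivative_mult)
  moreover have "(\<lambda>v. F (x $ k) * (G' * v $ l) + F' * v $ k * G (x $ l)) =
    (\<lambda>v. \<Sum>r\<in>UNIV. (if r = k then F' * G (x $ l) else F (x $ k) * G') * v $ r)"
    using assms(1) by (simp add: kl fun_eq_iff algebra_simps)
  ultimately show ?thesis by simp
qed

definition spline_coeff ::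
  "real \<Rightarrow> (real^2 \<Rightarrow> real) \<Rightarrow> real \<Rightarrow> 2 \<Rightarrow> 2 \<Rightarrow> nat \<Rightarrow> nat \<Rightarrow> real" where
  "spline_coeff L u h k l i j = (\<integral>x. bump h i (x $ k) * bump h j (x $ l) * u x \<partial>leb L)"

lemma continuous_on_tensor_bump:
  fixes k l :: 2
  shows "continuous_on S (\<lambda>x::real^2. bump h i (x $ k) * bump h j (x $ l))"
  by (intro continuous_on_mult continuous_on_compose2[OF continuous_on_bump[of UNIV]])
     (auto intro!: continuous_intros)

text \<open>
  A difference of neighbouring coefficients is the integral of \<open>u\<close> against \<open>h\<close> times a partial derivative
  of a product of a cubic and a quadratic spline. Adding these products with the signs of the differences
  gives a function bounded by 1, since either family is nonnegative with sum at most 1; hence the sum of the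
  differences is at most \<open>h * tv L u\<close>. The condition \<open>L = (m + 5) * h\<close> keeps all supports in the open square.
\<close>

lemma spline_coeff_variation:
  fixes k l :: 2
  assumes u: "u \<in> BV L" and h: "h > 0" "L = (real m + 5) * h" and kl: "k \<noteq> l"
  shows "(\<Sum>j\<le>m. \<Sum>i<m. \<bar>spline_coeff L u h k l i j - spline_coeff L u h k l (Suc i) j\<bar>) \<le> h * tv L u"
proof -
  let ?b = "spline_coeff L u h k l"
  define \<sigma> where "\<sigma> i j = sgn (?b i j - ?b (Suc i) j)" for i j
  define P where "P x = (\<Sum>i<m. \<Sum>j\<le>m. \<sigma> i j * (cubic_bump h i (x $ k) * bump h j (x $ l)))" for x :: "real^2"
  define C' where "C' i s = (bump h i s - bump h (Suc i) s) / h" for i s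
  define B' where "B' j s = (tent (s / h - 1 - real j) - tent (s / h - 1 - real j - 1)) / h" for j s
  define Q where "Q r x = (\<Sum>i<m. \<Sum>j\<le>m. \<sigma> i j *
      (if r = k then C' i (x $ k) * bump h j (x $ l) else cubic_bump h i (x $ k) * B' j (x $ l)))"
    for r and x :: "real^2"
  define K :: "(real^2) set" where "K = cbox (\<chi> i. h) (\<chi> i. (real m + 4) * h)"
  have int: "integrable (leb L) (\<lambda>x. bump h i (x $ k) * bump h j (x $ l) * u x)" for i j
    by (rule integrable_continuous_mult[OF BV_integrable[OF u] continuous_on_tensor_bump])
  have "(\<integral>x. u x * Q k x \<partial>leb L) \<le> tv L u"
  proof (rule integral_partial_derivative_le_tv[OF u, of P Q K])
    fix x
    have "((\<lambda>x. \<Sum>i<m. \<Sum>j\<le>m. \<sigma> i j * (cubic_bump h i (x $ k) * bump h j (x $ l))) has_derivative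
      (\<lambda>v. \<Sum>i<m. \<Sum>j\<le>m. \<sigma> i j * (\<Sum>r\<in>UNIV.
        (if r = k then C' i (x $ k) * bump h j (x $ l) else cubic_bump h i (x $ k) * B' j (x $ l)) * v $ r))) (at x)"
      unfolding C'_def B'_def
      by (intro has_derivative_sum has_derivative_mult_right has_derivative_tensor kl
          DERIV_cubic_bump DERIV_bump)
    moreover have "(\<Sum>i<m. \<Sum>j\<le>m. \<sigma> i j * (\<Sum>r\<in>UNIV.
        (if r = k then C' i (x $ k) * bump h j (x $ l) else cubic_bump h i (x $ k) * B' j (x $ l)) * v $ r))
      = (\<Sum>r\<in>UNIV. Q r x * v $ r)" for v
      unfolding Q_def sum_2 by (simp add: sum_distrib_right sum_distrib_left sum.distrib distrib_left mult.assoc)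
    ultimately show "(P has_derivative (\<lambda>v. \<Sum>r\<in>UNIV. Q r x * v $ r)) (at x)"
      by (simp add: P_def[abs_def])
  next
    fix r
    have "continuous_on UNIV (bump h i)" "continuous_on UNIV (cubic_bump h i)"
      "continuous_on UNIV (C' i)" "continuous_on UNIV (B' i)" for i
    proof -
      show "continuous_on UNIV (bump h i)" by (rule continuous_on_bump)
      show "continuous_on UNIV (cubic_bump h i)"
        by (meson DERIV_cubic_bump DERIV_isCont continuous_at_imp_continuous_on)
      show "continuous_on UNIV (C' i)"
        unfolding C'_def[abs_def] by (intro continuous_intros continuous_on_bump) (use h in auto)
      have "continuous_on UNIV (\<lambda>s. tent (s / h - 1 - real i))"
        "continuous_on UNIV (\<lambda>s. tent (s / h - 1 - real i - 1))"
        unfolding tent_def by (intro continuous_intros; use h in auto)+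
      then show "continuous_on UNIV (B' i)"
        unfolding B'_def[abs_def] using h by (intro continuous_intros) auto
    qed
    note c = this[THEN continuous_on_compose2, of UNIV "\<lambda>x::real^2. x $ _"]
    show "continuous_on UNIV (Q r)"
      unfolding Q_def[abs_def]
      by (cases "r = k") (auto intro!: continuous_intros c)
  next
    fix x
    have \<sigma>: "\<bar>\<sigma> i j\<bar> \<le> 1" for i j by (simp add: \<sigma>_def abs_sgn_eq)
    have "\<bar>P x\<bar> \<le> (\<Sum>i<m. \<Sum>j\<le>m. \<bar>\<sigma> i j * (cubic_bump h i (x $ k) * bump h j (x $ l))\<bar>)"
      unfolding P_def by (rule order_trans[OF sum_abs sum_mono]) (rule sum_abs)
    also have "\<dots> \<le> (\<Sum>i<m. \<Sum>j\<le>m. cubic_bump h i (x $ k) * bump h j (x $ l))"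
    proof (intro sum_mono)
      fix i j
      have "\<bar>\<sigma> i j\<bar> * (cubic_bump h i (x $ k) * bump h j (x $ l)) \<le> 1 * (cubic_bump h i (x $ k) * bump h j (x $ l))"
        by (intro mult_right_mono \<sigma> mult_nonneg_nonneg cubic_bump_nonneg bump_nonneg)
      then show "\<bar>\<sigma> i j * (cubic_bump h i (x $ k) * bump h j (x $ l))\<bar> \<le> cubic_bump h i (x $ k) * bump h j (x $ l)"
        by (simp add: abs_mult cubic_bump_nonneg bump_nonneg)
    qed
    also have "\<dots> = (\<Sum>i<m. cubic_bump h i (x $ k)) * (\<Sum>j\<le>m. bump h j (x $ l))"
      by (simp add: sum_product)
    also have "\<dots> \<le> 1 * 1"
    proof (rule mult_mono)
      show "(\<Sum>j\<le>m. bump h j (x $ l)) \<le> 1"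
        using sum_bump_le_1[of h "x $ l" "Suc m"] by (simp add: lessThan_Suc_atMost)
    qed (auto intro: sum_cubic_bump_le_1 sum_nonneg bump_nonneg)
    finally show "\<bar>P x\<bar> \<le> 1" by simp
  next
    fix x assume "P x \<noteq> 0"
    then obtain i where i: "i < m" "(\<Sum>j\<le>m. \<sigma> i j * (cubic_bump h i (x $ k) * bump h j (x $ l))) \<noteq> 0"
      unfolding P_def by (meson lessThan_iff sum.neutral)
    then obtain j where j: "j \<le> m" "\<sigma> i j * (cubic_bump h i (x $ k) * bump h j (x $ l)) \<noteq> 0"
      by (meson atMost_iff sum.neutral)
    then have nz: "cubic_bump h i (x $ k) \<noteq> 0" "bump h j (x $ l) \<noteq> 0" by auto
    have "h \<le> (real i + 1) * h" "(real i + 5) * h \<le> (real m + 4) * h"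
      "h \<le> (real j + 1) * h" "(real j + 4) * h \<le> (real m + 4) * h"
      using i(1) j(1) h(1) by (auto intro!: mult_right_mono simp: mult_le_cancel_right1)
    with cubic_bump_support[OF h(1) nz(1)] bump_support[OF h(1) nz(2)]
    have "h \<le> x $ k" "x $ k \<le> (real m + 4) * h" "h \<le> x $ l" "x $ l \<le> (real m + 4) * h" by linarith+
    moreover have "r = k \<or> r = l" for r :: 2
      using kl exhaust_2[of r] exhaust_2[of k] exhaust_2[of l] by auto
    ultimately have "h \<le> x $ r \<and> x $ r \<le> (real m + 4) * h" for r by metis
    then show "x \<in> K" by (simp add: K_def mem_box_cart)
  next
    show "compact K" by (simp add: K_def compact_cbox)
    show "K \<subseteq> interior (square L)"
    proof
      fix x assume "x \<in> K"
      then have x: "h \<le> x $ i" "x $ i \<le> (real m + 4) * h" for i by (auto simp: K_def mem_box_cart)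
      have "(real m + 4) * h < L" using h by (simp add: algebra_simps)
      then show "x \<in> interior (square L)"
        unfolding mem_interior_square using less_le_trans[OF h(1) x(1)] le_less_trans[OF x(2)] by blast
    qed
  qed
  moreover have "(\<Sum>i<m. \<Sum>j\<le>m. \<bar>?b i j - ?b (Suc i) j\<bar>) = h * (\<integral>x. u x * Q k x \<partial>leb L)"
  proof -
    have "(\<Sum>i<m. \<Sum>j\<le>m. \<bar>?b i j - ?b (Suc i) j\<bar>) = (\<Sum>i<m. \<Sum>j\<le>m. \<sigma> i j * (?b i j - ?b (Suc i) j))"
      by (simp add: \<sigma>_def abs_sgn mult.commute)
    also have "\<dots> = (\<Sum>i<m. \<Sum>j\<le>m. \<integral>x. \<sigma> i j * (bump h i (x $ k) * bump h j (x $ l) * u x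
        - bump h (Suc i) (x $ k) * bump h j (x $ l) * u x) \<partial>leb L)"
      unfolding spline_coeff_def using int by simp
    also have "\<dots> = (\<integral>x. (\<Sum>i<m. \<Sum>j\<le>m. \<sigma> i j * (bump h i (x $ k) * bump h j (x $ l) * u x
        - bump h (Suc i) (x $ k) * bump h j (x $ l) * u x)) \<partial>leb L)"
      using int by (simp add: Bochner_Integration.integral_sum)
    also have "\<dots> = (\<integral>x. h * (u x * Q k x) \<partial>leb L)"
    proof (rule Bochner_Integration.integral_cong[OF refl])
      fix x
      show "(\<Sum>i<m. \<Sum>j\<le>m. \<sigma> i j * (bump h i (x $ k) * bump h j (x $ l) * u x
        - bump h (Suc i) (x $ k) * bump h j (x $ l) * u x)) = h * (u x * Q k x)"
        unfolding Q_def sum_distrib_left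
        by (intro sum.cong refl) (use h in \<open>simp add: C'_def field_simps\<close>)
    qed
    finally show ?thesis by simp
  qed
  moreover have "(\<Sum>j\<le>m. \<Sum>i<m. \<bar>?b i j - ?b (Suc i) j\<bar>) = (\<Sum>i<m. \<Sum>j\<le>m. \<bar>?b i j - ?b (Suc i) j\<bar>)"
    by (rule sum.swap)
  ultimately show ?thesis using h(1) by simp
qed

section \<open>Approximation by quasi-interpolants\<close>

text \<open>
  The quadratic polynomial \<open>t \<mapsto> integral of (f - t g)\<^sup>2\<close> is nonnegative.
\<close>

lemma integral_cauchy_schwarz:
  fixes f g :: "'a \<Rightarrow> real"
  assumes f: "integrable M (\<lambda>x. (f x)\<^sup>2)" and g: "integrable M (\<lambda>x. (g x)\<^sup>2)"
    and fg: "integrable M (\<lambda>x. f x * g x)"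
  shows "(\<integral>x. f x * g x \<partial>M)\<^sup>2 \<le> (\<integral>x. (f x)\<^sup>2 \<partial>M) * (\<integral>x. (g x)\<^sup>2 \<partial>M)"
proof -
  let ?F = "\<integral>x. (f x)\<^sup>2 \<partial>M" and ?G = "\<integral>x. (g x)\<^sup>2 \<partial>M" and ?I = "\<integral>x. f x * g x \<partial>M"
  have quad: "0 \<le> ?F - 2 * t * ?I + t\<^sup>2 * ?G" for t
  proof -
    have "0 \<le> (\<integral>x. (f x - t * g x)\<^sup>2 \<partial>M)" by (rule integral_nonneg_AE) simp
    also have "(\<lambda>x. (f x - t * g x)\<^sup>2) = (\<lambda>x. (f x)\<^sup>2 - 2 * t * (f x * g x) + t\<^sup>2 * (g x)\<^sup>2)"
      by (simp add: fun_eq_iff power2_eq_square algebra_simps)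
    also have "integral\<^sup>L M \<dots> = ?F - 2 * t * ?I + t\<^sup>2 * ?G"
      using f g fg by simp
    finally show ?thesis .
  qed
  have F0: "0 \<le> ?F" and G0: "0 \<le> ?G" by (auto intro: integral_nonneg_AE)
  show ?thesis
  proof (cases "?G = 0")
    case True
    have "?I = 0"
    proof (rule ccontr)
      assume "?I \<noteq> 0"
      have "0 \<le> ?F - 2 * ((?F + 1) / (2 * ?I)) * ?I"
        (* The polynomial is now affine, and this parameter makes it equal to -1. *)
        using quad[of "(?F + 1) / (2 * ?I)"] True by simp
      also have "\<dots> = - 1" using \<open>?I \<noteq> 0\<close> by (simp add: field_simps)
      finally show False by simp
    qed
    then show ?thesis using F0 G0 by simp
  next
    case False
    then have G: "?G > 0" using G0 by (metis le_neq_trans)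
    have "0 \<le> (?F - 2 * (?I / ?G) * ?I + (?I / ?G)\<^sup>2 * ?G) * ?G"
      using quad[of "?I / ?G"] G by (intro mult_nonneg_nonneg) auto
    also have "\<dots> = ?F * ?G - ?I\<^sup>2"
      using G by (simp add: power2_eq_square field_simps)
    finally show ?thesis by simp
  qed
qed

text \<open>
  Half-open tiles, so that the tiles of a grid are disjoint and the sum of their indicators is exactly 1
  on the open square.
\<close>

definition tile :: "real \<Rightarrow> nat \<Rightarrow> nat \<Rightarrow> (real^2) set" where
  "tile l i j = {x. (real i * l \<le> x $ 1 \<and> x $ 1 < (real i + 1) * l) \<and>
     (real j * l \<le> x $ 2 \<and> x $ 2 < (real j + 1) * l)}"

lemma tile_sets: "tile l i j \<in> sets borel"
proof -
  have [measurable]: "(\<lambda>x::real^2. x $ k) \<in> borel_measurable borel" for k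
    by (intro borel_measurable_continuous_onI continuous_intros)
  have "{x \<in> space borel. (real i * l \<le> x $ 1 \<and> x $ 1 < (real i + 1) * l) \<and>
      (real j * l \<le> x $ 2 \<and> x $ 2 < (real j + 1) * l)} \<in> sets (borel :: (real^2) measure)"
    by measurable
  then show ?thesis by (simp add: tile_def)
qed

lemma tile_measurable: "(\<lambda>x. indicator (tile l i j) x :: real) \<in> borel_measurable (leb L)"
proof -
  have "tile l i j \<in> sets lebesgue" using tile_sets by simp
  then show ?thesis by (intro measurable_restrict_space1 borel_measurable_indicator)
qed

lemma tile_subset_square:
  assumes "l > 0" "i \<le> m" "j \<le> m" "L = (real m + 1) * l"
  shows "tile l i j \<subseteq> square L"
proof
  fix x assume x: "x \<in> tile l i j"
  have "(real i + 1) * l \<le> L" "(real j + 1) * l \<le> L" "0 \<le> real i * l" "0 \<le> real j * l"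
    using assms by (auto intro!: mult_right_mono)
  then have "0 \<le> x $ 1" "x $ 1 \<le> L" "0 \<le> x $ 2" "x $ 2 \<le> L"
    using x by (auto simp: tile_def)
  then show "x \<in> square L" unfolding mem_square forall_2 by blast
qed

lemma measure_tile:
  assumes "l > 0"
  shows "measure lebesgue (tile l i j) = l\<^sup>2"
proof -
  define a b :: "real^2" where "a = vector [real i * l, real j * l]"
    and "b = vector [(real i + 1) * l, (real j + 1) * l]"
  have "\<forall>r. a $ r \<le> b $ r"
    unfolding forall_2 using assms by (simp add: a_def b_def)
  then have ab: "\<And>r. a $ r \<le> b $ r" by blast
  have "measure lebesgue (cbox a b) = l\<^sup>2"
  proof -
    have "cbox a b \<noteq> {}" using ab by (simp add: interval_ne_empty_cart)
    then have "measure lebesgue (cbox a b) = (\<Prod>r\<in>UNIV. b $ r - a $ r)"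
      by (simp add: content_cbox_cart)
    also have "\<dots> = l\<^sup>2"
      by (simp add: UNIV_2 a_def b_def power2_eq_square algebra_simps)
    finally show ?thesis .
  qed
  moreover have "measure lebesgue (tile l i j) = measure lebesgue (cbox a b)"
  proof (rule antisym)
    have "tile l i j \<subseteq> cbox a b"
      by (auto simp: tile_def mem_box_cart forall_2 a_def b_def)
    then show "measure lebesgue (tile l i j) \<le> measure lebesgue (cbox a b)"
      by (intro measure_mono_fmeasurable) (simp_all add: tile_sets)
    have sub: "box a b \<subseteq> tile l i j"
      by (auto simp: tile_def mem_box_cart forall_2 a_def b_def)
    have "tile l i j \<in> lmeasurable"
      by (rule fmeasurableI2[OF lmeasurable_cbox \<open>tile l i j \<subseteq> cbox a b\<close>]) (simp add: tile_sets)
    with sub have "measure lebesgue (box a b) \<le> measure lebesgue (tile l i j)"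
      by (intro measure_mono_fmeasurable) simp_all
    moreover have "measure lebesgue (box a b) = measure lebesgue (cbox a b)"
      by (simp add: measure_lborel_box_eq measure_lborel_cbox_eq)
    ultimately show "measure lebesgue (cbox a b) \<le> measure lebesgue (tile l i j)" by simp
  qed
  ultimately show ?thesis by simp
qed

lemma sum_indicator_intervals:
  assumes "l \<ge> 0"
  shows "(\<Sum>i\<le>m. indicator {real i * l..<(real i + 1) * l} s) = (indicator {0..<(real m + 1) * l} s :: real)"
proof (induction m)
  case (Suc m)
  have "0 \<le> (real m + 1) * l" "(real m + 1) * l \<le> (real m + 2) * l"
    using assms by (auto intro!: mult_right_mono)
  then have "indicator {0..<(real m + 1) * l} s + indicator {(real m + 1) * l..<(real m + 2) * l} s =
      (indicator {0..<(real m + 2) * l} s :: real)"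
    by (auto simp: indicator_def)
  moreover have eqs: "real (Suc m) = real m + 1" "real m + 1 + 1 = real m + 2" by simp_all
  ultimately show ?case unfolding sum.atMost_Suc Suc eqs by blast
qed (simp add: indicator_def)

lemma sum_indicator_tile:
  assumes "l > 0" "L = (real m + 1) * l" "x \<in> interior (square L)"
  shows "(\<Sum>i\<le>m. \<Sum>j\<le>m. indicator (tile l i j) x) = (1 :: real)"
proof -
  have "(\<Sum>i\<le>m. \<Sum>j\<le>m. indicator (tile l i j) x) =
      (\<Sum>i\<le>m. \<Sum>j\<le>m. indicator {real i * l..<(real i + 1) * l} (x $ 1) *
        (indicator {real j * l..<(real j + 1) * l} (x $ 2) :: real))"
    by (intro sum.cong refl) (auto simp: tile_def indicator_def)
  also have "\<dots> = (\<Sum>i\<le>m. indicator {real i * l..<(real i + 1) * l} (x $ 1)) *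
      (\<Sum>j\<le>m. indicator {real j * l..<(real j + 1) * l} (x $ 2))"
    by (simp add: sum_product)
  also have "\<dots> = 1"
    unfolding sum_indicator_intervals[OF less_imp_le[OF assms(1)]] assms(2)[symmetric]
    using assms(3) by (simp add: mem_interior_square indicator_def less_imp_le)
  finally show ?thesis .
qed

definition tile_integral :: "real \<Rightarrow> (real^2 \<Rightarrow> real) \<Rightarrow> real \<Rightarrow> nat \<Rightarrow> nat \<Rightarrow> real" where
  "tile_integral L \<phi> l i j = (\<integral>x. indicator (tile l i j) x * \<phi> x \<partial>leb L)"

lemma integrable_tile_mult:
  fixes \<phi> :: "real^2 \<Rightarrow> real"
  shows "integrable (leb L) \<phi> \<Longrightarrow> integrable (leb L) (\<lambda>x. indicator (tile l i j) x * \<phi> x)"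
  by (rule integrable_bounded_mult[where K = 1, OF _ tile_measurable]) (auto simp: indicator_def)

lemma integral_indicator_tile:
  assumes "l > 0" "i \<le> m" "j \<le> m" "L = (real m + 1) * l"
  shows "(\<integral>x. indicator (tile l i j) x \<partial>leb L) = l\<^sup>2"
proof -
  have "tile l i j \<in> sets (leb L)"
    using tile_sets tile_subset_square[OF assms] by (simp add: sets_restrict_space_iff sets_square)
  then have "(\<integral>x. indicator (tile l i j) x \<partial>leb L) = measure (leb L) (tile l i j \<inter> space (leb L))"
    by (intro Bochner_Integration.integral_indicator)
  also have "\<dots> = measure lebesgue (tile l i j)"
    using tile_subset_square[OF assms] by (simp add: measure_restrict_space sets_square inf_absorb1)
  finally show ?thesis using measure_tile[OF assms(1)] by simp
qed

lemma integral_double_sum: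
  fixes g :: "nat \<Rightarrow> nat \<Rightarrow> 'a \<Rightarrow> real"
  assumes "\<And>i j. integrable M (g i j)"
  shows "(\<integral>x. (\<Sum>i\<le>m. \<Sum>j\<le>n. g i j x) \<partial>M) = (\<Sum>i\<le>m. \<Sum>j\<le>n. \<integral>x. g i j x \<partial>M)"
  using assms by simp

lemma sum_integral_tile:
  assumes "l > 0" "L = (real m + 1) * l" "integrable (leb L) \<phi>"
  shows "(\<Sum>i\<le>m. \<Sum>j\<le>m. tile_integral L \<phi> l i j) = (\<integral>x. \<phi> x \<partial>leb L)"
proof -
  have "(\<Sum>i\<le>m. \<Sum>j\<le>m. tile_integral L \<phi> l i j) =
      (\<integral>x. (\<Sum>i\<le>m. \<Sum>j\<le>m. indicator (tile l i j) x * \<phi> x) \<partial>leb L)"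
    unfolding tile_integral_def by (intro integral_double_sum[symmetric] integrable_tile_mult assms(3))
  also have "\<dots> = (\<integral>x. \<phi> x \<partial>leb L)"
  proof (rule integral_cong_AE)
    show "(\<lambda>x. \<Sum>i\<le>m. \<Sum>j\<le>m. indicator (tile l i j) x * \<phi> x) \<in> borel_measurable (leb L)"
      using integrable_tile_mult[OF assms(3)] by (intro borel_measurable_sum borel_measurable_integrable)
    show "\<phi> \<in> borel_measurable (leb L)" using assms(3) by (rule borel_measurable_integrable)
    show "AE x in leb L. (\<Sum>i\<le>m. \<Sum>j\<le>m. indicator (tile l i j) x * \<phi> x) = \<phi> x"
      using AE_leb_interior
    proof eventually_elim
      case (elim x)
      have "(\<Sum>i\<le>m. \<Sum>j\<le>m. indicator (tile l i j) x * \<phi> x) =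
          (\<Sum>i\<le>m. \<Sum>j\<le>m. indicator (tile l i j) x) * \<phi> x"
        by (simp add: sum_distrib_right)
      then show ?case using sum_indicator_tile[OF assms(1,2) elim] by simp
    qed
  qed
  finally show ?thesis .
qed

text \<open>
  Cauchy-Schwarz on each tile; the tiles have measure \<open>l\<^sup>2\<close> and their indicators sum to 1.
\<close>

lemma sum_tile_integral_square_le:
  assumes l: "l > 0" "L = (real m + 1) * l" and \<phi>: "\<phi> \<in> L2 L"
  shows "(\<Sum>i\<le>m. \<Sum>j\<le>m. (tile_integral L \<phi> l i j)\<^sup>2) \<le> l\<^sup>2 * (\<integral>x. (\<phi> x)\<^sup>2 \<partial>leb L)"
proof -
  have int: "integrable (leb L) \<phi>" "integrable (leb L) (\<lambda>x. (\<phi> x)\<^sup>2)"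
    using \<phi> L2_imp_integrable[OF \<phi>] by (auto simp: L2_def)
  have "(tile_integral L \<phi> l i j)\<^sup>2 \<le> l\<^sup>2 * tile_integral L (\<lambda>x. (\<phi> x)\<^sup>2) l i j"
    if ij: "i \<le> m" "j \<le> m" for i j
  proof -
    let ?T = "\<lambda>x. indicator (tile l i j) x :: real"
    have sq: "(\<lambda>x. (?T x)\<^sup>2) = ?T" "(\<lambda>x. (?T x * \<phi> x)\<^sup>2) = (\<lambda>x. ?T x * (\<phi> x)\<^sup>2)"
      "(\<lambda>x. ?T x * (?T x * \<phi> x)) = (\<lambda>x. ?T x * \<phi> x)"
      by (auto simp: fun_eq_iff indicator_def)
    have "(\<integral>x. ?T x * (?T x * \<phi> x) \<partial>leb L)\<^sup>2 \<le> (\<integral>x. (?T x)\<^sup>2 \<partial>leb L) * (\<integral>x. (?T x * \<phi> x)\<^sup>2 \<partial>leb L)"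
      using integrable_tile_mult[OF int(1)] integrable_tile_mult[OF int(2)]
        integrable_tile_mult[OF integrable_const_leb[of L 1]]
      by (intro integral_cauchy_schwarz) (simp_all add: sq)
    then show ?thesis
      unfolding sq tile_integral_def using integral_indicator_tile[OF l(1) ij l(2)] by simp
  qed
  then have "(\<Sum>i\<le>m. \<Sum>j\<le>m. (tile_integral L \<phi> l i j)\<^sup>2) \<le>
      (\<Sum>i\<le>m. \<Sum>j\<le>m. l\<^sup>2 * tile_integral L (\<lambda>x. (\<phi> x)\<^sup>2) l i j)"
    by (intro sum_mono) auto
  also have "\<dots> = l\<^sup>2 * (\<integral>x. (\<phi> x)\<^sup>2 \<partial>leb L)"
    using sum_integral_tile[OF l int(2)] by (simp flip: sum_distrib_left)
  finally show ?thesis .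
qed

lemma tile_integral_diff_le:
  assumes l: "l > 0" "L = (real m + 1) * l" "i \<le> m" "j \<le> m" and \<phi>: "integrable (leb L) \<phi>"
    and close: "\<And>y. y \<in> tile l i j \<Longrightarrow> y \<in> square L \<Longrightarrow> \<bar>\<phi> y - c\<bar> \<le> e"
  shows "\<bar>tile_integral L \<phi> l i j - l\<^sup>2 * c\<bar> \<le> l\<^sup>2 * e"
proof -
  let ?T = "\<lambda>x. indicator (tile l i j) x :: real"
  note intT = integrable_tile_mult[OF integrable_const_leb[of L 1], of l i j, simplified]
  have "tile_integral L \<phi> l i j - l\<^sup>2 * c = (\<integral>x. ?T x * \<phi> x - ?T x * c \<partial>leb L)"
  proof -
    have "(\<integral>x. ?T x * \<phi> x - ?T x * c \<partial>leb L) = tile_integral L \<phi> l i j - (\<integral>x. ?T x * c \<partial>leb L)"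
      unfolding tile_integral_def using integrable_tile_mult[OF \<phi>] intT
      by (intro Bochner_Integration.integral_diff) auto
    also have "(\<integral>x. ?T x * c \<partial>leb L) = (\<integral>x. ?T x \<partial>leb L) * c"
      by (rule integral_mult_left_zero)
    finally show ?thesis by (simp only: integral_indicator_tile[OF l(1,3,4,2)])
  qed
  also have "\<bar>\<dots>\<bar> \<le> (\<integral>x. ?T x * e \<partial>leb L)"
  proof (rule integral_abs_bound[THEN order_trans], rule integral_mono)
    show "integrable (leb L) (\<lambda>x. \<bar>?T x * \<phi> x - ?T x * c\<bar>)"
      using integrable_tile_mult[OF \<phi>] intT by simp
    show "integrable (leb L) (\<lambda>x. ?T x * e)" using intT by simp
    show "\<bar>?T x * \<phi> x - ?T x * c\<bar> \<le> ?T x * e" if "x \<in> space (leb L)" for x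
      using close[of x] that by (simp add: indicator_def)
  qed
  also have "\<dots> = (\<integral>x. ?T x \<partial>leb L) * e" by (rule integral_mult_left_zero)
  also have "\<dots> = l\<^sup>2 * e" by (simp only: integral_indicator_tile[OF l(1,3,4,2)])
  finally show ?thesis .
qed

text \<open>
  Two meshes are used. The splines need a mesh of width \<open>L / (m + 5)\<close> that leaves room at the boundary,
  while the tiles, of side \<open>L / (m + 1)\<close>, must cover the square exactly, since otherwise the tile integrals
  of a function of mean 0 would not sum to 0. The two index ranges agree, and the support of a product of
  bumps stays within distance \<open>8 * h\<close> of the tile of the same index.
\<close>

definition quasi_interpolant :: "real \<Rightarrow> (real^2 \<Rightarrow> real) \<Rightarrow> nat \<Rightarrow> real^2 \<Rightarrow> real" where
  "quasi_interpolant L \<phi> m x = (let h = L / (real m + 5); l = L / (real m + 1) in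
     (\<Sum>i\<le>m. \<Sum>j\<le>m. (bump h i (x $ 1) * bump h j (x $ 2)) * (tile_integral L \<phi> l i j / h\<^sup>2)))"

lemma continuous_on_quasi_interpolant: "continuous_on S (quasi_interpolant L \<phi> m)"
  unfolding quasi_interpolant_def[abs_def] Let_def
  by (intro continuous_on_sum continuous_on_mult_right continuous_on_tensor_bump)

lemma sum_tensor_bump:
  "(\<Sum>i\<le>m. \<Sum>j\<le>m. bump h i s * bump h j t) = (\<Sum>i\<le>m. bump h i s) * (\<Sum>j\<le>m. bump h j t)"
  by (simp add: sum_product)

text \<open>
  The bumps are nonnegative with sum at most 1, so a weighted sum is bounded by the weights that are
  actually seen.
\<close>

lemma weighted_sum_bump_le:
  assumes "\<And>i j. i \<le> m \<Longrightarrow> j \<le> m \<Longrightarrow> bump h i s * bump h j t \<noteq> 0 \<Longrightarrow> \<bar>w i j\<bar> \<le> e" "0 \<le> e"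
  shows "\<bar>\<Sum>i\<le>m. \<Sum>j\<le>m. (bump h i s * bump h j t) * w i j\<bar> \<le> e"
proof -
  have "\<bar>\<Sum>i\<le>m. \<Sum>j\<le>m. (bump h i s * bump h j t) * w i j\<bar> \<le>
      (\<Sum>i\<le>m. \<Sum>j\<le>m. \<bar>(bump h i s * bump h j t) * w i j\<bar>)"
    by (rule order_trans[OF sum_abs sum_mono]) (rule sum_abs)
  also have "\<dots> \<le> (\<Sum>i\<le>m. \<Sum>j\<le>m. (bump h i s * bump h j t) * e)"
  proof (intro sum_mono)
    fix i j assume "i \<in> {..m}" "j \<in> {..m}"
    then have w: "bump h i s * bump h j t \<noteq> 0 \<Longrightarrow> \<bar>w i j\<bar> \<le> e" using assms(1)[of i j] by simp
    have step: "\<bar>\<beta> * w i j\<bar> \<le> \<beta> * e" if "0 \<le> \<beta>" "\<beta> \<noteq> 0 \<Longrightarrow> \<bar>w i j\<bar> \<le> e" for \<beta>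
      using that by (cases "\<beta> = 0") (simp_all add: abs_mult mult_left_mono)
    show "\<bar>(bump h i s * bump h j t) * w i j\<bar> \<le> (bump h i s * bump h j t) * e"
      by (rule step[OF _ w]) (simp add: bump_nonneg)
  qed
  also have "\<dots> = (\<Sum>i\<le>m. bump h i s) * (\<Sum>j\<le>m. bump h j t) * e"
    by (simp add: sum_tensor_bump flip: sum_distrib_right)
  also have "\<dots> \<le> 1 * 1 * e"
    using sum_bump_le_1[of h s "Suc m"] sum_bump_le_1[of h t "Suc m"] assms(2)
    by (intro mult_mono mult_right_mono) (auto simp: lessThan_Suc_atMost intro!: sum_nonneg bump_nonneg)
  finally show ?thesis by simp
qed

lemma mesh_ratio:
  assumes "L > 0"
  shows "0 < L / (real m + 5)" "0 < L / (real m + 1)" "L / (real m + 1) \<le> 5 * (L / (real m + 5))"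
    "(L / (real m + 1))\<^sup>2 / (L / (real m + 5))\<^sup>2 \<le> 25"
    "(L / (real m + 1)) / (L / (real m + 5)) = 1 + 4 / (real m + 1)"
proof -
  show 1: "0 < L / (real m + 5)" "0 < L / (real m + 1)" using assms by auto
  show 2: "L / (real m + 1) \<le> 5 * (L / (real m + 5))"
    using assms by (simp add: field_simps)
  have "a\<^sup>2 / b\<^sup>2 \<le> 25" if "0 < a" "0 < b" "a \<le> 5 * b" for a b :: real
    using power_mono[OF that(3), of 2] that by (simp add: power_mult_distrib divide_le_eq)
  from this[OF 1(2,1) 2] show "(L / (real m + 1))\<^sup>2 / (L / (real m + 5))\<^sup>2 \<le> 25" .
  have "(L / a) / (L / b) = b / a" if "0 < a" "0 < b" for a b :: real
    using assms that by (simp add: divide_divide_eq_left divide_divide_eq_right)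
  then have "(L / (real m + 1)) / (L / (real m + 5)) = (real m + 5) / (real m + 1)" by simp
  also have "\<dots> = 1 + 4 / (real m + 1)" by (simp add: field_simps)
  finally show "(L / (real m + 1)) / (L / (real m + 5)) = 1 + 4 / (real m + 1)" .
qed

lemma quasi_interpolant_bounded:
  assumes L: "L > 0" and \<phi>: "integrable (leb L) \<phi>" and K: "\<And>x. x \<in> square L \<Longrightarrow> \<bar>\<phi> x\<bar> \<le> K"
  shows "\<bar>quasi_interpolant L \<phi> m x\<bar> \<le> 25 * K"
proof -
  define h l where "h = L / (real m + 5)" and "l = L / (real m + 1)"
  note r = mesh_ratio[OF L, of m, folded h_def l_def]
  have "0 \<in> square L" using L by (simp add: mem_square)
  then have K0: "0 \<le> K" using K abs_ge_zero order_trans by blast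
  have "\<bar>tile_integral L \<phi> l i j / h\<^sup>2\<bar> \<le> 25 * K" if "i \<le> m" "j \<le> m" for i j
  proof -
    have "\<bar>tile_integral L \<phi> l i j\<bar> \<le> l\<^sup>2 * K"
    proof -
      have "L = (real m + 1) * l" by (simp add: l_def)
      from tile_integral_diff_le[OF r(2) this that \<phi>, of 0 K] show ?thesis using K by simp
    qed
    then have "\<bar>tile_integral L \<phi> l i j / h\<^sup>2\<bar> \<le> l\<^sup>2 / h\<^sup>2 * K"
      using r(1) by (simp add: divide_right_mono)
    also have "\<dots> \<le> 25 * K" using r(4) K0 by (rule mult_right_mono)
    finally show ?thesis .
  qed
  then show ?thesis
    unfolding quasi_interpolant_def Let_def h_def[symmetric] l_def[symmetric]
    using K0 by (intro weighted_sum_bump_le) auto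
qed

text \<open>
  For small \<open>h\<close> the bumps sum to 1 at the interior point \<open>x\<close>, so the quasi-interpolant is an average of
  tile means, up to the factor \<open>(l / h)\<^sup>2\<close>, which tends to 1. Only tiles close to \<open>x\<close> contribute, and there
  \<open>\<phi>\<close> is close to \<open>\<phi> x\<close>.
\<close>

lemma quasi_interpolant_tendsto:
  assumes L: "L > 0" and \<phi>: "continuous_on (square L) \<phi>" and x: "x \<in> interior (square L)"
  shows "(\<lambda>m. quasi_interpolant L \<phi> m x) \<longlonglongrightarrow> \<phi> x"
proof (rule LIMSEQ_I)
  fix r :: real assume "0 < r"
  (* The final error is below 26 * e: 25 * e from the oscillation of \<open>\<phi>\<close> (25 bounds the squared ratio of
     the mesh widths), and e from replacing that ratio by 1. *)
  define e where "e = r / 52"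
  have e: "e > 0" using \<open>0 < r\<close> by (simp add: e_def)
  have int: "integrable (leb L) \<phi>"
    using integrable_continuous_mult[OF integrable_const_leb[of L 1] \<phi>] by simp
  obtain d where d: "d > 0" "\<And>y. y \<in> square L \<Longrightarrow> dist y x < d \<Longrightarrow> \<bar>\<phi> y - \<phi> x\<bar> < e"
    using \<phi> x interior_subset e unfolding continuous_on_iff dist_real_def by blast
  define h l where "h m = L / (real m + 5)" and "l m = L / (real m + 1)" for m
  have h0: "h \<longlonglongrightarrow> 0"
    using tendsto_mult_right[OF LIMSEQ_ignore_initial_segment[OF lim_inverse_n', of 5], of L]
    by (simp add: h_def[abs_def] add.commute)
  have ratio: "(\<lambda>m. (l m)\<^sup>2 / (h m)\<^sup>2) \<longlonglongrightarrow> 1"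
  proof -
    have "(\<lambda>m. (1 + 4 * inverse (real (Suc m)))\<^sup>2) \<longlonglongrightarrow> (1 + 4 * 0)\<^sup>2"
      by (intro tendsto_intros LIMSEQ_inverse_real_of_nat)
    moreover have "(1 + 4 * inverse (real (Suc m)))\<^sup>2 = (l m)\<^sup>2 / (h m)\<^sup>2" for m
    proof -
      have "l m / h m = 1 + 4 * inverse (real (Suc m))"
        unfolding h_def l_def mesh_ratio(5)[OF L] by (simp add: inverse_eq_divide add.commute)
      then show ?thesis by (simp only: power_divide[symmetric])
    qed
    ultimately show ?thesis by simp
  qed
  have "(\<lambda>m. (l m)\<^sup>2 / (h m)\<^sup>2 * \<phi> x) \<longlonglongrightarrow> 1 * \<phi> x"
    by (intro tendsto_intros ratio)
  then have ev1: "eventually (\<lambda>m. dist ((l m)\<^sup>2 / (h m)\<^sup>2 * \<phi> x) (\<phi> x) < e) sequentially"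
    using e by (simp add: tendstoD)
  (* This smallness makes the averages local and puts \<open>x\<close> at distance more than 3 * h from the boundary, where the
     bumps sum to 1. *)
  define \<delta> where "\<delta> = min (d / 8) (min (min (x $ 1 / 3) (x $ 2 / 3)) (min ((L - x $ 1) / 3) ((L - x $ 2) / 3)))"
  have "\<delta> > 0" using x d by (simp add: \<delta>_def mem_interior_square)
  with h0 have ev2: "eventually (\<lambda>m. h m < \<delta>) sequentially"
    by (rule order_tendstoD)
  from ev1 ev2 have "eventually (\<lambda>m. norm (quasi_interpolant L \<phi> m x - \<phi> x) < r) sequentially"
  proof eventually_elim
    case (elim m)
    define H l' where "H = h m" and "l' = l m"
    have Lm: "L = (real m + 5) * H" "L = (real m + 1) * l'"
      by (simp_all add: H_def l'_def h_def l_def field_simps)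
    note ratio' = mesh_ratio[OF L, of m, folded h_def l_def, folded H_def l'_def]
    have small: "8 * H < d" "3 * H < x $ 1" "3 * H < x $ 2" "3 * H < L - x $ 1" "3 * H < L - x $ 2"
      using elim(2) by (auto simp: \<delta>_def H_def)
    have one: "(\<Sum>i\<le>m. bump H i (x $ k)) = 1" if "3 * H < x $ k" "3 * H < L - x $ k" for k
    proof -
      have "(\<Sum>i\<le>m. bump H i (x $ k)) = ramp2 (x $ k / H - 1) - ramp2 (x $ k / H - 1 - real (Suc m))"
        unfolding bump_def using sum_bspline2[of "x $ k / H - 1" "Suc m"] by (simp add: lessThan_Suc_atMost)
      moreover have "2 \<le> x $ k / H - 1" using that ratio'(1) by (simp add: field_simps)
      moreover have "x $ k / H - 1 - real (Suc m) \<le> 0"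
        using that ratio'(1) Lm(1) by (simp add: field_simps)
      ultimately show ?thesis by (simp add: ramp2_eq_0 ramp2_eq_1)
    qed
    have close: "\<bar>tile_integral L \<phi> l' i j / H\<^sup>2 - l'\<^sup>2 / H\<^sup>2 * \<phi> x\<bar> \<le> 25 * e"
      if ij: "i \<le> m" "j \<le> m" and nz: "bump H i (x $ 1) * bump H j (x $ 2) \<noteq> 0" for i j
    proof -
      have "\<bar>tile_integral L \<phi> l' i j - l'\<^sup>2 * \<phi> x\<bar> \<le> l'\<^sup>2 * e"
      proof (rule tile_integral_diff_le[OF ratio'(2) Lm(2) ij int])
        fix y assume y: "y \<in> tile l' i j" "y \<in> square L"
        have coord: "\<bar>y $ k - x $ k\<bar> \<le> 4 * H"
          if "n \<le> m" "bump H n (x $ k) \<noteq> 0" "real n * l' \<le> y $ k" "y $ k < (real n + 1) * l'" for k n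
        proof -
          have l': "l' = H + 4 * H / (real m + 1)"
            using ratio'(1,5) by (simp add: field_simps)
          (* Up to index m the two meshes drift apart by at most four spline widths. *)
          have "(real n + 1) * l' = (real n + 1) * H + 4 * H * ((real n + 1) / (real m + 1))"
            unfolding l' by (simp add: algebra_simps)
          also have "\<dots> \<le> (real n + 1) * H + 4 * H * 1"
            using that(1) ratio'(1) by (intro add_left_mono mult_left_mono) auto
          finally have up: "(real n + 1) * l' \<le> (real n + 5) * H" by (simp add: algebra_simps)
          have "H \<le> l'" unfolding l' using ratio'(1) by simp
          then have low: "real n * H \<le> real n * l'" by (rule mult_left_mono) simp
          show ?thesis
            using bump_support[OF ratio'(1) that(2)] that(3,4) up low
            by (simp add: abs_le_iff algebra_simps)
        qed
        have "\<bar>y $ 1 - x $ 1\<bar> \<le> 4 * H" "\<bar>y $ 2 - x $ 2\<bar> \<le> 4 * H"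
          using coord ij nz y(1) by (auto simp: tile_def)
        then have "norm (y - x) \<le> 8 * H"
          using norm_le_l1_cart[of "y - x"] by (simp add: sum_2)
        then have "dist y x < d" using small(1) by (simp add: dist_norm)
        from d(2)[OF y(2) this] show "\<bar>\<phi> y - \<phi> x\<bar> \<le> e" by simp
      qed
      then have "\<bar>(tile_integral L \<phi> l' i j - l'\<^sup>2 * \<phi> x) / H\<^sup>2\<bar> \<le> l'\<^sup>2 / H\<^sup>2 * e"
        by (simp add: divide_right_mono)
      also have "\<dots> \<le> 25 * e" using ratio'(4) e by (intro mult_right_mono) auto
      finally show ?thesis by (simp add: diff_divide_distrib)
    qed
    have "quasi_interpolant L \<phi> m x - l'\<^sup>2 / H\<^sup>2 * \<phi> x =
        (\<Sum>i\<le>m. \<Sum>j\<le>m. (bump H i (x $ 1) * bump H j (x $ 2)) *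
          (tile_integral L \<phi> l' i j / H\<^sup>2 - l'\<^sup>2 / H\<^sup>2 * \<phi> x))"
    proof -
      have "(\<Sum>i\<le>m. \<Sum>j\<le>m. (bump H i (x $ 1) * bump H j (x $ 2)) * (l'\<^sup>2 / H\<^sup>2 * \<phi> x)) =
          (\<Sum>i\<le>m. bump H i (x $ 1)) * (\<Sum>j\<le>m. bump H j (x $ 2)) * (l'\<^sup>2 / H\<^sup>2 * \<phi> x)"
        by (simp only: sum_tensor_bump flip: sum_distrib_right)
      also have "\<dots> = l'\<^sup>2 / H\<^sup>2 * \<phi> x" using one small by simp
      finally show ?thesis
        unfolding quasi_interpolant_def Let_def
        by (simp add: right_diff_distrib sum_subtractf H_def l'_def h_def l_def)
    qed
    also have "\<bar>\<dots>\<bar> \<le> 25 * e"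
      using e by (intro weighted_sum_bump_le close) auto
    finally have "\<bar>quasi_interpolant L \<phi> m x - l'\<^sup>2 / H\<^sup>2 * \<phi> x\<bar> \<le> 25 * e" .
    moreover have "\<bar>l'\<^sup>2 / H\<^sup>2 * \<phi> x - \<phi> x\<bar> < e"
      using elim(1) by (simp add: H_def l'_def dist_real_def)
    ultimately have "\<bar>quasi_interpolant L \<phi> m x - \<phi> x\<bar> \<le> 26 * e" by linarith
    also have "\<dots> < r" using \<open>0 < r\<close> by (simp add: e_def)
    finally show ?case by simp
  qed
  then show "\<exists>no. \<forall>n\<ge>no. norm (quasi_interpolant L \<phi> n x - \<phi> x) < r"
    by (simp add: eventually_sequentially)
qed

section \<open>The Poincare-Sobolev inequality\<close>

lemma continuous_imp_L2:
  assumes "continuous_on (square L) \<phi>" shows "\<phi> \<in> L2 L"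
proof -
  have "integrable (leb L) (\<lambda>x. (\<phi> x)\<^sup>2 * 1)"
    by (intro integrable_continuous_mult integrable_const_leb continuous_intros assms)
  then show ?thesis using measurable_leb_continuous[OF assms] by (simp add: L2_def)
qed

text \<open>
  Integrating \<open>u\<close> against the quasi-interpolant pairs the spline coefficients of \<open>u\<close> with the tile
  integrals of \<open>\<phi>\<close>. The former have variation at most \<open>h * tv L u\<close>, the latter sum to 0, so the discrete
  inequality applies. The powers of the mesh widths cancel up to their
  bounded ratio.
\<close>

lemma integral_quasi_interpolant_square_le:
  assumes L: "L > 0" and u: "u \<in> BV L" and \<phi>: "continuous_on (square L) \<phi>"
    and mean0: "(\<integral>x. \<phi> x \<partial>leb L) = 0"
  shows "(\<integral>x. quasi_interpolant L \<phi> m x * u x \<partial>leb L)\<^sup>2 \<le> 100 * (tv L u)\<^sup>2 * (\<integral>x. (\<phi> x)\<^sup>2 \<partial>leb L)"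
proof -
  define h l where "h = L / (real m + 5)" and "l = L / (real m + 1)"
  note r = mesh_ratio[OF L, of m, folded h_def l_def]
  have Lm: "L = (real m + 5) * h" "L = (real m + 1) * l" by (simp_all add: h_def l_def)
  let ?b = "spline_coeff L u h 1 2" and ?w = "tile_integral L \<phi> l" and ?S = "\<integral>x. (\<phi> x)\<^sup>2 \<partial>leb L"
  have b_swap: "spline_coeff L u h 2 1 j i = ?b i j" for i j
    by (simp add: spline_coeff_def mult.commute)
  have L2: "\<phi> \<in> L2 L" by (rule continuous_imp_L2[OF \<phi>])
  have "(\<Sum>i\<le>m. \<Sum>j\<le>m. ?b i j * ?w i j)\<^sup>2 \<le> 4 * (h * tv L u)\<^sup>2 * (\<Sum>i\<le>m. \<Sum>j\<le>m. (?w i j)\<^sup>2)"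
  proof (rule discrete_poincare_sobolev)
    show "(\<Sum>j\<le>m. \<Sum>i<m. \<bar>?b i j - ?b (Suc i) j\<bar>) \<le> h * tv L u"
      by (rule spline_coeff_variation[OF u r(1) Lm(1)]) simp
    show "(\<Sum>i\<le>m. \<Sum>j<m. \<bar>?b i j - ?b i (Suc j)\<bar>) \<le> h * tv L u"
      using spline_coeff_variation[OF u r(1) Lm(1), of 2 1] by (simp add: b_swap)
    show "(\<Sum>i\<le>m. \<Sum>j\<le>m. ?w i j) = 0"
      using sum_integral_tile[OF r(2) Lm(2) L2_imp_integrable[OF L2]] mean0 by simp
  qed
  also have "\<dots> \<le> 4 * (h * tv L u)\<^sup>2 * (l\<^sup>2 * ?S)"
    by (intro mult_left_mono sum_tile_integral_square_le[OF r(2) Lm(2) L2]) simp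
  finally have bw: "(\<Sum>i\<le>m. \<Sum>j\<le>m. ?b i j * ?w i j)\<^sup>2 \<le> 4 * (h * tv L u)\<^sup>2 * (l\<^sup>2 * ?S)" .
  have int: "integrable (leb L) (\<lambda>x. bump h i (x $ 1) * bump h j (x $ 2) * u x)" for i j
    by (rule integrable_continuous_mult[OF BV_integrable[OF u] continuous_on_tensor_bump])
  have "(\<integral>x. quasi_interpolant L \<phi> m x * u x \<partial>leb L) =
      (\<integral>x. (\<Sum>i\<le>m. \<Sum>j\<le>m. (bump h i (x $ 1) * bump h j (x $ 2) * u x) * (?w i j / h\<^sup>2)) \<partial>leb L)"
    unfolding quasi_interpolant_def Let_def h_def[symmetric] l_def[symmetric]
    by (intro Bochner_Integration.integral_cong refl) (simp only: sum_distrib_right sum_distrib_left mult_ac)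
  also have "\<dots> = (\<Sum>i\<le>m. \<Sum>j\<le>m. \<integral>x. (bump h i (x $ 1) * bump h j (x $ 2) * u x) * (?w i j / h\<^sup>2) \<partial>leb L)"
    by (intro integral_double_sum integrable_mult_left int)
  also have "\<dots> = (\<Sum>i\<le>m. \<Sum>j\<le>m. ?b i j * ?w i j) / h\<^sup>2"
    by (simp add: spline_coeff_def sum_divide_distrib)
  finally have "(\<integral>x. quasi_interpolant L \<phi> m x * u x \<partial>leb L)\<^sup>2 =
      (\<Sum>i\<le>m. \<Sum>j\<le>m. ?b i j * ?w i j)\<^sup>2 / (h\<^sup>2 * h\<^sup>2)"
    by (simp add: power_divide power2_eq_square)
  also have "\<dots> \<le> 4 * (h * tv L u)\<^sup>2 * (l\<^sup>2 * ?S) / (h\<^sup>2 * h\<^sup>2)"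
    by (rule divide_right_mono[OF bw]) simp
  also have "\<dots> = 4 * (tv L u)\<^sup>2 * (l\<^sup>2 / h\<^sup>2) * ?S"
  proof -
    have "4 * (a * t) * (b * S) / (a * a) = 4 * t * (b / a) * S" if "a \<noteq> 0" for a b t S :: real
      using that by (simp add: field_simps)
    from this[of "h\<^sup>2"] show ?thesis using r(1) unfolding power_mult_distrib by simp
  qed
  also have "\<dots> \<le> 4 * (tv L u)\<^sup>2 * 25 * ?S"
    using r(4) by (intro mult_right_mono mult_left_mono) auto
  finally show ?thesis by simp
qed

lemma integral_continuous_mult_BV_le:
  assumes L: "L > 0" and u: "u \<in> BV L" and \<phi>: "continuous_on (square L) \<phi>"
    and mean0: "(\<integral>x. \<phi> x \<partial>leb L) = 0"
  shows "(\<integral>x. \<phi> x * u x \<partial>leb L)\<^sup>2 \<le> 100 * (tv L u)\<^sup>2 * (\<integral>x. (\<phi> x)\<^sup>2 \<partial>leb L)"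
proof -
  have int: "integrable (leb L) \<phi>" by (rule L2_imp_integrable[OF continuous_imp_L2[OF \<phi>]])
  obtain K where K: "\<And>x. x \<in> square L \<Longrightarrow> \<bar>\<phi> x\<bar> \<le> K"
    using compact_imp_bounded[OF compact_continuous_image[OF \<phi> compact_square]]
    by (auto simp: bounded_iff)
  have "(\<lambda>m. \<integral>x. quasi_interpolant L \<phi> m x * u x \<partial>leb L) \<longlonglongrightarrow> (\<integral>x. \<phi> x * u x \<partial>leb L)"
  proof (rule tendsto_integral_bounded_mult[OF BV_integrable[OF u]])
    show "quasi_interpolant L \<phi> m \<in> borel_measurable (leb L)" for m
      by (rule measurable_leb_continuous[OF continuous_on_quasi_interpolant])
    show "\<phi> \<in> borel_measurable (leb L)" by (rule measurable_leb_continuous[OF \<phi>])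
    show "AE x in leb L. (\<lambda>m. quasi_interpolant L \<phi> m x) \<longlonglongrightarrow> \<phi> x"
      using AE_leb_interior by eventually_elim (rule quasi_interpolant_tendsto[OF L \<phi>])
    show "\<bar>quasi_interpolant L \<phi> m x\<bar> \<le> 25 * K" for m x
      by (rule quasi_interpolant_bounded[OF L int K])
  qed
  then have "(\<lambda>m. (\<integral>x. quasi_interpolant L \<phi> m x * u x \<partial>leb L)\<^sup>2) \<longlonglongrightarrow> (\<integral>x. \<phi> x * u x \<partial>leb L)\<^sup>2"
    by (rule tendsto_power)
  then show ?thesis
    by (rule LIMSEQ_le_const2)
       (use integral_quasi_interpolant_square_le[OF L u \<phi> mean0] in blast)
qed

lemma integral_diff_mean_eq_0:
  assumes "L > 0" "integrable (leb L) u"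
  shows "(\<integral>x. u x - mean L u \<partial>leb L) = 0"
  using assms integral_const_leb[OF assms(1), of "mean L u"] integrable_const_leb[of L "mean L u"]
  by (simp add: mean_def)

text \<open>
  Measurable functions are limits almost everywhere of continuous ones; truncating these at the bound
  of \<open>\<phi>\<close> preserves the limit.
\<close>

lemma bounded_measurable_approx_continuous:
  fixes \<phi> :: "real^2 \<Rightarrow> real"
  assumes \<phi>: "\<phi> \<in> borel_measurable (leb L)" and K: "\<And>x. x \<in> square L \<Longrightarrow> \<bar>\<phi> x\<bar> \<le> K" "0 \<le> K"
  obtains g where "\<And>n. continuous_on UNIV (g n)" "\<And>n x. \<bar>g n x\<bar> \<le> K"
    "AE x in leb L. (\<lambda>n. g n x) \<longlonglongrightarrow> \<phi> x"
proof -
  have "\<phi> measurable_on square L"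
    using \<phi> by (simp add: measurable_on_iff_borel_measurable sets_square)
  then obtain N g where N: "negligible N" and g: "\<And>n. continuous_on UNIV (g n)"
    and lim: "\<And>x. x \<notin> N \<Longrightarrow> (\<lambda>n. g n x) \<longlonglongrightarrow> (if x \<in> square L then \<phi> x else 0)"
    unfolding measurable_on_def by blast
  define G where "G n x = max (- K) (min K (g n x))" for n x
  show thesis
  proof (rule that[of G])
    show "continuous_on UNIV (G n)" for n
      unfolding G_def[abs_def] by (intro continuous_intros g)
    show "\<bar>G n x\<bar> \<le> K" for n x using K(2) by (auto simp: G_def)
    have "AE x in lebesgue. x \<notin> N"
      using N by (intro AE_not_in) (simp add: negligible_iff_null_sets)
    then have "AE x in leb L. x \<notin> N"
      by (subst AE_restrict_space_iff) (auto simp: sets_square elim: eventually_mono)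
    moreover have "AE x in leb L. x \<in> square L" by (rule AE_I2) simp
    ultimately show "AE x in leb L. (\<lambda>n. G n x) \<longlonglongrightarrow> \<phi> x"
    proof eventually_elim
      case (elim x)
      have "(\<lambda>n. G n x) \<longlonglongrightarrow> max (- K) (min K (\<phi> x))"
        unfolding G_def using lim[OF elim(1)] elim(2) by (intro tendsto_intros) simp
      moreover have "max (- K) (min K (\<phi> x)) = \<phi> x" using K(1)[OF elim(2)] by auto
      ultimately show ?case by simp
    qed
  qed
qed

lemma integral_bounded_mult_BV_le:
  fixes \<phi> :: "real^2 \<Rightarrow> real"
  assumes L: "L > 0" and u: "u \<in> BV L"
    and \<phi>: "\<phi> \<in> borel_measurable (leb L)" and K: "\<And>x. x \<in> square L \<Longrightarrow> \<bar>\<phi> x\<bar> \<le> K"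
  shows "(\<integral>x. (\<phi> x - mean L \<phi>) * u x \<partial>leb L)\<^sup>2 \<le> 100 * (tv L u)\<^sup>2 * (\<integral>x. (\<phi> x - mean L \<phi>)\<^sup>2 \<partial>leb L)"
proof -
  have "0 \<in> square L" using L by (simp add: mem_square)
  then have K0: "0 \<le> K" using K abs_ge_zero order_trans by blast
  obtain g where g: "\<And>n. continuous_on UNIV (g n)" "\<And>n x. \<bar>g n x\<bar> \<le> K"
    "AE x in leb L. (\<lambda>n. g n x) \<longlonglongrightarrow> \<phi> x"
    using bounded_measurable_approx_continuous[OF \<phi> K K0] by blast
  have gL: "continuous_on (square L) (g n)" for n using g(1) continuous_on_subset by blast
  have g_meas: "g n \<in> borel_measurable (leb L)" for n by (rule measurable_leb_continuous[OF gL])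
  define \<psi> where "\<psi> n x = g n x - mean L (g n)" for n x
  have \<psi>_cont: "continuous_on (square L) (\<psi> n)" for n
    unfolding \<psi>_def[abs_def] by (intro continuous_intros gL)
  have "(\<lambda>n. \<integral>x. g n x * 1 \<partial>leb L) \<longlonglongrightarrow> (\<integral>x. \<phi> x * 1 \<partial>leb L)"
    by (rule tendsto_integral_bounded_mult[OF integrable_const_leb g_meas \<phi> g(3)]) (rule g(2))
  then have mean_lim: "(\<lambda>n. mean L (g n)) \<longlonglongrightarrow> mean L \<phi>"
    unfolding mean_def using L by (intro tendsto_divide tendsto_const) auto
  obtain C where C: "\<And>n. \<bar>mean L (g n)\<bar> \<le> C"
    using convergent_imp_Bseq[OF convergentI[OF mean_lim]] by (auto simp: Bseq_def)
  have \<psi>_bound: "\<bar>\<psi> n x\<bar> \<le> K + C" for n x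
    using g(2)[of n x] C[of n] by (simp add: \<psi>_def)
  have \<psi>_lim: "AE x in leb L. (\<lambda>n. \<psi> n x) \<longlonglongrightarrow> \<phi> x - mean L \<phi>"
    using g(3) by eventually_elim (unfold \<psi>_def, intro tendsto_intros mean_lim)
  have \<psi>_meas: "\<psi> n \<in> borel_measurable (leb L)" for n by (rule measurable_leb_continuous[OF \<psi>_cont])
  have lim1: "(\<lambda>n. \<integral>x. \<psi> n x * u x \<partial>leb L) \<longlonglongrightarrow> (\<integral>x. (\<phi> x - mean L \<phi>) * u x \<partial>leb L)"
    by (rule tendsto_integral_bounded_mult[OF BV_integrable[OF u] \<psi>_meas _ \<psi>_lim])
       (use \<phi> \<psi>_bound in auto)
  have lim2: "(\<lambda>n. \<integral>x. (\<psi> n x)\<^sup>2 * 1 \<partial>leb L) \<longlonglongrightarrow> (\<integral>x. (\<phi> x - mean L \<phi>)\<^sup>2 * 1 \<partial>leb L)"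
  proof (rule tendsto_integral_bounded_mult[OF integrable_const_leb])
    show "(\<lambda>x. (\<psi> n x)\<^sup>2) \<in> borel_measurable (leb L)" for n
      by (intro borel_measurable_power \<psi>_meas)
    show "(\<lambda>x. (\<phi> x - mean L \<phi>)\<^sup>2) \<in> borel_measurable (leb L)"
      using \<phi> by (intro borel_measurable_power) simp
    show "AE x in leb L. (\<lambda>n. (\<psi> n x)\<^sup>2) \<longlonglongrightarrow> (\<phi> x - mean L \<phi>)\<^sup>2"
      using \<psi>_lim by eventually_elim (rule tendsto_power)
    show "\<bar>(\<psi> n x)\<^sup>2\<bar> \<le> (K + C)\<^sup>2" for n x
      using power_mono[OF \<psi>_bound, of n x 2] by simp
  qed
  have "(\<integral>x. \<psi> n x * u x \<partial>leb L)\<^sup>2 \<le> 100 * (tv L u)\<^sup>2 * (\<integral>x. (\<psi> n x)\<^sup>2 * 1 \<partial>leb L)" for n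
  proof -
    have "(\<integral>x. \<psi> n x \<partial>leb L) = 0"
      unfolding \<psi>_def by (rule integral_diff_mean_eq_0[OF L L2_imp_integrable[OF continuous_imp_L2[OF gL]]])
    from integral_continuous_mult_BV_le[OF L u \<psi>_cont this] show ?thesis by simp
  qed
  then have "(\<integral>x. (\<phi> x - mean L \<phi>) * u x \<partial>leb L)\<^sup>2 \<le> 100 * (tv L u)\<^sup>2 * (\<integral>x. (\<phi> x - mean L \<phi>)\<^sup>2 * 1 \<partial>leb L)"
    by (intro LIMSEQ_le[OF tendsto_power[OF lim1] tendsto_mult_left[OF lim2]]) auto
  then show ?thesis by simp
qed

text \<open>
  The duality estimate is applied to truncations of \<open>z = u - mean L u\<close> itself. For a truncation \<open>T\<close> of \<open>z\<close> one
  has \<open>T\<^sup>2 \<le> T * z\<close>, so the square of the integral of \<open>T\<^sup>2\<close> is at most \<open>100 * (tv L u)\<^sup>2\<close> times that integral.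
  One factor cancels, and monotone convergence removes the truncation. The estimate contains both facts
  that are needed later: BV functions are square integrable, and functions of total variation 0 are constant.
\<close>

theorem poincare_sobolev:
  assumes L: "L > 0" and u: "u \<in> BV L"
  shows "(\<lambda>x. u x - mean L u) \<in> L2 L"
    and "(\<integral>x. (u x - mean L u)\<^sup>2 \<partial>leb L) \<le> 100 * (tv L u)\<^sup>2"
proof -
  note int = BV_integrable[OF u]
  define z where "z x = u x - mean L u" for x
  have z_int: "integrable (leb L) z"
    unfolding z_def[abs_def] using int integrable_const_leb by (rule Bochner_Integration.integrable_diff)
  have z_meas: "z \<in> borel_measurable (leb L)" using z_int by (rule borel_measurable_integrable)
  have z_mean: "(\<integral>x. z x \<partial>leb L) = 0" unfolding z_def by (rule integral_diff_mean_eq_0[OF L int])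
  have z_BV: "z \<in> BV L" "tv L z = tv L u"
    using BV_add_const[OF u, of "- mean L u"] by (simp_all add: z_def[abs_def])
  define T where "T k x = max (- real k) (min (real k) (z x))" for k x
  have T_bound: "\<bar>T k x\<bar> \<le> real k" for k x by (auto simp: T_def)
  have T_meas: "T k \<in> borel_measurable (leb L)" for k
    unfolding T_def[abs_def] using z_meas by measurable
  have T_int: "integrable (leb L) (T k)" for k
    using integrable_bounded_mult[OF integrable_const_leb[of L 1] T_meas, of k "real k"] T_bound by simp
  have T2_int: "integrable (leb L) (\<lambda>x. (T k x)\<^sup>2)" for k
    using integrable_bounded_mult[OF T_int[of k] T_meas[of k], of "real k"] T_bound
    by (simp add: power2_eq_square)
  have Tz_int: "integrable (leb L) (\<lambda>x. T k x * z x)" for k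
    by (rule integrable_bounded_mult[OF z_int T_meas]) (rule T_bound)
  have T_sq_le: "(T k x)\<^sup>2 \<le> T k x * z x" for k x
  proof -
    have "0 \<le> T k x * (z x - T k x)"
      unfolding T_def by (auto simp: max_def min_def zero_le_mult_iff)
    then show ?thesis by (simp add: power2_eq_square algebra_simps)
  qed
  have bound: "(\<integral>x. (T k x)\<^sup>2 \<partial>leb L) \<le> 100 * (tv L u)\<^sup>2" for k
  proof -
    let ?I = "\<integral>x. (T k x)\<^sup>2 \<partial>leb L"
    have I0: "0 \<le> ?I" by (rule integral_nonneg_AE) simp
    have "?I \<le> (\<integral>x. T k x * z x \<partial>leb L)"
      by (rule integral_mono[OF T2_int Tz_int]) (rule T_sq_le)
    also have "\<dots> = (\<integral>x. (T k x - mean L (T k)) * z x \<partial>leb L)"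
      using Tz_int z_int z_mean by (simp add: left_diff_distrib)
    finally have "?I\<^sup>2 \<le> (\<integral>x. (T k x - mean L (T k)) * z x \<partial>leb L)\<^sup>2"
      using I0 by (intro power_mono)
    also have "\<dots> \<le> 100 * (tv L u)\<^sup>2 * (\<integral>x. (T k x - mean L (T k))\<^sup>2 \<partial>leb L)"
      using integral_bounded_mult_BV_le[OF L z_BV(1) T_meas T_bound] z_BV(2) by simp
    also have "(\<integral>x. (T k x - mean L (T k))\<^sup>2 \<partial>leb L) \<le> ?I"
    proof -
      have "(\<integral>x. (T k x - mean L (T k))\<^sup>2 \<partial>leb L) =
          (\<integral>x. (T k x)\<^sup>2 - mean L (T k) * (T k x + (T k x - mean L (T k))) \<partial>leb L)"
        by (intro Bochner_Integration.integral_cong refl) (simp add: power2_eq_square algebra_simps)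
      also have "\<dots> = ?I - mean L (T k) * ((\<integral>x. T k x \<partial>leb L) + (\<integral>x. T k x - mean L (T k) \<partial>leb L))"
        using T2_int[of k] T_int[of k] integrable_const_leb[of L "mean L (T k)"] by simp
      also have "(\<integral>x. T k x - mean L (T k) \<partial>leb L) = 0" by (rule integral_diff_mean_eq_0[OF L T_int])
      also have "mean L (T k) * ((\<integral>x. T k x \<partial>leb L) + 0) = (\<integral>x. T k x \<partial>leb L)\<^sup>2 / L\<^sup>2"
        by (simp add: mean_def power2_eq_square)
      finally show ?thesis by simp
    qed
    finally have le: "?I * ?I \<le> 100 * (tv L u)\<^sup>2 * ?I"
      by (simp add: power2_eq_square mult_left_mono)
    show ?thesis
    proof (cases "?I = 0")
      case False
      then have "0 < ?I" using I0 by (metis le_neq_trans)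
      with le show ?thesis by (simp only: mult_le_cancel_right_pos)
    qed simp
  qed
  have mono: "(T j x)\<^sup>2 \<le> (T k x)\<^sup>2" if "j \<le> k" for j k x
  proof -
    have "\<bar>T j x\<bar> \<le> \<bar>T k x\<bar>" using that by (auto simp: T_def max_def min_def)
    then show ?thesis by (rule abs_le_square_iff[THEN iffD1])
  qed
  have "incseq (\<lambda>k. \<integral>x. (T k x)\<^sup>2 \<partial>leb L)"
    unfolding incseq_def by (intro allI impI integral_mono T2_int mono)
  then obtain s where s: "(\<lambda>k. \<integral>x. (T k x)\<^sup>2 \<partial>leb L) \<longlonglongrightarrow> s"
    using incseq_convergent[of "\<lambda>k. \<integral>x. (T k x)\<^sup>2 \<partial>leb L"] bound by blast
  have lim: "(\<lambda>k. (T k x)\<^sup>2) \<longlonglongrightarrow> (z x)\<^sup>2" for x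
  proof (rule tendsto_eventually)
    obtain n where "\<bar>z x\<bar> \<le> real n" using real_arch_simple by blast
    then have "T k x = z x" if "n \<le> k" for k using that by (auto simp: T_def)
    then show "eventually (\<lambda>k. (T k x)\<^sup>2 = (z x)\<^sup>2) sequentially"
      unfolding eventually_sequentially by metis
  qed
  have z2: "(\<lambda>x. (z x)\<^sup>2) \<in> borel_measurable (leb L)" using z_meas by (rule borel_measurable_power)
  have "integrable (leb L) (\<lambda>x. (z x)\<^sup>2)" "(\<integral>x. (z x)\<^sup>2 \<partial>leb L) = s"
    using integrable_monotone_convergence[OF T2_int _ _ s z2]
      integral_monotone_convergence[OF T2_int _ _ s z2] lim mono by (auto simp: incseq_def)
  moreover have "s \<le> 100 * (tv L u)\<^sup>2" by (rule LIMSEQ_le_const2[OF s]) (use bound in blast)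
  ultimately show "(\<lambda>x. u x - mean L u) \<in> L2 L" "(\<integral>x. (u x - mean L u)\<^sup>2 \<partial>leb L) \<le> 100 * (tv L u)\<^sup>2"
    using z_meas by (simp_all add: L2_def z_def[abs_def])
qed

corollary BV_subset_L2:
  assumes "L > 0" "u \<in> BV L"
  shows "u \<in> L2 L"
  using L2_add[OF poincare_sobolev(1)[OF assms] L2_const[of "mean L u"]] by simp

corollary tv_eq_0_imp_const:
  assumes L: "L > 0" and u: "u \<in> BV L" and tv: "tv L u = 0"
  shows "AE x in leb L. u x = mean L u"
proof -
  have int: "integrable (leb L) (\<lambda>x. (u x - mean L u)\<^sup>2)"
    using poincare_sobolev(1)[OF L u] by (simp add: L2_def)
  have "(\<integral>x. (u x - mean L u)\<^sup>2 \<partial>leb L) \<le> 0"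
    using poincare_sobolev(2)[OF L u] tv by simp
  then have "(\<integral>x. (u x - mean L u)\<^sup>2 \<partial>leb L) = 0"
    by (intro antisym integral_nonneg_AE) auto
  then have "AE x in leb L. (u x - mean L u)\<^sup>2 = 0"
    using integral_nonneg_eq_0_iff_AE[OF int] by simp
  then show ?thesis by eventually_elim simp
qed

section \<open>Duality and optimal decompositions\<close>

definition reg :: "real \<Rightarrow> real \<Rightarrow> (real^2 \<Rightarrow> real) \<Rightarrow> (real^2 \<Rightarrow> real) \<Rightarrow> real" where
  "reg L lam g h = tv L g + lam * lipd L h"

lemma regularizer_eq_reg:
  assumes "L > 0" "g \<in> BV L" "h \<in> H L"
  shows "regularizer L lam g h = ereal (reg L lam g h)"
  by (simp add: regularizer_def reg_def total_variation_eq_tv[OF assms(2)] Lip_dual_norm_eq_lipd[OF assms(1,3)])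

lemma reg_nonneg: "lam > 0 \<Longrightarrow> 0 \<le> reg L lam g h"
  by (simp add: reg_def tv_nonneg lipd_nonneg)

lemma reg_eq_0:
  assumes "lam > 0" "reg L lam g h = 0"
  shows "tv L g = 0" "lipd L h = 0"
proof -
  have "0 \<le> lam * lipd L h" using assms(1) by (simp add: lipd_nonneg)
  then have "tv L g = 0" "lam * lipd L h = 0"
    using assms(2) tv_nonneg[of L g] unfolding reg_def by linarith+
  then show "tv L g = 0" "lipd L h = 0" using assms(1) by auto
qed

lemma reg_combination_le:
  assumes "L > 0" "lam > 0" "u \<in> BV L" "g \<in> BV L" "v \<in> H L" "h \<in> H L" "0 \<le> a" "0 \<le> b"
  shows "reg L lam (\<lambda>x. a * u x + b * g x + c) (\<lambda>x. a * v x + b * h x) \<le> a * reg L lam u v + b * reg L lam g h"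
proof -
  have "lam * lipd L (\<lambda>x. a * v x + b * h x) \<le> lam * (a * lipd L v + b * lipd L h)"
    using H_combination(2)[OF assms(1,5,6,7,8)] assms(2) by (intro mult_left_mono) auto
  with BV_combination(2)[OF assms(3,4,7,8), of c] show ?thesis
    by (simp add: reg_def algebra_simps)
qed

lemma L2_inner_add:
  assumes "w \<in> L2 L" "p \<in> L2 L" "q \<in> L2 L"
  shows "L2_inner L w (\<lambda>x. a * p x + b * q x) = a * L2_inner L w p + b * L2_inner L w q"
  using L2_integrable_mult[OF assms(1,2)] L2_integrable_mult[OF assms(1,3)]
  by (simp add: L2_inner_def distrib_left mult.left_commute)

lemma L2_inner_diff_left:
  assumes "w \<in> L2 L" "p \<in> L2 L" "q \<in> L2 L"
  shows "L2_inner L (\<lambda>x. p x - q x) w = L2_inner L p w - L2_inner L q w"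
  using L2_integrable_mult[OF assms(2,1)] L2_integrable_mult[OF assms(3,1)]
  by (simp add: L2_inner_def left_diff_distrib)

lemma L2_inner_cong_AE:
  assumes "w \<in> L2 L" "w' \<in> L2 L" "p \<in> L2 L" "AE x in leb L. w x = w' x"
  shows "L2_inner L w p = L2_inner L w' p"
  unfolding L2_inner_def
proof (rule integral_cong_AE)
  show "(\<lambda>x. w x * p x) \<in> borel_measurable (leb L)" "(\<lambda>x. w' x * p x) \<in> borel_measurable (leb L)"
    using assms(1-3) by (auto simp: L2_def)
  show "AE x in leb L. w x * p x = w' x * p x" using assms(4) by eventually_elim simp
qed

text \<open>
  For square integrable \<open>w\<close> this says that the star norm is at most \<open>1 / \<alpha>\<close>, but without quotients, so
  that pairs with vanishing regularizer are included.
\<close>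

definition dual_bounded :: "real \<Rightarrow> real \<Rightarrow> real \<Rightarrow> (real^2 \<Rightarrow> real) \<Rightarrow> bool" where
  "dual_bounded L \<alpha> lam w \<longleftrightarrow> (\<forall>g\<in>BV L. \<forall>h\<in>H L \<inter> L2 L.
     \<alpha> * L2_inner L w (\<lambda>x. g x + h x) \<le> reg L lam g h)"

lemma not_AE_zero_coordinate:
  assumes "L > 0"
  shows "\<not> (AE x in leb L. x $ k - c = 0)"
proof
  assume "AE x in leb L. x $ k - c = 0"
  then have "AE x in lebesgue. x \<in> square L \<longrightarrow> x $ k - c = 0"
    by (subst (asm) AE_restrict_space_iff) (auto simp: sets_square)
  moreover have "AE x in lebesgue. x \<notin> {x. x $ k = c}"
    using negligible_standard_hyperplane[of "axis k 1 :: real^2" c]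
    by (intro AE_not_in) (simp add: negligible_iff_null_sets inner_axis axis_in_Basis_iff)
  ultimately have "AE x in lebesgue. x \<notin> square L" by eventually_elim auto
  then have "square L \<in> null_sets lebesgue" using AE_iff_null_sets[OF sets_square] by blast
  then have "measure lebesgue (square L) = 0" by (simp add: measure_eq_0_null_sets)
  then show False using measure_square[OF assms] assms by (simp add: measure_restrict_space sets_square)
qed

lemma exists_H_not_AE_zero:
  assumes "L > 0"
  obtains h where "h \<in> H L" "h \<in> L2 L" "\<not> (AE x in leb L. h x = 0)"
proof
  let ?q = "\<lambda>x :: real^2. x $ 1"
  have q: "continuous_on (square L) ?q" by (intro continuous_intros)
  have int: "integrable (leb L) ?q" by (rule L2_imp_integrable[OF continuous_imp_L2[OF q]])
  show "(\<lambda>x. ?q x - mean L ?q) \<in> L2 L"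
    by (intro continuous_imp_L2 continuous_intros)
  from L2_imp_integrable[OF this] show "(\<lambda>x. ?q x - mean L ?q) \<in> H L"
    using integral_diff_mean_eq_0[OF assms int] by (simp add: H_def L1_def)
  show "\<not> (AE x in leb L. ?q x - mean L ?q = 0)" by (rule not_AE_zero_coordinate[OF assms])
qed

lemma star_norm_ge_quotient:
  assumes "L > 0" "g \<in> BV L" "h \<in> H L" "h \<in> L2 L" "reg L lam g h \<noteq> 0"
  shows "ereal (L2_inner L w (\<lambda>x. g x + h x) / reg L lam g h) \<le> star_norm L lam w"
proof -
  have eq: "regularizer L lam g h = ereal (reg L lam g h)" by (rule regularizer_eq_reg[OF assms(1-3)])
  have "(case (g, h) of (g, h) \<Rightarrow> ereal (L2_inner L w (\<lambda>x. g x + h x)) / regularizer L lam g h) \<le> star_norm L lam w"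
    unfolding star_norm_def using assms eq by (intro SUP_upper) auto
  then show ?thesis using assms(5) by (simp add: eq)
qed

text \<open>
  Pairs with positive regularizer are covered by the definition of the norm. If \<open>reg L lam g h = 0\<close>, the
  quotient is not available; adding a fixed \<open>k\<close> with positive dual norm to a large multiple of the pair
  gives an admissible quotient whose denominator stays bounded while its numerator would tend to infinity
  if the inner product were positive.
\<close>

lemma star_norm_le_imp_dual_bounded:
  assumes L: "L > 0" and lam: "lam > 0" and \<alpha>: "\<alpha> > 0" and w: "w \<in> L2 L"
    and le: "star_norm L lam w \<le> ereal (1 / \<alpha>)"
  shows "dual_bounded L \<alpha> lam w"
proof -
  have pos: "\<alpha> * L2_inner L w (\<lambda>x. g x + h x) \<le> reg L lam g h"
    if "g \<in> BV L" "h \<in> H L" "h \<in> L2 L" "reg L lam g h \<noteq> 0" for g h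
  proof -
    have "0 < reg L lam g h" using reg_nonneg[OF lam, of L g h] that(4) by simp
    moreover have "L2_inner L w (\<lambda>x. g x + h x) / reg L lam g h \<le> 1 / \<alpha>"
      using order_trans[OF star_norm_ge_quotient[OF L that] le] by simp
    ultimately show ?thesis using \<alpha> by (simp add: field_simps)
  qed
  obtain k where k: "k \<in> H L" "k \<in> L2 L" "\<not> (AE x in leb L. k x = 0)"
    by (rule exists_H_not_AE_zero[OF L])
  have "\<alpha> * L2_inner L w (\<lambda>x. g x + h x) \<le> reg L lam g h"
    if gh: "g \<in> BV L" "h \<in> H L" "h \<in> L2 L" and zero: "reg L lam g h = 0" for g h
  proof (rule ccontr)
    let ?c = "L2_inner L w (\<lambda>x. g x + h x)" and ?d = "L2_inner L w k"
    assume "\<not> ?thesis"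
    then have c: "0 < \<alpha> * ?c" using zero by simp
    define t where "t = (\<bar>lam * lipd L k - \<alpha> * ?d\<bar> + 1) / (\<alpha> * ?c)"
    have t: "0 \<le> t" using c unfolding t_def by (intro divide_nonneg_pos) auto
    let ?g = "\<lambda>x. t * g x + 0 * g x + 0" and ?h = "\<lambda>x. t * h x + 1 * k x"
    have H: "?h \<in> H L" by (rule H_combination(1)[OF L gh(2) k(1) t]) simp
    have BV: "?g \<in> BV L" by (rule BV_combination(1)[OF gh(1) gh(1) t]) simp
    have hL2: "?h \<in> L2 L" by (intro L2_add L2_scale gh(3) k(2))
    have "AE x in leb L. h x = 0"
      by (rule lipd_eq_0_imp_AE_0[OF L gh(2) reg_eq_0(2)[OF lam zero]])
    then have "AE x in leb L. k x = 0" if "AE x in leb L. ?h x = 0"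
      using that by eventually_elim simp
    then have "\<not> (AE x in leb L. ?h x = 0)" using k(3) by blast
    then have "lipd L ?h \<noteq> 0" using lipd_eq_0_imp_AE_0[OF L H] by blast
    then have "reg L lam ?g ?h \<noteq> 0" using reg_eq_0(2)[OF lam] by blast
    from pos[OF BV H hL2 this] have "\<alpha> * L2_inner L w (\<lambda>x. ?g x + ?h x) \<le> reg L lam ?g ?h" .
    moreover have "(\<lambda>x. ?g x + ?h x) = (\<lambda>x. t * (g x + h x) + 1 * k x)"
      by (simp add: fun_eq_iff algebra_simps)
    moreover have "L2_inner L w (\<lambda>x. t * (g x + h x) + 1 * k x) = t * ?c + 1 * ?d"
      by (rule L2_inner_add[OF w L2_add[OF BV_subset_L2[OF L gh(1)] gh(3)] k(2)])
    moreover have "reg L lam ?g ?h \<le> lam * lipd L k"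
    proof -
      have "tv L ?g \<le> 0"
        using BV_combination(2)[OF gh(1) gh(1) t order_refl, of 0] reg_eq_0(1)[OF lam zero] by simp
      moreover have "lam * lipd L ?h \<le> lam * lipd L k"
        using lam H_combination(2)[OF L gh(2) k(1) t, of 1] reg_eq_0(2)[OF lam zero] by simp
      ultimately show ?thesis unfolding reg_def by linarith
    qed
    ultimately have "\<alpha> * (t * ?c + ?d) \<le> lam * lipd L k" by simp
    moreover have "\<alpha> * (t * ?c + ?d) = \<bar>lam * lipd L k - \<alpha> * ?d\<bar> + 1 + \<alpha> * ?d"
    proof -
      have "t * (\<alpha> * ?c) = \<bar>lam * lipd L k - \<alpha> * ?d\<bar> + 1"
        using nonzero_eq_divide_eq[THEN iffD1, OF less_imp_neq[OF c, symmetric] t_def] .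
      then show ?thesis by (simp add: algebra_simps)
    qed
    ultimately show False by linarith
  qed
  with pos show ?thesis unfolding dual_bounded_def by blast
qed

lemma dual_bounded_imp_star_norm_le:
  assumes L: "L > 0" and lam: "lam > 0" and \<alpha>: "\<alpha> > 0" and db: "dual_bounded L \<alpha> lam w"
  shows "star_norm L lam w \<le> ereal (1 / \<alpha>)"
  unfolding star_norm_def
proof (rule SUP_least, clarsimp)
  fix g h assume gh: "g \<in> BV L" "h \<in> H L" "h \<in> L2 L" and nz: "regularizer L lam g h \<noteq> 0"
  have eq: "regularizer L lam g h = ereal (reg L lam g h)" by (rule regularizer_eq_reg[OF L gh(1,2)])
  have pos: "0 < reg L lam g h" using nz reg_nonneg[OF lam, of L g h] by (simp add: eq)
  have "\<alpha> * L2_inner L w (\<lambda>x. g x + h x) \<le> reg L lam g h" using db gh by (simp add: dual_bounded_def)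
  then have "L2_inner L w (\<lambda>x. g x + h x) / reg L lam g h \<le> 1 / \<alpha>"
    using pos \<alpha> by (simp add: field_simps)
  then show "ereal (L2_inner L w (\<lambda>x. g x + h x)) / regularizer L lam g h \<le> ereal (1 / \<alpha>)"
    using pos by (simp add: eq)
qed

text \<open>
  Constants have total variation 0, so the inner products of \<open>w\<close> with all of them are at most 0.
\<close>

lemma dual_bounded_integral_eq_0:
  assumes L: "L > 0" and lam: "lam > 0" and \<alpha>: "\<alpha> > 0" and w: "w \<in> L2 L" and db: "dual_bounded L \<alpha> lam w"
  shows "(\<integral>x. w x \<partial>leb L) = 0"
proof -
  have "c * (\<integral>x. w x \<partial>leb L) \<le> 0" for c
  proof -
    have "\<alpha> * L2_inner L w (\<lambda>x. c) \<le> reg L lam (\<lambda>x. c) (\<lambda>x. 0)"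
      using db[unfolded dual_bounded_def, rule_format, OF BV_const(1)[of c], of "\<lambda>x. 0"]
      by (simp add: zero_in_H L2_const)
    moreover have "L2_inner L w (\<lambda>x. c) = c * (\<integral>x. w x \<partial>leb L)" by (simp add: L2_inner_def)
    ultimately have "\<alpha> * (c * (\<integral>x. w x \<partial>leb L)) \<le> 0"
      by (simp add: reg_def BV_const(2) lipd_zero[OF L])
    then show ?thesis using \<alpha> by (simp add: mult_le_0_iff)
  qed
  from this[of 1] this[of "- 1"] show ?thesis by simp
qed

lemma energy_finite:
  assumes "L > 0" "u \<in> BV L" "v \<in> H L" "(\<lambda>x. f x - u x - v x) \<in> L2 L"
  shows "energy L \<alpha> lam f u v =
    ereal (reg L lam u v + \<alpha> / 2 * (\<integral>x. (f x - u x - v x)\<^sup>2 \<partial>leb L))"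
  using assms
  by (simp add: energy_def reg_def total_variation_eq_tv Lip_dual_norm_eq_lipd)

lemma integral_square_diff:
  assumes "w \<in> L2 L" "s \<in> L2 L"
  shows "(\<integral>x. (w x - s x)\<^sup>2 \<partial>leb L) = (\<integral>x. (w x)\<^sup>2 \<partial>leb L) - 2 * L2_inner L w s + (\<integral>x. (s x)\<^sup>2 \<partial>leb L)"
  using L2_integrable_mult[OF assms] assms
  by (simp add: L2_inner_def L2_def power2_diff mult.assoc)

text \<open>
  The derivative at 0 of a function that has a minimum over \<open>[0, 1]\<close> at 0 is nonnegative.
\<close>

lemma first_order_nonneg:
  fixes C D :: real
  assumes "\<And>t. 0 < t \<Longrightarrow> t \<le> 1 \<Longrightarrow> 0 \<le> t * D + t\<^sup>2 * C"
  shows "0 \<le> D"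
proof (rule ccontr)
  assume "\<not> 0 \<le> D"
  (* With this step the quadratic term is at most half of the linear one. *)
  define t where "t = min 1 (- D / (2 * (\<bar>C\<bar> + 1)))"
  have t: "0 < t" "t \<le> 1" using \<open>\<not> 0 \<le> D\<close> by (auto simp: t_def divide_neg_pos)
  have "0 \<le> t * (D + t * C)" using assms[OF t] by (simp add: power2_eq_square algebra_simps)
  then have "0 \<le> D + t * C" using t(1) by (simp add: zero_le_mult_iff)
  moreover have "t * C \<le> - D / 2"
  proof -
    have "t * C \<le> t * (\<bar>C\<bar> + 1)" using t(1) by (intro mult_left_mono) auto
    also have "t * (\<bar>C\<bar> + 1) \<le> - D / (2 * (\<bar>C\<bar> + 1)) * (\<bar>C\<bar> + 1)"
      by (intro mult_right_mono) (auto simp: t_def)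
    also have "\<dots> = - D / 2" by (simp add: field_simps)
    finally show ?thesis .
  qed
  ultimately show False using \<open>\<not> 0 \<le> D\<close> by linarith
qed

text \<open>
  The energy only forces the residual to be square integrable; the embedding of BV then transfers this
  to \<open>v\<close> itself.
\<close>

lemma residual_L2_imp_L2:
  assumes "L > 0" "f \<in> L2 L" "u \<in> BV L" "(\<lambda>x. f x - u x - v x) \<in> L2 L"
  shows "v \<in> L2 L"
proof -
  have "(\<lambda>x. (f x - u x) - (f x - u x - v x)) \<in> L2 L"
    by (intro L2_diff assms(2,4) BV_subset_L2[OF assms(1,3)])
  then show ?thesis by simp
qed

text \<open>
  The minimizer is compared with \<open>((1 + t * A) u + t * B g + const, (1 + t * A) v + t * B h)\<close> for small
  \<open>t > 0\<close>, where the constant restores the mean of \<open>u\<close>. By sublinearity the regularizer grows at most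
  linearly in \<open>t\<close>, and the quadratic term has derivative \<open>- \<alpha>\<close> times the inner product of the residual with
  the direction. The constant does not contribute, since it has no variation and the residual has mean 0.
  The bound \<open>-1 \<le> A\<close> keeps the coefficient \<open>1 + t * A\<close> nonnegative.
\<close>

lemma optimal_first_order:
  assumes L: "L > 0" and \<alpha>: "\<alpha> > 0" and lam: "lam > 0" and f: "f \<in> L2 L"
    and opt: "optimal_decomposition L \<alpha> lam f u v"
    and g: "g \<in> BV L" and h: "h \<in> H L" "h \<in> L2 L" and A: "-1 \<le> A" and B: "0 \<le> B"
  defines "w \<equiv> \<lambda>x. f x - u x - v x"
  shows "w \<in> L2 L"
    and "\<alpha> * (A * L2_inner L w (\<lambda>x. u x + v x) + B * L2_inner L w (\<lambda>x. g x + h x)) \<le>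
      A * reg L lam u v + B * reg L lam g h"
proof -
  have adm: "u \<in> BV L" "v \<in> H L" "(\<integral>x. f x \<partial>leb L) = (\<integral>x. u x \<partial>leb L)"
    and min: "\<And>u' v'. admissible L f u' v' \<Longrightarrow> energy L \<alpha> lam f u v \<le> energy L \<alpha> lam f u' v'"
    using opt by (auto simp: optimal_decomposition_def admissible_def)
  have "admissible L f (\<lambda>x. mean L f) (\<lambda>x. 0)"
    using L by (simp add: admissible_def BV_const(1) zero_in_H measure_square mean_def)
  from min[OF this] have "energy L \<alpha> lam f u v < \<infinity>"
    using energy_finite[OF L BV_const(1) zero_in_H, of f "mean L f" \<alpha> lam] L2_diff[OF f L2_const[of "mean L f"]]
    by (auto simp: le_less_trans)
  then show w: "w \<in> L2 L" by (auto simp: energy_def w_def split: if_splits)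
  have uL2: "u \<in> L2 L" and gL2: "g \<in> L2 L" using BV_subset_L2[OF L] adm(1) g by auto
  have vL2: "v \<in> L2 L" using residual_L2_imp_L2[OF L f adm(1)] w by (simp add: w_def)
  have w0: "(\<integral>x. w x \<partial>leb L) = 0"
    using L2_imp_integrable[OF f] BV_integrable[OF adm(1)] H_integrable[OF adm(2)] adm(3) H_integral[OF adm(2)]
    by (simp add: w_def)
  define c where "c = - (A * mean L u + B * mean L g)"
  define s where "s x = A * (u x + v x) + B * (g x + h x) + c * 1" for x
  have s: "s \<in> L2 L"
    unfolding s_def[abs_def] by (intro L2_add L2_scale uL2 vL2 gL2 h(2) L2_const)
  have ws: "L2_inner L w s = A * L2_inner L w (\<lambda>x. u x + v x) + B * L2_inner L w (\<lambda>x. g x + h x)"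
  proof -
    have "L2_inner L w s =
        1 * L2_inner L w (\<lambda>x. A * (u x + v x) + B * (g x + h x)) + c * L2_inner L w (\<lambda>x. 1)"
      using L2_inner_add[OF w L2_add[OF L2_scale[OF L2_add[OF uL2 vL2], of A] L2_scale[OF L2_add[OF gL2 h(2)], of B]]
          L2_const[of 1], of 1 c]
      by (simp add: s_def[abs_def])
    also have "L2_inner L w (\<lambda>x. 1) = 0" using w0 by (simp add: L2_inner_def)
    finally show ?thesis
      using L2_inner_add[OF w L2_add[OF uL2 vL2] L2_add[OF gL2 h(2)]] by simp
  qed
  have "0 \<le> t * (A * reg L lam u v + B * reg L lam g h - \<alpha> * L2_inner L w s) + t\<^sup>2 * (\<alpha> / 2 * (\<integral>x. (s x)\<^sup>2 \<partial>leb L))"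
    if t: "0 < t" "t \<le> 1" for t
  proof -
    let ?u = "\<lambda>x. (1 + t * A) * u x + t * B * g x + t * c" and ?v = "\<lambda>x. (1 + t * A) * v x + t * B * h x"
    have "- 1 \<le> t * A"
    proof (cases "0 \<le> A")
      case True
      then have "0 \<le> t * A" using t by simp
      then show ?thesis by simp
    next
      case False
      have "t * - A \<le> 1 * 1" using t A False by (intro mult_mono) auto
      then show ?thesis by simp
    qed
    then have coef: "0 \<le> 1 + t * A" "0 \<le> t * B" using t B by auto
    have BV: "?u \<in> BV L" by (rule BV_combination(1)[OF adm(1) g coef])
    have H: "?v \<in> H L" by (rule H_combination(1)[OF L adm(2) h(1) coef])
    have "(\<integral>x. ?u x \<partial>leb L) = (1 + t * A) * (\<integral>x. u x \<partial>leb L) + t * B * (\<integral>x. g x \<partial>leb L) + t * c * L\<^sup>2"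
      using BV_integrable[OF adm(1)] BV_integrable[OF g] integrable_const_leb[of L "t * c"] measure_square[OF L]
      by simp
    also have "\<dots> = (\<integral>x. u x \<partial>leb L)" using L by (simp add: c_def mean_def field_simps)
    finally have adm': "admissible L f ?u ?v" using BV H adm(3) by (simp add: admissible_def)
    have res: "(\<lambda>x. f x - ?u x - ?v x) = (\<lambda>x. w x - t * s x)"
      by (simp add: fun_eq_iff w_def s_def algebra_simps)
    have resL2: "(\<lambda>x. w x - t * s x) \<in> L2 L" by (intro L2_diff L2_scale w s)
    have "reg L lam u v + \<alpha> / 2 * (\<integral>x. (w x)\<^sup>2 \<partial>leb L) \<le>
        reg L lam ?u ?v + \<alpha> / 2 * (\<integral>x. (w x - t * s x)\<^sup>2 \<partial>leb L)"
    proof -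
      have e1: "energy L \<alpha> lam f u v = ereal (reg L lam u v + \<alpha> / 2 * (\<integral>x. (w x)\<^sup>2 \<partial>leb L))"
        using energy_finite[OF L adm(1,2) w[unfolded w_def]] by (simp add: w_def)
      have e2: "energy L \<alpha> lam f ?u ?v = ereal (reg L lam ?u ?v + \<alpha> / 2 * (\<integral>x. (f x - ?u x - ?v x)\<^sup>2 \<partial>leb L))"
        by (rule energy_finite[OF L BV H]) (unfold res, rule resL2)
      have "(\<integral>x. (f x - ?u x - ?v x)\<^sup>2 \<partial>leb L) = (\<integral>x. (w x - t * s x)\<^sup>2 \<partial>leb L)"
        by (rule arg_cong[where f = "\<lambda>q. \<integral>x. (q x)\<^sup>2 \<partial>leb L", OF res])
      with min[OF adm'] show ?thesis unfolding e1 e2 ereal_less_eq by (simp only:)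
    qed
    also have "(\<integral>x. (w x - t * s x)\<^sup>2 \<partial>leb L) =
        (\<integral>x. (w x)\<^sup>2 \<partial>leb L) - 2 * t * L2_inner L w s + t\<^sup>2 * (\<integral>x. (s x)\<^sup>2 \<partial>leb L)"
      using integral_square_diff[OF w L2_scale[OF s, of t]]
      by (simp add: L2_inner_def power_mult_distrib mult.left_commute)
    also have "reg L lam ?u ?v \<le> (1 + t * A) * reg L lam u v + t * B * reg L lam g h"
      by (rule reg_combination_le[OF L lam adm(1) g adm(2) h(1) coef])
    finally show ?thesis by (simp add: algebra_simps)
  qed
  then have "0 \<le> A * reg L lam u v + B * reg L lam g h - \<alpha> * L2_inner L w s"
    by (rule first_order_nonneg)
  then show "\<alpha> * (A * L2_inner L w (\<lambda>x. u x + v x) + B * L2_inner L w (\<lambda>x. g x + h x)) \<le>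
      A * reg L lam u v + B * reg L lam g h"
    by (simp add: ws)
qed

text \<open>
  \<open>A = 0, B = 1\<close> gives the inequality for all competitors. Scaling the minimizer up and down,
  \<open>A = 1\<close> and \<open>A = -1\<close> with \<open>B = 0\<close>, gives both halves of the equality.
\<close>

lemma optimal_imp_dual_conditions:
  assumes L: "L > 0" and \<alpha>: "\<alpha> > 0" and lam: "lam > 0" and f: "f \<in> L2 L"
    and opt: "optimal_decomposition L \<alpha> lam f u v"
  defines "w \<equiv> \<lambda>x. f x - u x - v x"
  shows "w \<in> L2 L" "dual_bounded L \<alpha> lam w" "\<alpha> * L2_inner L w (\<lambda>x. u x + v x) = reg L lam u v"
proof -
  note fo = optimal_first_order[OF L \<alpha> lam f opt, folded w_def]
  show "w \<in> L2 L" by (rule fo(1)[OF BV_const(1) zero_in_H L2_const, of 0 0]) auto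
  show "dual_bounded L \<alpha> lam w"
    unfolding dual_bounded_def using fo(2)[of _ _ 0 1] by auto
  have "\<alpha> * (A * L2_inner L w (\<lambda>x. u x + v x)) \<le> A * reg L lam u v" if "-1 \<le> A" for A
    using fo(2)[OF BV_const(1) zero_in_H L2_const that, of 0 0] by simp
  from this[of 1] this[of "- 1"] show "\<alpha> * L2_inner L w (\<lambda>x. u x + v x) = reg L lam u v" by simp
qed

text \<open>
  Convexity makes the first-order conditions sufficient. For a competitor with residual \<open>w'\<close> the bound on
  \<open>w\<close> gives that the regularizer exceeds that of \<open>(u, v)\<close> by at least \<open>\<alpha> * L2_inner L w (w - w')\<close>, and the
  quadratic term loses at most this much because the square of \<open>w - w'\<close> has nonnegative integral.
\<close>

lemma dual_conditions_imp_optimal: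
  assumes L: "L > 0" and \<alpha>: "\<alpha> > 0" and lam: "lam > 0" and f: "f \<in> L2 L"
    and u: "u \<in> BV L" and v: "v \<in> H L"
  defines "w \<equiv> \<lambda>x. f x - u x - v x"
  assumes w: "w \<in> L2 L" and db: "dual_bounded L \<alpha> lam w"
    and eq: "\<alpha> * L2_inner L w (\<lambda>x. u x + v x) = reg L lam u v"
  shows "optimal_decomposition L \<alpha> lam f u v"
  unfolding optimal_decomposition_def
proof (intro conjI allI impI)
  have "(\<integral>x. w x \<partial>leb L) = (\<integral>x. f x \<partial>leb L) - (\<integral>x. u x \<partial>leb L) - (\<integral>x. v x \<partial>leb L)"
    unfolding w_def using L2_imp_integrable[OF f] BV_integrable[OF u] H_integrable[OF v] by simp
  then show "admissible L f u v"
    using dual_bounded_integral_eq_0[OF L lam \<alpha> w db] H_integral[OF v] u v by (simp add: admissible_def)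
  fix u' v' assume "admissible L f u' v'"
  then have u': "u' \<in> BV L" and v': "v' \<in> H L" by (auto simp: admissible_def)
  define w' where "w' x = f x - u' x - v' x" for x
  show "energy L \<alpha> lam f u v \<le> energy L \<alpha> lam f u' v'"
  proof (cases "w' \<in> L2 L")
    case False
    then show ?thesis by (simp add: energy_def w'_def[abs_def])
  next
    case w': True
    have v'L2: "v' \<in> L2 L" using residual_L2_imp_L2[OF L f u'] w' by (simp add: w'_def[abs_def])
    have inner: "L2_inner L w (\<lambda>x. f x - q x) = L2_inner L w f - L2_inner L w q" if "q \<in> L2 L" for q
      using L2_inner_add[OF w f that, of 1 "- 1"] by simp
    have "\<alpha> * L2_inner L w (\<lambda>x. u' x + v' x) \<le> reg L lam u' v'"
      using db u' v' v'L2 by (simp add: dual_bounded_def)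
    moreover have "(\<lambda>x. u' x + v' x) = (\<lambda>x. f x - w' x)" "(\<lambda>x. u x + v x) = (\<lambda>x. f x - w x)"
      by (auto simp: w_def w'_def)
    ultimately have "\<alpha> * (L2_inner L w f - L2_inner L w w') \<le> reg L lam u' v'"
      "\<alpha> * (L2_inner L w f - L2_inner L w w) = reg L lam u v"
      using eq inner[OF w'] inner[OF w] by auto
    then have 1: "reg L lam u v \<le> reg L lam u' v' + \<alpha> * (L2_inner L w w' - L2_inner L w w)"
      by (simp add: algebra_simps)
    have ww: "L2_inner L w w = (\<integral>x. (w x)\<^sup>2 \<partial>leb L)" by (simp add: L2_inner_def power2_eq_square)
    have "0 \<le> (\<integral>x. (w x - w' x)\<^sup>2 \<partial>leb L)" by (rule integral_nonneg_AE) simp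
    then have "2 * (L2_inner L w w' - L2_inner L w w) \<le> (\<integral>x. (w' x)\<^sup>2 \<partial>leb L) - (\<integral>x. (w x)\<^sup>2 \<partial>leb L)"
      unfolding integral_square_diff[OF w w'] ww by simp
    then have "\<alpha> / 2 * (2 * (L2_inner L w w' - L2_inner L w w)) \<le>
        \<alpha> / 2 * ((\<integral>x. (w' x)\<^sup>2 \<partial>leb L) - (\<integral>x. (w x)\<^sup>2 \<partial>leb L))"
      using \<alpha> by (intro mult_left_mono) auto
    with 1 have "reg L lam u v + \<alpha> / 2 * (\<integral>x. (w x)\<^sup>2 \<partial>leb L) \<le> reg L lam u' v' + \<alpha> / 2 * (\<integral>x. (w' x)\<^sup>2 \<partial>leb L)"
      by (simp add: algebra_simps)
    then show ?thesis
      using energy_finite[OF L u v w[unfolded w_def], of \<alpha> lam] energy_finite[OF L u' v' w'[unfolded w'_def[abs_def]], of \<alpha> lam]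
      by (simp add: w_def w'_def)
  qed
qed

theorem theorem2:
  fixes L \<alpha> lam :: real and f :: "real^2 \<Rightarrow> real"
  assumes "L > 0" and "\<alpha> > 0" and "lam > 0" and "f \<in> L2 L"
  shows
    "(\<forall>u v. optimal_decomposition L \<alpha> lam f u v \<longrightarrow>
        (star_norm L lam f \<le> ereal (1 / \<alpha>) \<longleftrightarrow>
           (AE x in leb L. u x = 0) \<and> (AE x in leb L. v x = 0) \<and>
           (AE x in leb L. f x - u x - v x = f x))) \<and>
     (star_norm L lam f > ereal (1 / \<alpha>) \<and>
      star_norm L lam (\<lambda>x. f x - mean L f) \<ge> ereal (1 / \<alpha>) \<longrightarrow>
        (\<forall>u\<in>BV L. \<forall>v\<in>H L.
           optimal_decomposition L \<alpha> lam f u v \<longleftrightarrow>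
             (let w = (\<lambda>x. f x - u x - v x) in
                w \<in> L2 L \<and>
                star_norm L lam w = ereal (1 / \<alpha>) \<and>
                ereal (L2_inner L w (\<lambda>x. u x + v x)) =
                  ereal (1 / \<alpha>) * (total_variation L u + ereal lam * Lip_dual_norm L v))))"
proof -
  note L = assms(1) and \<alpha> = assms(2) and lam = assms(3) and f = assms(4)
  have star_norm_cong: "star_norm L lam w = star_norm L lam w'"
    if "w \<in> L2 L" "w' \<in> L2 L" "AE x in leb L. w x = w' x" for w w'
    unfolding star_norm_def
    by (intro SUP_cong refl)
       (auto simp: L2_inner_cong_AE[OF that(1,2) L2_add[OF BV_subset_L2[OF L]] that(3)])
  have part1: "star_norm L lam f \<le> ereal (1 / \<alpha>) \<longleftrightarrow>
      (AE x in leb L. u x = 0) \<and> (AE x in leb L. v x = 0) \<and> (AE x in leb L. f x - u x - v x = f x)"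
    if opt: "optimal_decomposition L \<alpha> lam f u v" for u v
  proof
    define w where "w x = f x - u x - v x" for x
    note dual = optimal_imp_dual_conditions[OF L \<alpha> lam f opt, folded w_def[abs_def]]
    have u: "u \<in> BV L" and v: "v \<in> H L"
      using opt by (auto simp: optimal_decomposition_def admissible_def)
    have vL2: "v \<in> L2 L" using residual_L2_imp_L2[OF L f u] dual(1) by (simp add: w_def[abs_def])
    have uvL2: "(\<lambda>x. u x + v x) \<in> L2 L" by (rule L2_add[OF BV_subset_L2[OF L u] vL2])
    {
      assume "star_norm L lam f \<le> ereal (1 / \<alpha>)"
      (* Both \<open>f\<close> and \<open>w\<close> are tested with \<open>u + v\<close>, which is their difference: its squared norm is at most 0. *)
      then have "dual_bounded L \<alpha> lam f" by (rule star_norm_le_imp_dual_bounded[OF L lam \<alpha> f])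
      then have "\<alpha> * L2_inner L f (\<lambda>x. u x + v x) \<le> \<alpha> * L2_inner L w (\<lambda>x. u x + v x)"
        using u v vL2 by (simp add: dual_bounded_def dual(3))
      then have "L2_inner L f (\<lambda>x. u x + v x) - L2_inner L w (\<lambda>x. u x + v x) \<le> 0" using \<alpha> by simp
      also have "L2_inner L f (\<lambda>x. u x + v x) - L2_inner L w (\<lambda>x. u x + v x) =
          L2_inner L (\<lambda>x. f x - w x) (\<lambda>x. u x + v x)"
        by (rule L2_inner_diff_left[OF uvL2 f dual(1), symmetric])
      also have "\<dots> = (\<integral>x. (u x + v x)\<^sup>2 \<partial>leb L)"
        by (simp add: L2_inner_def w_def power2_eq_square)
      finally have "(\<integral>x. (u x + v x)\<^sup>2 \<partial>leb L) = 0"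
        by (intro antisym integral_nonneg_AE) auto
      then have "AE x in leb L. (u x + v x)\<^sup>2 = 0"
        using integral_nonneg_eq_0_iff_AE[of "leb L" "\<lambda>x. (u x + v x)\<^sup>2"] uvL2 by (simp add: L2_def)
      then have uv0: "AE x in leb L. u x + v x = 0" by eventually_elim simp
      have "L2_inner L w (\<lambda>x. u x + v x) = L2_inner L w (\<lambda>x. 0)"
        unfolding L2_inner_def
        by (rule integral_cong_AE) (use dual(1) uvL2 uv0 in \<open>auto simp: L2_def elim: eventually_mono\<close>)
      then have "reg L lam u v = 0" using dual(3) by (simp add: L2_inner_def)
      from lipd_eq_0_imp_AE_0[OF L v reg_eq_0(2)[OF lam this]] have v0: "AE x in leb L. v x = 0" .
      from uv0 v0 have u0: "AE x in leb L. u x = 0" by eventually_elim simp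
      from u0 v0 have "AE x in leb L. f x - u x - v x = f x" by eventually_elim simp
      with u0 v0 show "(AE x in leb L. u x = 0) \<and> (AE x in leb L. v x = 0) \<and> (AE x in leb L. f x - u x - v x = f x)"
        by blast
    }
    {
      assume "(AE x in leb L. u x = 0) \<and> (AE x in leb L. v x = 0) \<and> (AE x in leb L. f x - u x - v x = f x)"
      then have "AE x in leb L. w x = f x" by (simp add: w_def)
      from star_norm_cong[OF dual(1) f this] dual_bounded_imp_star_norm_le[OF L lam \<alpha> dual(2)]
      show "star_norm L lam f \<le> ereal (1 / \<alpha>)" by simp
    }
  qed
  have part2: "optimal_decomposition L \<alpha> lam f u v \<longleftrightarrow>
      w \<in> L2 L \<and> star_norm L lam w = ereal (1 / \<alpha>) \<and>
      ereal (L2_inner L w (\<lambda>x. u x + v x)) =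
        ereal (1 / \<alpha>) * (total_variation L u + ereal lam * Lip_dual_norm L v)"
    if ge: "star_norm L lam (\<lambda>x. f x - mean L f) \<ge> ereal (1 / \<alpha>)" and u: "u \<in> BV L" and v: "v \<in> H L"
      and w_def: "w = (\<lambda>x. f x - u x - v x)" for u v w
  proof -
    have rhs: "ereal (1 / \<alpha>) * (total_variation L u + ereal lam * Lip_dual_norm L v) = ereal (1 / \<alpha> * reg L lam u v)"
      using regularizer_eq_reg[OF L u v, of lam] by (simp add: regularizer_def)
    have eq_iff: "ereal (L2_inner L w (\<lambda>x. u x + v x)) = ereal (1 / \<alpha> * reg L lam u v) \<longleftrightarrow>
        \<alpha> * L2_inner L w (\<lambda>x. u x + v x) = reg L lam u v"
      using \<alpha> by (auto simp: field_simps)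
    show ?thesis unfolding rhs eq_iff
    proof (intro iffI conjI)
      assume opt: "optimal_decomposition L \<alpha> lam f u v"
      note dual = optimal_imp_dual_conditions[OF L \<alpha> lam f opt, folded w_def]
      show "w \<in> L2 L" "\<alpha> * L2_inner L w (\<lambda>x. u x + v x) = reg L lam u v" by (rule dual)+
      have vL2: "v \<in> L2 L" using residual_L2_imp_L2[OF L f u] dual(1) by (simp add: w_def)
      have "ereal (1 / \<alpha>) \<le> star_norm L lam w"
      proof (cases "reg L lam u v = 0")
        case False
        have "L2_inner L w (\<lambda>x. u x + v x) / reg L lam u v = 1 / \<alpha>"
          using dual(3) False \<alpha> by (auto simp: field_simps)
        with star_norm_ge_quotient[OF L u v vL2 False, of w] show ?thesis by simp
      next
        case True
        (* A minimizer with vanishing regularizer is (mean L f, 0), so the lower bound must come from the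
           hypothesis on f - mean L f. *)
        have u_const: "AE x in leb L. u x = mean L u"
          by (rule tv_eq_0_imp_const[OF L u reg_eq_0(1)[OF lam True]])
        have v_zero: "AE x in leb L. v x = 0"
          by (rule lipd_eq_0_imp_AE_0[OF L v reg_eq_0(2)[OF lam True]])
        have "mean L u = mean L f"
          using opt by (simp add: optimal_decomposition_def admissible_def mean_def)
        with u_const v_zero have "AE x in leb L. w x = f x - mean L f"
          by (auto simp: w_def elim: eventually_elim2)
        from star_norm_cong[OF dual(1) L2_diff[OF f L2_const] this] ge show ?thesis by simp
      qed
      then show "star_norm L lam w = ereal (1 / \<alpha>)"
        using dual_bounded_imp_star_norm_le[OF L lam \<alpha> dual(2)] by (rule antisym[rotated])
    next
      assume "w \<in> L2 L \<and> star_norm L lam w = ereal (1 / \<alpha>) \<and> \<alpha> * L2_inner L w (\<lambda>x. u x + v x) = reg L lam u v"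
      then show "optimal_decomposition L \<alpha> lam f u v"
        using dual_conditions_imp_optimal[OF L \<alpha> lam f u v, folded w_def]
          star_norm_le_imp_dual_bounded[OF L lam \<alpha>, of w] by simp
    qed
  qed
  show ?thesis using part1 part2 unfolding Let_def by blast
qed

end
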